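(* Let $\mathcal A\subseteq\Omega$ be an infinite set that is compact in the quotient topology on $\mathbb R^d/\mathcal V$. Let $f$ be a weak G-type potential such that $$\int_0^\infty\frac{\pi^{d/2}}{t^{d/2}}e^{-\pi^2|w|^2/t}\,d\mu_f(t)>0\qquad\text{for all } w\in\mathcal V^*\setminus\{0\},$$ and such that $\mathcal L_f(\lambda):=\iint K_f^{\mathrm p}(x,y)\,d\lambda(x)\,d\lambda(y)<\infty$ for some $\lambda\in\mathcal M_{+,1}(\mathcal A)$. Let $\nu_f$ be the unique minimizer of $\mathcal L_f$ over $\mathcal M_{+,1}(\mathcal A)$. For each $N\in\mathbb N$, let $\omega_N\in\mathcal A^N$ be a configuration satisfying $E_f^{\mathrm p}(\omega_N)=\mathcal E_f^{\mathrm p}(\mathcal A,N)$. If $\nu_N$ is the measure that assigns weight $N^{-1}$ to each point in $\omega_N$, then $\nu_f$ is the unique weak limit of the measures $\{\nu_N\}_{N\ge2}$ as $N\to\infty$.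
   Context: Let $V$ be a real $d\times d$ matrix with linearly independent columns $v_1,\dots,v_d$ and $\det V=1$; $\mathcal V=\{Vk:k\in\mathbb Z^d\}$; $\mathcal V^*=\{w\in\mathbb R^d: w\cdot v\in\mathbb Z\ \forall v\in\mathcal V\}$; $\Omega=\{\sum_j\alpha_jv_j:\alpha_j\in[0,1)\}$, identified with the fundamental cell of $\mathbb R^d/\mathcal V$ (compact in the quotient topology). $\mathcal M_{+,1}(\mathcal A)$ is the set of positive Borel probability measures with support in $\mathcal A$, the support (and weak convergence) being taken in the topology of $\mathbb R^d/\mathcal V$. $\int_a^b h\,d\mu$ means integration over $[a,b)$ (over $(0,b)$ if $a=0$ and $\mu$ is a measure on $(0,\infty)$). Weak G-type potential: a lower-semicontinuous $f:\mathbb R^d\to\mathbb R\cup\{\infty\}$ for which there are a function $f^*:(0,1)\to\mathbb R$ and a signed measure $\mu_f$ on $(0,\infty)$ with finite negative part such that (W1) for every $q\neq0$, $f(q)$ is finite and $f(q)=\lim_{\alpha\to0^+}\big(\int_\alpha^\infty e^{-|q|^2t}\,d\mu_f(t)+f^*(\alpha)\big)$, where $\int_\alpha^\infty e^{-|q|^2t}\,d\mu_f(t)<\infty$ for all $\alpha>0$; and (W2) if $w_0$ is an element of $\mathcal V^*\setminus\{0\}$ of minimal length, then $\int_0^1 t^{-d/2}e^{-\pi^2|w_0|^2/t}\,d\mu_f(t)<\infty$. The periodic kernel is $$K_f^{\mathrm p}(x,y)=\sum_{v\in\mathcal V}\int_1^\infty e^{-|x-y+v|^2t}\,d\mu_f(t)+\sum_{w\in\mathcal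 V^*\setminus\{0\}}e^{2\pi i w\cdot(x-y)}\int_0^1\frac{\pi^{d/2}}{t^{d/2}}e^{-\pi^2|w|^2/t}\,d\mu_f(t),$$ the periodic energy is $E_f^{\mathrm p}(\omega_N)=\sum_{j\neq k}K_f^{\mathrm p}(x_j,x_k)$ for $\omega_N=(x_j)_{j=1}^N$, and $\mathcal E_f^{\mathrm p}(\mathcal A,N)=\inf_{\omega_N\in\mathcal A^N}E_f^{\mathrm p}(\omega_N)$. (Under the stated hypotheses the minimizer $\nu_f$ of $\mathcal L_f$ exists and is unique.) *)

theory Defs
  imports "HOL-Probability.Probability"
begin

subsection \<open>The lattice, its dual, and the flat torus\<close>

definition period_lattice :: "real^'d^'d \<Rightarrow> (real^'d) set" where
  "period_lattice V = {V *v k | k. \<forall>i. k $ i \<in> \<int>}"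

definition dual_lattice :: "real^'d^'d \<Rightarrow> (real^'d) set" where
  "dual_lattice V = {w. \<forall>v\<in>period_lattice V. w \<bullet> v \<in> \<int>}"

definition fundamental_cell :: "real^'d^'d \<Rightarrow> (real^'d) set" where
  "fundamental_cell V =
     {\<Sum>j\<in>UNIV. \<alpha> j *\<^sub>R column j V | \<alpha>. \<forall>j. 0 \<le> \<alpha> j \<and> \<alpha> j < 1}"

text \<open>
  The quotient topology of \<open>\<real>\<^sup>d / \<V>\<close>, carried over to the fundamental cell by identifying
  each coset with its representative in the cell: a set \<open>U\<close> of representatives is open iff its
  preimage \<open>U + \<V>\<close> under the quotient map \<open>\<real>\<^sup>d \<rightarrow> \<real>\<^sup>d / \<V>\<close> is open.
\<close>

definition torus_topology :: "real^'d^'d \<Rightarrow> (real^'d) topology" where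
  "torus_topology V =
     topology (\<lambda>U. U \<subseteq> fundamental_cell V \<and> open {x. \<exists>u\<in>U. x - u \<in> period_lattice V})"

lemma fundamental_cell_eq:
  "fundamental_cell V = {V *v a | a. \<forall>j. 0 \<le> a $ j \<and> a $ j < 1}" (is "?L = ?R")
proof (intro set_eqI iffI)
  fix x assume "x \<in> ?L"
  then obtain \<alpha> where "x = (\<Sum>j\<in>UNIV. \<alpha> j *\<^sub>R column j V)" "\<forall>j. 0 \<le> \<alpha> j \<and> \<alpha> j < 1"
    unfolding fundamental_cell_def by blast
  then have "x = V *v (\<chi> j. \<alpha> j)" "\<forall>j. 0 \<le> (\<chi> j. \<alpha> j) $ j \<and> (\<chi> j. \<alpha> j) $ j < 1"
    by (simp_all add: matrix_mult_sum scalar_mult_eq_scaleR)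
  then show "x \<in> ?R" by blast
next
  fix x assume "x \<in> ?R"
  then obtain a where a: "x = V *v a" "\<forall>j. 0 \<le> a $ j \<and> a $ j < 1" by blast
  then have "x = (\<Sum>j\<in>UNIV. (\<lambda>j. a $ j) j *\<^sub>R column j V)"
    by (simp add: matrix_mult_sum scalar_mult_eq_scaleR)
  with a(2) show "x \<in> ?L" unfolding fundamental_cell_def by blast
qed

lemma fundamental_cell_unique:
  assumes V: "det V \<noteq> 0" and xy: "x \<in> fundamental_cell V" "y \<in> fundamental_cell V"
    and z: "z - x \<in> period_lattice V" "z - y \<in> period_lattice V"
  shows "x = y"
proof -
  from xy obtain a b where a: "x = V *v a" "\<And>j. 0 \<le> a $ j \<and> a $ j < 1"
    and b: "y = V *v b" "\<And>j. 0 \<le> b $ j \<and> b $ j < 1"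
    unfolding fundamental_cell_eq by blast
  from z obtain k l where k: "z - x = V *v k" "\<And>i. k $ i \<in> \<int>"
    and l: "z - y = V *v l" "\<And>i. l $ i \<in> \<int>"
    unfolding period_lattice_def by blast
  have "V *v (a - b) = x - y"
    by (simp add: a(1) b(1) matrix_vector_mult_diff_distrib)
  also have "\<dots> = (z - y) - (z - x)" by simp
  also have "\<dots> = V *v (l - k)"
    by (simp add: k(1) l(1) matrix_vector_mult_diff_distrib)
  finally have "V *v (a - b) = V *v (l - k)" .
  moreover have "inj ((*v) V)"
    using V by (simp add: inj_matrix_vector_mult invertible_det_nz)
  ultimately have eq: "a - b = l - k" by (simp add: inj_eq)
  have "a $ j = b $ j" for j
  proof -
    have "a $ j - b $ j = l $ j - k $ j" using eq by (metis vector_minus_component)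
    then have "a $ j - b $ j \<in> \<int>" using k(2)[of j] l(2)[of j] by simp
    moreover have "\<bar>a $ j - b $ j\<bar> < 1" using a(2)[of j] b(2)[of j] by linarith
    ultimately show ?thesis using Ints_nonzero_abs_less1[of "a $ j - b $ j"] by simp
  qed
  then have "a = b" by (simp add: vec_eq_iff)
  then show ?thesis using a(1) b(1) by simp
qed

text \<open>The predicate above is a topology, so \<^const>\<open>torus_topology\<close> has the intended open sets.\<close>

lemma openin_torus_topology:
  assumes V: "det V \<noteq> 0"
  shows "openin (torus_topology V) U \<longleftrightarrow>
    U \<subseteq> fundamental_cell V \<and> open {x. \<exists>u\<in>U. x - u \<in> period_lattice V}"
proof -
  let ?sat = "\<lambda>U. {x. \<exists>u\<in>U. x - u \<in> period_lattice V}"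
  have "istopology (\<lambda>U. U \<subseteq> fundamental_cell V \<and> open (?sat U))"
    unfolding istopology_def
  proof (intro conjI allI impI)
    fix S T
    assume S: "S \<subseteq> fundamental_cell V \<and> open (?sat S)"
      and T: "T \<subseteq> fundamental_cell V \<and> open (?sat T)"
    show "S \<inter> T \<subseteq> fundamental_cell V" using S by blast
    have "?sat (S \<inter> T) = ?sat S \<inter> ?sat T"
      (is "?l = ?r")
    proof
      show "?l \<subseteq> ?r" by blast
      show "?r \<subseteq> ?l"
      proof
        fix x assume "x \<in> ?r"
        then obtain u v where u: "u \<in> S" "x - u \<in> period_lattice V"
          and v: "v \<in> T" "x - v \<in> period_lattice V" by blast
        then have "u = v" using fundamental_cell_unique[OF V, of u v x] S T by (simp add: subset_iff)
        then show "x \<in> ?l" using u v by blast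
      qed
    qed
    then show "open (?sat (S \<inter> T))" using S T by (simp only: open_Int)
  next
    fix \<K> assume K: "\<forall>S\<in>\<K>. S \<subseteq> fundamental_cell V \<and> open (?sat S)"
    show "\<Union>\<K> \<subseteq> fundamental_cell V" using K by blast
    have "?sat (\<Union>\<K>) = (\<Union>S\<in>\<K>. ?sat S)" by blast
    moreover have "open (\<Union>S\<in>\<K>. ?sat S)" using K by (intro open_UN) blast
    ultimately show "open (?sat (\<Union>\<K>))" by (simp only:)
  qed
  then show ?thesis unfolding torus_topology_def by simp
qed

definition torus_borel :: "real^'d^'d \<Rightarrow> (real^'d) measure" where
  "torus_borel V = sigma (fundamental_cell V) {U. openin (torus_topology V) U}"

definition torus_support :: "real^'d^'d \<Rightarrow> (real^'d) measure \<Rightarrow> (real^'d) set" where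
  "torus_support V \<rho> =
     {x \<in> fundamental_cell V. \<forall>U. openin (torus_topology V) U \<and> x \<in> U \<longrightarrow> emeasure \<rho> U > 0}"

text \<open>The set \<open>\<M>\<^sub>+\<^sub>,\<^sub>1(A)\<close>; with \<open>A\<close> the whole cell, these are all Borel probability measures
  on the torus.\<close>

definition prob_measures_on :: "real^'d^'d \<Rightarrow> (real^'d) set \<Rightarrow> (real^'d) measure set" where
  "prob_measures_on V A =
     {\<rho>. prob_space \<rho> \<and> sets \<rho> = sets (torus_borel V) \<and> torus_support V \<rho> \<subseteq> A}"

definition weakly_converges ::
    "real^'d^'d \<Rightarrow> (nat \<Rightarrow> (real^'d) measure) \<Rightarrow> (real^'d) measure \<Rightarrow> bool" where
  "weakly_converges V \<nu>s \<nu> \<longleftrightarrow>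
     (\<forall>g :: real^'d \<Rightarrow> real.
        continuous_map (torus_topology V) euclideanreal g \<and> bounded (g ` fundamental_cell V) \<longrightarrow>
        (\<lambda>N. integral\<^sup>L (\<nu>s N) g) \<longlonglongrightarrow> integral\<^sup>L \<nu> g)"

subsection \<open>Signed measures and weak G-type potentials\<close>

text \<open>
  A signed measure on \<open>(0,\<infinity>)\<close> is given by its Jordan decomposition, the pair of its positive and
  negative parts; these are the pairs of mutually singular measures. Only the negative part is
  required to be finite.
\<close>

type_synonym signed_measure = "real measure \<times> real measure"

definition signed_measure_finite_neg :: "signed_measure \<Rightarrow> bool" where
  "signed_measure_finite_neg \<mu> \<longleftrightarrow>
     sets (fst \<mu>) = sets (restrict_space borel {0<..}) \<and>
     sets (snd \<mu>) = sets (restrict_space borel {0<..}) \<and>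
     (\<exists>P \<in> sets (restrict_space borel {0<..}).
        emeasure (snd \<mu>) P = 0 \<and> emeasure (fst \<mu>) ({0<..} - P) = 0) \<and>
     finite_measure (snd \<mu>)"

text \<open>
  Meant for \<open>h \<ge> 0\<close>. All integrands below are nonnegative and bounded on the set of integration,
  so the subtracted integral is finite; the value may be \<open>\<infinity>\<close>.
\<close>

definition signed_integral :: "signed_measure \<Rightarrow> real set \<Rightarrow> (real \<Rightarrow> real) \<Rightarrow> ereal" where
  "signed_integral \<mu> S h =
     enn2ereal (\<integral>\<^sup>+t\<in>S. ennreal (h t) \<partial>fst \<mu>) - enn2ereal (\<integral>\<^sup>+t\<in>S. ennreal (h t) \<partial>snd \<mu>)"

definition weak_G_type ::
    "real^'d^'d \<Rightarrow> (real^'d \<Rightarrow> ereal) \<Rightarrow> signed_measure \<Rightarrow> bool" where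
  "weak_G_type V f \<mu> \<longleftrightarrow>
     (\<forall>q. f q \<noteq> -\<infinity>) \<and>
     (\<forall>c. open {q. c < f q}) \<and>
     signed_measure_finite_neg \<mu> \<and>
     (\<exists>fstar :: real \<Rightarrow> real. \<forall>q. q \<noteq> 0 \<longrightarrow>
        \<bar>f q\<bar> \<noteq> \<infinity> \<and>
        (\<forall>\<alpha>>0. signed_integral \<mu> {\<alpha>..} (\<lambda>t. exp (- (norm q)\<^sup>2 * t)) < \<infinity>) \<and>
        ((\<lambda>\<alpha>. signed_integral \<mu> {\<alpha>..} (\<lambda>t. exp (- (norm q)\<^sup>2 * t)) + ereal (fstar \<alpha>))
           \<longlongrightarrow> f q) (at_right 0)) \<and>
     (\<forall>w\<^sub>0 \<in> dual_lattice V - {0}. (\<forall>w \<in> dual_lattice V - {0}. norm w\<^sub>0 \<le> norm w) \<longrightarrow>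
        signed_integral \<mu> {0<..<1}
          (\<lambda>t. t powr (- real CARD('d) / 2) * exp (- pi\<^sup>2 * (norm w\<^sub>0)\<^sup>2 / t)) < \<infinity>)"

subsection \<open>The periodic kernel and energies\<close>

definition dual_heat :: "real^'d \<Rightarrow> real \<Rightarrow> real" where
  "dual_heat w t =
     pi powr (real CARD('d) / 2) / t powr (real CARD('d) / 2) * exp (- pi\<^sup>2 * (norm w)\<^sup>2 / t)"

text \<open>
  The first sum takes values in \<open>(-\<infinity>,\<infinity>]\<close>. The second is an absolutely convergent complex series
  with finite coefficients; its sum is real because the terms of \<open>w\<close> and \<open>-w\<close> are conjugate.
\<close>

definition periodic_kernel ::
    "real^'d^'d \<Rightarrow> signed_measure \<Rightarrow> real^'d \<Rightarrow> real^'d \<Rightarrow> ereal" where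
  "periodic_kernel V \<mu> x y =
     (\<Sum>\<^sub>\<infinity>v\<in>period_lattice V.
        signed_integral \<mu> {1..} (\<lambda>t. exp (- (norm (x - y + v))\<^sup>2 * t)))
     + ereal (Re (\<Sum>\<^sub>\<infinity>w\<in>dual_lattice V - {0}.
        exp (2 * complex_of_real pi * \<i> * complex_of_real (w \<bullet> (x - y))) *
        complex_of_real (real_of_ereal (signed_integral \<mu> {0<..<1} (dual_heat w)))))"

definition periodic_energy ::
    "real^'d^'d \<Rightarrow> signed_measure \<Rightarrow> nat \<Rightarrow> (nat \<Rightarrow> real^'d) \<Rightarrow> ereal" where
  "periodic_energy V \<mu> N \<omega> =
     (\<Sum>j<N. \<Sum>k\<in>{..<N} - {j}. periodic_kernel V \<mu> (\<omega> j) (\<omega> k))"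

definition minimal_periodic_energy ::
    "real^'d^'d \<Rightarrow> signed_measure \<Rightarrow> (real^'d) set \<Rightarrow> nat \<Rightarrow> ereal" where
  "minimal_periodic_energy V \<mu> A N =
     (INF \<omega> \<in> {..<N} \<rightarrow>\<^sub>E A. periodic_energy V \<mu> N \<omega>)"

definition ereal_integral :: "'a measure \<Rightarrow> ('a \<Rightarrow> ereal) \<Rightarrow> ereal" where
  "ereal_integral M g =
     enn2ereal (\<integral>\<^sup>+z. e2ennreal (g z) \<partial>M) - enn2ereal (\<integral>\<^sup>+z. e2ennreal (- g z) \<partial>M)"

definition continuous_energy ::
    "real^'d^'d \<Rightarrow> signed_measure \<Rightarrow> (real^'d) measure \<Rightarrow> ereal" where
  "continuous_energy V \<mu> \<rho> =
     ereal_integral (\<rho> \<Otimes>\<^sub>M \<rho>) (\<lambda>(x, y). periodic_kernel V \<mu> x y)"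

text \<open>Points of the configuration are counted with multiplicity.\<close>

definition normalized_counting_measure ::
    "real^'d^'d \<Rightarrow> nat \<Rightarrow> (nat \<Rightarrow> real^'d) \<Rightarrow> (real^'d) measure" where
  "normalized_counting_measure V N \<omega> =
     distr (uniform_count_measure {..<N}) (torus_borel V) \<omega>"

end

theory Submission
  imports Defs
begin

text \<open>
  By Poisson summation the truncation of the periodic kernel at \<open>t \<le> n\<close> is an absolutely
  convergent cosine series over the dual lattice; its coefficients increase with \<open>n\<close> and each of
  them with \<open>w \<noteq> 0\<close> is eventually positive. Hence the energy of a measure is the increasing limit
  of the quadratic forms \<open>\<Sum>w. a n w * \<bar>c w\<bar>\<^sup>2\<close> in its Fourier coefficients \<open>c w\<close>, and the parallelogram
  identity for a measure halfway between two minimizers shows that they have the same coefficients.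
  Averaging over independent points bounds the minimal energy of \<open>N\<close> points by \<open>N (N - 1)\<close> times the
  minimal continuous energy. As the truncated forms are weakly continuous, every weak limit of the
  counting measures along a subsequence is a minimizer, and the theorem follows by compactness.
\<close>

text \<open>The positive part of \<open>\<mu>\<close> may have infinite mass on
  \<open>[1,\<infinity>)\<close>, so the kernel may be infinite on the diagonal and need not have a
  convergent Fourier series. Truncation makes the diagonal finite: it then costs only
  \<open>trunc n 0 / N\<close> in the averages, and \<open>N\<close> tends to infinity before
  \<open>n\<close> does. The negative part is finite and is never truncated; this is what makes the
  coefficients increase. For a fixed \<open>n\<close> infinitely many coefficients may still be
  negative, and the one at \<open>w = 0\<close> may have either sign. The negative ones are
  dominated by the summable \<open>a 0\<close> and fade out in the limit, while the mode
  \<open>w = 0\<close> cancels because all competitors have mass 1. Hence strict convexity is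
  obtained only in the limit, as a gap that persists for all large \<open>n\<close>. Compactness
  comes from a continuous curve that fills the cell: the counting measures are lifted to
  \<open>[0,1]\<close>, where tightness yields a convergent subsequence. Functions on the torus are
  treated as periodic functions on the whole space, and lattice sums as integrals over a counting
  measure, so that Fubini and dominated convergence apply to them.\<close>

definition unit_cell :: "(real^'d) set" where
  "unit_cell = {a. \<forall>j. 0 \<le> a $ j \<and> a $ j < 1}"

lemma unit_cell_borel [measurable]: "(unit_cell :: (real^'d) set) \<in> sets borel"
proof -
  have eq: "unit_cell = (\<Inter>j. {a :: real^'d. 0 \<le> a $ j} \<inter> {a. a $ j < 1})" by (auto simp: unit_cell_def)
  have "closed {a :: real^'d. 0 \<le> a $ j}" "open {a :: real^'d. a $ j < 1}" for j
    by (intro closed_Collect_le open_Collect_less continuous_intros)+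
  then show ?thesis unfolding eq by (intro sets.finite_INT) auto
qed

lemma emeasure_unit_cell: "emeasure lborel (unit_cell :: (real^'d) set) = 1"
proof (rule antisym)
  have C: "box 0 1 \<subseteq> (unit_cell :: (real^'d) set)" "(unit_cell :: (real^'d) set) \<subseteq> cbox 0 1"
    by (auto simp: unit_cell_def mem_box_cart less_imp_le)
  have le: "b \<in> Basis \<Longrightarrow> 0 \<bullet> b \<le> 1 \<bullet> b" and ip: "b \<in> Basis \<Longrightarrow> 1 \<bullet> b = 1" for b :: "real^'d"
    by (auto simp: Basis_vec_def inner_axis)
  show "emeasure lborel (unit_cell :: (real^'d) set) \<le> 1"
    using emeasure_mono[OF C(2), of lborel] le by (simp add: ip)
  show "1 \<le> emeasure lborel (unit_cell :: (real^'d) set)"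
    using emeasure_mono[OF C(1), of lborel] le by (simp add: ip)
qed

section \<open>Linear maps and Lebesgue measure\<close>

lemma borel_measurable_matrix_vector_mult [measurable]:
  "(\<lambda>x. (A :: real^'n^'m) *v x) \<in> borel_measurable borel"
  by (intro borel_measurable_continuous_onI bounded_linear.continuous_on[OF matrix_vector_mul_bounded_linear])
    (rule continuous_on_id)

lemma nn_integral_lborel_shift:
  fixes c :: "'a::euclidean_space"
  assumes [measurable]: "F \<in> borel_measurable borel"
  shows "(\<integral>\<^sup>+x. F (c + x) \<partial>lborel) = (\<integral>\<^sup>+x. F x \<partial>lborel)"
proof -
  have "(\<integral>\<^sup>+x. F x \<partial>lborel) = (\<integral>\<^sup>+x. F x \<partial>distr lborel borel ((+) c))"
    by (simp add: lborel_distr_plus)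
  also have "\<dots> = (\<integral>\<^sup>+x. F (c + x) \<partial>lborel)"
    by (subst nn_integral_distr) simp_all
  finally show ?thesis by simp
qed

text \<open>Uniqueness of translation-invariant measures; the library's change of variables for
  linear maps needs a well-ordered index type.\<close>

lemma emeasure_linear_vimage:
  fixes A :: "real^'d^'d"
  assumes inv: "A ** B = mat 1" and [measurable]: "S \<in> sets borel"
  shows "emeasure lborel {x. A *v x \<in> S} = emeasure lborel S * emeasure lborel {x. A *v x \<in> unit_cell}"
proof -
  define i where "i T x = (indicator T x :: ennreal)" for T :: "(real^'d) set" and x
  have [measurable]: "i T \<in> borel_measurable borel" if "T \<in> sets borel" for T
    using that unfolding i_def by measurable
  have AB: "A *v (B *v y) = y" for y
    by (simp add: matrix_vector_mul_assoc inv)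
  have m: "emeasure lborel T = (\<integral>\<^sup>+x. i T x \<partial>lborel)" if "T \<in> sets borel" for T
    using that by (simp add: i_def)
  have mA: "emeasure lborel {x. A *v x \<in> T} = (\<integral>\<^sup>+x. i T (A *v x) \<partial>lborel)" if [measurable]: "T \<in> sets borel" for T
  proof -
    have "{x \<in> space lborel. A *v x \<in> T} \<in> sets lborel" by measurable
    moreover have "(\<integral>\<^sup>+x. i T (A *v x) \<partial>lborel) = (\<integral>\<^sup>+x. indicator {x. A *v x \<in> T} x \<partial>lborel)"
      by (intro nn_integral_cong) (simp add: i_def indicator_def)
    ultimately show ?thesis by simp
  qed
  \<comment> \<open>Insert the factor 1 as the integral of the indicator of
    \<open>unit_cell\<close>, translate \<open>y\<close> by \<open>- (A *v x)\<close>, exchange the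
    integrals and translate \<open>x\<close> by \<open>B *v y\<close>. The variable \<open>y\<close>
    then survives only in the indicator of \<open>T\<close>, where it integrates to the measure of
    \<open>T\<close>.\<close>
  have key: "emeasure lborel {x. A *v x \<in> T} = emeasure lborel T * (\<integral>\<^sup>+x. i unit_cell (- (A *v x)) \<partial>lborel)"
    if [measurable]: "T \<in> sets borel" for T
  proof -
    have "emeasure lborel {x. A *v x \<in> T} =
      (\<integral>\<^sup>+x. i T (A *v x) * (\<integral>\<^sup>+y. i unit_cell y \<partial>lborel) \<partial>lborel)"
      by (simp add: mA[OF that] m[symmetric] emeasure_unit_cell)
    also have "\<dots> = (\<integral>\<^sup>+x. \<integral>\<^sup>+y. i T (A *v x) * i unit_cell (- (A *v x) + y) \<partial>lborel \<partial>lborel)"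
    proof (rule nn_integral_cong)
      fix x
      show "i T (A *v x) * (\<integral>\<^sup>+y. i unit_cell y \<partial>lborel) =
          (\<integral>\<^sup>+y. i T (A *v x) * i unit_cell (- (A *v x) + y) \<partial>lborel)"
        using nn_integral_lborel_shift[of "i unit_cell" "- (A *v x)"] by (simp add: nn_integral_cmult)
    qed
    also have "\<dots> = (\<integral>\<^sup>+y. \<integral>\<^sup>+x. i T (A *v x) * i unit_cell (- (A *v x) + y) \<partial>lborel \<partial>lborel)"
      by (rule lborel_pair.Fubini'[symmetric]) simp
    also have "\<dots> = (\<integral>\<^sup>+y. \<integral>\<^sup>+x. i T (A *v x + y) * i unit_cell (- (A *v x)) \<partial>lborel \<partial>lborel)"
    proof (rule nn_integral_cong)
      fix y
      show "(\<integral>\<^sup>+x. i T (A *v x) * i unit_cell (- (A *v x) + y) \<partial>lborel) =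
          (\<integral>\<^sup>+x. i T (A *v x + y) * i unit_cell (- (A *v x)) \<partial>lborel)"
        by (subst nn_integral_lborel_shift[where c = "B *v y", symmetric])
          (simp_all add: matrix_vector_right_distrib AB add.commute)
    qed
    also have "\<dots> = (\<integral>\<^sup>+x. \<integral>\<^sup>+y. i T (A *v x + y) * i unit_cell (- (A *v x)) \<partial>lborel \<partial>lborel)"
      by (rule lborel_pair.Fubini') simp
    also have "\<dots> = (\<integral>\<^sup>+x. emeasure lborel T * i unit_cell (- (A *v x)) \<partial>lborel)"
      by (simp add: nn_integral_multc nn_integral_lborel_shift[of "i T"] m[symmetric])
    finally show ?thesis by (simp add: nn_integral_cmult)
  qed
  \<comment> \<open>The factor in \<open>key\<close> involves \<open>- (A *v x)\<close>; the case
    \<open>T = unit_cell\<close> replaces it by the factor with \<open>A *v x\<close>.\<close>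
  show ?thesis
    using key[of S] key[of unit_cell] by (simp add: emeasure_unit_cell)
qed

text \<open>By \<open>emeasure_linear_vimage\<close> the factor \<open>\<kappa>\<close> is
  multiplicative on invertible matrices, and so is the absolute determinant. It suffices to compare
  them on the generators of the matrix induction: diagonal matrices, transpositions and
  shears.\<close>

lemma emeasure_vimage_unit_cell:
  fixes A :: "real^'d^'d"
  assumes "det A \<noteq> 0"
  shows "emeasure lborel {x. A *v x \<in> unit_cell} * ennreal \<bar>det A\<bar> = 1"
proof -
  define \<kappa> where "\<kappa> A = emeasure lborel {x :: real^'d. A *v x \<in> unit_cell}" for A :: "real^'d^'d"
  have ex_inv: "\<exists>B. A ** B = mat 1" if "det A \<noteq> 0" for A :: "real^'d^'d"
    using that invertible_det_nz[of A] unfolding invertible_def by blast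
  have \<kappa>_mult: "\<kappa> (A ** B) = \<kappa> A * \<kappa> B" if "det A \<noteq> 0" "det B \<noteq> 0" for A B
  proof -
    from ex_inv[OF that(2)] obtain B' where B': "B ** B' = mat 1" ..
    have "{x. (A ** B) *v x \<in> unit_cell} = {x. B *v x \<in> {y. A *v y \<in> unit_cell}}"
      by (simp add: matrix_vector_mul_assoc)
    then show ?thesis
      unfolding \<kappa>_def using emeasure_linear_vimage[OF B', of "{y. A *v y \<in> unit_cell}"] by simp
  qed
  have \<kappa>_1: "\<kappa> (mat 1) = 1"
    by (simp add: \<kappa>_def emeasure_unit_cell)
  have \<kappa>_pos: "\<kappa> A \<noteq> 0 \<and> \<kappa> A \<noteq> \<top>" if A: "det A \<noteq> 0" for A
  proof -
    from ex_inv[OF A] obtain B where B: "A ** B = mat 1" ..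
    then have "det B \<noteq> 0" using det_mul[of A B] by auto
    then have "\<kappa> A * \<kappa> B = 1" using \<kappa>_mult[OF A] B \<kappa>_1 by metis
    then show ?thesis by (auto simp: ennreal_top_mult split: if_splits)
  qed
  have "det A \<noteq> 0 \<longrightarrow> \<kappa> A * ennreal \<bar>det A\<bar> = 1"
  proof (induction rule: induct_matrix_elementary_alt)
    case (1 A B)
    show ?case
    proof
      assume "det (A ** B) \<noteq> 0"
      then have d: "det A \<noteq> 0" "det B \<noteq> 0" by (auto simp: det_mul)
      have "\<kappa> (A ** B) * ennreal \<bar>det (A ** B)\<bar> = (\<kappa> A * ennreal \<bar>det A\<bar>) * (\<kappa> B * ennreal \<bar>det B\<bar>)"
        by (simp add: \<kappa>_mult[OF d] det_mul abs_mult ennreal_mult ac_simps)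
      then show "\<kappa> (A ** B) * ennreal \<bar>det (A ** B)\<bar> = 1" using 1 d by simp
    qed
  next
    case (2 A i)
    then show ?case by (simp add: det_zero_row)
  next
    case (3 A)
    show ?case
    proof
      assume "det A \<noteq> 0"
      then have nz: "A $ j $ j \<noteq> 0" for j using 3 by (auto simp: det_diagonal)
      define c where "c b = (\<Sum>j\<in>UNIV. A $ j $ j * b $ j)" for b :: "real^'d"
      have c: "c (axis i 1) = A $ i $ i" for i
        by (simp add: c_def axis_def if_distrib[of "\<lambda>x. _ * x"] cong: if_cong)
      have B: "(Basis :: (real^'d) set) = (\<lambda>i. axis i 1) ` UNIV"
        by (auto simp: Basis_vec_def)
      have inj: "inj (\<lambda>i::'d. axis i (1::real))"
        by (simp add: inj_on_def axis_eq_axis)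
      \<comment> \<open>The shape that \<open>lborel_affine_euclidean\<close> asks for, with
        translation part 0.\<close>
      define T where "T x = 0 + (\<Sum>b\<in>Basis. (c b * (x \<bullet> b)) *\<^sub>R b)" for x
      have T: "T x = A *v x" for x
      proof -
        have "(A *v x) $ i = A $ i $ i * x $ i" for i
        proof -
          have "(A *v x) $ i = (\<Sum>j\<in>UNIV. if j = i then A $ i $ i * x $ i else 0)"
            unfolding matrix_vector_mult_def vec_lambda_beta
          proof (rule sum.cong)
            fix j show "A $ i $ j * x $ j = (if j = i then A $ i $ i * x $ i else 0)"
              using 3[of i j] by auto
          qed simp
          then show ?thesis by simp
        qed
        moreover have "T x $ i = A $ i $ i * x $ i" for i
        proof -
          have "T x = (\<Sum>j\<in>UNIV. (A $ j $ j * x $ j) *\<^sub>R axis j 1)"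
            unfolding T_def B by (subst sum.reindex[OF inj]) (simp add: c inner_axis)
          then have "T x $ i = (\<Sum>j\<in>UNIV. if j = i then A $ i $ i * x $ i else 0)"
            by (simp add: axis_def if_distrib[of "\<lambda>x. _ * x"] cong: if_cong)
          then show ?thesis by simp
        qed
        ultimately show ?thesis by (simp add: vec_eq_iff)
      qed
      have "c b \<noteq> 0" if "b \<in> Basis" for b
        using that nz unfolding B by (auto simp: c)
      from lborel_affine_euclidean[where t=0, OF this]
      have "lborel = density (distr lborel borel T) (\<lambda>_. ennreal (\<Prod>j\<in>Basis. \<bar>c j\<bar>))"
        by (simp add: T_def[abs_def])
      moreover have "(\<Prod>j\<in>Basis. \<bar>c j\<bar>) = \<bar>det A\<bar>"
        unfolding B using 3 by (subst prod.reindex[OF inj]) (simp add: c det_diagonal abs_prod)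
      moreover have "T = (*v) A" using T by auto
      ultimately have "lborel = density (distr lborel borel ((*v) A)) (\<lambda>_. ennreal \<bar>det A\<bar>)"
        by simp
      then have "emeasure lborel (unit_cell :: (real^'d) set) =
          emeasure (density (distr lborel borel ((*v) A)) (\<lambda>_. ennreal \<bar>det A\<bar>)) unit_cell"
        by simp
      also have "\<dots> = ennreal \<bar>det A\<bar> * \<kappa> A"
        by (subst emeasure_density_const) (simp_all add: emeasure_distr \<kappa>_def vimage_def)
      finally show "\<kappa> A * ennreal \<bar>det A\<bar> = 1"
        by (simp add: emeasure_unit_cell mult.commute)
    qed
  next
    case (4 m n)
    let ?A = "(\<chi> i j. mat 1 $ i $ Transposition.transpose m n j) :: real^'d^'d"
    have "(?A *v x) $ i = x $ Transposition.transpose m n i" for x i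
    proof -
      have "(?A *v x) $ i = (\<Sum>j\<in>UNIV. if j = Transposition.transpose m n i then x $ j else 0)"
        unfolding matrix_vector_mult_def vec_lambda_beta mat_def
        by (intro sum.cong) (auto simp: transpose_eq_iff)
      then show ?thesis by simp
    qed
    \<comment> \<open>A transposition is an involution, so the absolute determinant and
      \<open>\<kappa>\<close> both have square 1.\<close>
    then have AA: "?A ** ?A = mat 1"
      by (subst matrix_eq) (simp add: vec_eq_iff flip: matrix_vector_mul_assoc)
    show ?case
    proof
      assume d: "det ?A \<noteq> 0"
      have "det ?A * det ?A = 1" using AA det_mul[of ?A ?A] by simp
      then have "\<bar>det ?A\<bar> = 1" by (metis abs_mult_self_eq abs_1 abs_ge_zero mult_1 real_sqrt_abs2 real_sqrt_one)
      moreover have "\<kappa> ?A * \<kappa> ?A = 1" using \<kappa>_mult[OF d d] AA \<kappa>_1 by simp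
      then have "\<kappa> ?A = 1"
        using \<kappa>_pos[OF d] by (cases "\<kappa> ?A" rule: ennreal_cases)
          (auto simp flip: ennreal_mult simp: ennreal_eq_1 square_eq_1_iff)
      ultimately show "\<kappa> ?A * ennreal \<bar>det ?A\<bar> = 1" by simp
    qed
  next
    case (5 m n)
    define S :: "real^'d^'d" where "S = (\<chi> i j. of_bool (i = m \<and> j = n \<or> i = j))"
    define D :: "real^'d^'d" where "D = (\<chi> i j. if i = j then if i = m then 2 else 1 else 0)"
    have Sv: "(S *v x) $ i = (if i = m then x $ m + x $ n else x $ i)" for x i
    proof -
      have "(S *v x) $ i = (\<Sum>j\<in>UNIV. (if j = i then x $ j else 0) + (if j = n \<and> i = m then x $ j else 0))"
        unfolding matrix_vector_mult_def S_def using 5 by (auto intro!: sum.cong)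
      then show ?thesis using 5 by (simp add: sum.distrib)
    qed
    have Dv: "(D *v x) $ i = (if i = m then 2 * x $ i else x $ i)" for x i
    proof -
      have "(D *v x) $ i = (\<Sum>j\<in>UNIV. if j = i then (if i = m then 2 * x $ i else x $ i) else 0)"
        unfolding matrix_vector_mult_def D_def vec_lambda_beta by (intro sum.cong) auto
      then show ?thesis by simp
    qed
    \<comment> \<open>Conjugation by \<open>D\<close> doubles the shear, which turns
      \<open>S\<close> into its square. A multiplicative function with finite nonzero values must
      therefore be 1 at \<open>S\<close>.\<close>
    have comm: "D ** S = (S ** S) ** D"
      using 5 by (subst matrix_eq) (simp add: vec_eq_iff Sv Dv flip: matrix_vector_mul_assoc)
    have dD: "det D \<noteq> 0" unfolding D_def by (subst det_diagonal) auto
    show ?case unfolding S_def[symmetric]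
    proof
      assume d: "det S \<noteq> 0"
      have "det D * det S = det S * det S * det D"
        using arg_cong[OF comm, of det] by (simp add: det_mul)
      then have "det S = 1" using d dD by simp
      have "\<kappa> D * \<kappa> S = \<kappa> S * \<kappa> S * \<kappa> D"
        using arg_cong[OF comm, of \<kappa>] d dD by (simp add: \<kappa>_mult det_mul)
      then have "\<kappa> S = 1"
        using \<kappa>_pos[OF d] \<kappa>_pos[OF dD]
        by (cases "\<kappa> S" rule: ennreal_cases; cases "\<kappa> D" rule: ennreal_cases)
          (auto simp flip: ennreal_mult simp: ennreal_eq_1)
      with \<open>det S = 1\<close> show "\<kappa> S * ennreal \<bar>det S\<bar> = 1" by simp
    qed
  qed
  then show ?thesis using assms by (simp add: \<kappa>_def)
qed

section \<open>The lattice, its fundamental cell and the unfolding of integrals\<close>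

locale unimodular_lattice =
  fixes V :: "real^'d^'d"
  assumes det_V: "det V = 1"
begin

abbreviation "\<Lambda> \<equiv> period_lattice V"
abbreviation "cell \<equiv> fundamental_cell V"

definition coord :: "real^'d \<Rightarrow> real^'d" where
  "coord x = matrix_inv V *v x"

text \<open>The quotient map onto the torus, with values in the cell. Sets and functions on the
  torus are handled through their pullbacks under it: saturated sets and periodic functions.\<close>

definition cell_rep :: "real^'d \<Rightarrow> real^'d" where
  "cell_rep x = V *v (\<chi> j. frac (coord x $ j))"

lemma V_inverse: "V ** matrix_inv V = mat 1" "matrix_inv V ** V = mat 1"
proof -
  have "invertible V" using det_V by (simp add: invertible_det_nz)
  then have "\<exists>A'. V ** A' = mat 1 \<and> A' ** V = mat 1" by (simp add: invertible_def)
  then have "V ** matrix_inv V = mat 1 \<and> matrix_inv V ** V = mat 1"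
    unfolding matrix_inv_def by (rule someI_ex)
  then show "V ** matrix_inv V = mat 1" "matrix_inv V ** V = mat 1" by auto
qed

lemma V_coord [simp]: "V *v coord x = x"
  by (simp add: coord_def matrix_vector_mul_assoc V_inverse)

lemma coord_V [simp]: "coord (V *v a) = a"
  by (simp add: coord_def matrix_vector_mul_assoc V_inverse)

lemma coord_add: "coord (x + y) = coord x + coord y"
  by (simp add: coord_def matrix_vector_right_distrib)

lemma coord_diff: "coord (x - y) = coord x - coord y"
  by (simp add: coord_def matrix_vector_mult_diff_distrib)

lemma continuous_on_coord [continuous_intros]:
  "continuous_on S f \<Longrightarrow> continuous_on S (\<lambda>x. coord (f x))"
  unfolding coord_def by (rule bounded_linear.continuous_on[OF matrix_vector_mul_bounded_linear])

lemma in_lattice_iff: "x \<in> \<Lambda> \<longleftrightarrow> (\<forall>j. coord x $ j \<in> \<int>)"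
proof
  assume "x \<in> \<Lambda>" then show "\<forall>j. coord x $ j \<in> \<int>" by (auto simp: period_lattice_def)
next
  assume "\<forall>j. coord x $ j \<in> \<int>"
  moreover have "x = V *v coord x" by simp
  ultimately show "x \<in> \<Lambda>" unfolding period_lattice_def by blast
qed

lemma in_cell_iff: "x \<in> cell \<longleftrightarrow> (\<forall>j. 0 \<le> coord x $ j \<and> coord x $ j < 1)"
proof
  assume "x \<in> cell" then show "\<forall>j. 0 \<le> coord x $ j \<and> coord x $ j < 1" by (auto simp: fundamental_cell_eq)
next
  assume "\<forall>j. 0 \<le> coord x $ j \<and> coord x $ j < 1"
  moreover have "x = V *v coord x" by simp
  ultimately show "x \<in> cell" unfolding fundamental_cell_eq by blast
qed

lemma lattice_0 [simp]: "0 \<in> \<Lambda>"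
  by (simp add: in_lattice_iff coord_def)

lemma lattice_add: "x \<in> \<Lambda> \<Longrightarrow> y \<in> \<Lambda> \<Longrightarrow> x + y \<in> \<Lambda>"
  by (simp add: in_lattice_iff coord_add)

lemma lattice_diff: "x \<in> \<Lambda> \<Longrightarrow> y \<in> \<Lambda> \<Longrightarrow> x - y \<in> \<Lambda>"
  by (simp add: in_lattice_iff coord_diff)

lemma lattice_uminus_iff: "- x \<in> \<Lambda> \<longleftrightarrow> x \<in> \<Lambda>"
  using lattice_diff[of 0 x] lattice_diff[of 0 "-x"] by auto

lemma coord_cell_rep: "coord (cell_rep x) $ j = frac (coord x $ j)"
  by (simp add: cell_rep_def)

lemma cell_rep_in_cell [simp]: "cell_rep x \<in> cell"
  by (simp add: in_cell_iff coord_cell_rep frac_ge_0 frac_lt_1)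

lemma diff_cell_rep_in_lattice: "x - cell_rep x \<in> \<Lambda>"
  by (simp add: in_lattice_iff coord_diff coord_cell_rep frac_def)

lemma cell_rep_unique: "u \<in> cell \<Longrightarrow> x - u \<in> \<Lambda> \<Longrightarrow> u = cell_rep x"
  using fundamental_cell_unique[of V u "cell_rep x" x] det_V diff_cell_rep_in_lattice by simp

lemma cell_rep_cell [simp]: "u \<in> cell \<Longrightarrow> cell_rep u = u"
  using cell_rep_unique[of u u] by simp

lemma countable_lattice: "countable \<Lambda>"
proof -
  have "\<Lambda> = (\<lambda>k :: 'd \<Rightarrow> int. V *v (\<chi> j. of_int (k j))) ` UNIV"
  proof (intro equalityI subsetI)
    fix x assume "x \<in> \<Lambda>"
    then have "coord x $ j = of_int \<lfloor>coord x $ j\<rfloor>" for j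
      by (auto simp: in_lattice_iff Ints_def image_iff dest!: spec[of _ j])
    then have "coord x = (\<chi> j. of_int \<lfloor>coord x $ j\<rfloor>)" by (simp add: vec_eq_iff)
    then have "x = V *v (\<chi> j. of_int \<lfloor>coord x $ j\<rfloor>)" by (metis V_coord)
    then show "x \<in> range (\<lambda>k :: 'd \<Rightarrow> int. V *v (\<chi> j. of_int (k j)))" 
      by (rule range_eqI[where x="\<lambda>j. \<lfloor>coord x $ j\<rfloor>"])
  qed (auto simp: in_lattice_iff)
  then show ?thesis by (metis countableI_type countable_image)
qed

lemma borel_measurable_coord [measurable]: "coord \<in> borel_measurable borel"
  by (intro borel_measurable_continuous_onI continuous_intros)

lemma cell_borel [measurable]: "cell \<in> sets borel"
proof -
  have "cell = (\<Inter>j. {x. 0 \<le> coord x $ j} \<inter> {x. coord x $ j < 1})"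
    by (auto simp: in_cell_iff)
  moreover have "closed {x. 0 \<le> coord x $ j}" "open {x. coord x $ j < 1}" for j
    by (intro closed_Collect_le open_Collect_less continuous_intros)+
  ultimately show ?thesis by auto
qed

lemma bounded_cell: "bounded cell"
proof -
  have "cell \<subseteq> (*v) V ` cbox 0 1"
  proof
    fix x assume "x \<in> cell"
    then have "coord x \<in> cbox 0 1" by (auto simp: in_cell_iff mem_box_cart less_imp_le)
    then show "x \<in> (*v) V ` cbox 0 1" by (metis V_coord image_eqI)
  qed
  moreover have "compact ((*v) V ` cbox 0 1)"
    by (intro compact_continuous_image continuous_intros compact_cbox)
  ultimately show ?thesis using bounded_subset compact_imp_bounded by blast
qed

text \<open>The translates of the cell tile the space, so the indicators of
  \<open>x - v \<in> cell\<close> sum to 1 over the lattice. Insert this sum, exchange it with the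
  integral and translate by \<open>v\<close>.\<close>

lemma nn_integral_unfold:
  assumes [measurable]: "F \<in> borel_measurable borel"
  shows "(\<integral>\<^sup>+x. F x \<partial>lborel) =
    (\<integral>\<^sup>+x. (\<integral>\<^sup>+v. F (x + v) \<partial>count_space \<Lambda>) * indicator cell x \<partial>lborel)"
proof -
  have "(\<integral>\<^sup>+v. F x * indicator cell (x - v) \<partial>count_space \<Lambda>) = F x" for x
  proof -
    have "(\<integral>\<^sup>+v. F x * indicator cell (x - v) \<partial>count_space \<Lambda>) =
          (\<integral>\<^sup>+v. F x * indicator {x - cell_rep x} v \<partial>count_space \<Lambda>)"
    proof (rule nn_integral_cong)
      fix v assume "v \<in> space (count_space \<Lambda>)"
      then have v: "v \<in> \<Lambda>" by simp
      have "x - v \<in> cell \<longleftrightarrow> v = x - cell_rep x"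
        using cell_rep_unique[of "x - v" x] v cell_rep_in_cell[of x]
        by (metis add_diff_cancel_left' diff_add_cancel diff_diff_eq2)
      then show "F x * indicator cell (x - v) = F x * indicator {x - cell_rep x} v"
        by (auto simp: indicator_def)
    qed
    then show ?thesis by (simp add: diff_cell_rep_in_lattice nn_integral_cmult)
  qed
  then have "(\<integral>\<^sup>+x. F x \<partial>lborel) =
      (\<integral>\<^sup>+x. (\<integral>\<^sup>+v. F x * indicator cell (x - v) \<partial>count_space \<Lambda>) \<partial>lborel)" by simp
  also have "\<dots> = (\<integral>\<^sup>+v. (\<integral>\<^sup>+x. F x * indicator cell (x - v) \<partial>lborel) \<partial>count_space \<Lambda>)"
    by (rule nn_integral_count_space_nn_integral) (use countable_lattice in \<open>auto\<close>)
  also have "\<dots> = (\<integral>\<^sup>+v. (\<integral>\<^sup>+x. F (x + v) * indicator cell x \<partial>lborel) \<partial>count_space \<Lambda>)"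
  proof (rule nn_integral_cong)
    fix v
    have "(\<integral>\<^sup>+x. F x * indicator cell (x - v) \<partial>lborel) =
        (\<integral>\<^sup>+x. F x * indicator cell (x - v) \<partial>distr lborel borel ((+) v))"
      by (simp add: lborel_distr_plus)
    also have "\<dots> = (\<integral>\<^sup>+x. F (x + v) * indicator cell x \<partial>lborel)"
      by (subst nn_integral_distr) (simp_all add: add.commute)
    finally show "(\<integral>\<^sup>+x. F x * indicator cell (x - v) \<partial>lborel) =
      (\<integral>\<^sup>+x. F (x + v) * indicator cell x \<partial>lborel)" .
  qed
  also have "\<dots> = (\<integral>\<^sup>+x. (\<integral>\<^sup>+v. F (x + v) * indicator cell x \<partial>count_space \<Lambda>) \<partial>lborel)"
    by (rule nn_integral_count_space_nn_integral[symmetric]) (use countable_lattice in \<open>auto\<close>)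
  also have "\<dots> = (\<integral>\<^sup>+x. (\<integral>\<^sup>+v. F (x + v) \<partial>count_space \<Lambda>) * indicator cell x \<partial>lborel)"
    by (intro nn_integral_cong) (simp add: nn_integral_multc)
  finally show ?thesis .
qed

text \<open>The covolume is 1 because \<open>det V = 1\<close>; this is why no constant appears in
  \<open>poisson_summation\<close>.\<close>

lemma emeasure_cell: "emeasure lborel cell = 1"
proof -
  have "det (matrix_inv V) = 1"
    using det_mul[of V "matrix_inv V"] by (simp add: V_inverse det_V)
  moreover have "cell = {x. matrix_inv V *v x \<in> unit_cell}"
    by (auto simp: in_cell_iff coord_def unit_cell_def)
  ultimately show ?thesis
    using emeasure_vimage_unit_cell[of "matrix_inv V"] by simp
qed

end

section \<open>Sums written as integrals over counting measures\<close>

lemma integrable_count_space_bound: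
  fixes f b :: "'a \<Rightarrow> real"
  assumes "integrable (count_space D) b" "\<And>w. w \<in> D \<Longrightarrow> \<bar>f w\<bar> \<le> b w"
  shows "integrable (count_space D) f"
  using assms(2) by (intro Bochner_Integration.integrable_bound[OF assms(1)]) (force simp: AE_count_space)+

text \<open>The Weierstrass test with majorant \<open>b\<close>, as dominated convergence along
  sequences.\<close>

lemma continuous_on_integral_count_space:
  fixes f :: "'w \<Rightarrow> 'a::metric_space \<Rightarrow> real"
  assumes f: "\<And>w. w \<in> D \<Longrightarrow> continuous_on S (f w)"
    and b: "integrable (count_space D) b" "\<And>w x. w \<in> D \<Longrightarrow> x \<in> S \<Longrightarrow> \<bar>f w x\<bar> \<le> b w"
  shows "continuous_on S (\<lambda>x. \<integral>w. f w x \<partial>count_space D)"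
  unfolding continuous_on_sequentially
proof (intro allI ballI impI)
  fix X a assume a: "a \<in> S" and X: "(\<forall>n. X n \<in> S) \<and> X \<longlonglongrightarrow> a"
  have "(\<lambda>n. \<integral>w. f w (X n) \<partial>count_space D) \<longlonglongrightarrow> (\<integral>w. f w a \<partial>count_space D)"
  proof (rule integral_dominated_convergence)
    show "integrable (count_space D) b" by fact
    show "AE w in count_space D. (\<lambda>n. f w (X n)) \<longlonglongrightarrow> f w a"
      using f a X by (auto simp: AE_count_space continuous_on_sequentially comp_def)
    show "AE w in count_space D. norm (f w (X n)) \<le> b w" for n
      using b(2) X by (auto simp: AE_count_space)
  qed auto
  then show "(((\<lambda>x. \<integral>w. f w x \<partial>count_space D) \<circ> X) \<longlonglongrightarrow> (\<integral>w. f w a \<partial>count_space D))"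
    by (simp add: comp_def)
qed

lemma integral_count_space_swap:
  fixes f :: "'w \<Rightarrow> 'a \<Rightarrow> real"
  assumes D: "countable D" and M: "finite_measure M"
    and f: "\<And>w. w \<in> D \<Longrightarrow> f w \<in> borel_measurable M"
    and b: "integrable (count_space D) b" "\<And>w x. w \<in> D \<Longrightarrow> x \<in> space M \<Longrightarrow> \<bar>f w x\<bar> \<le> b w"
  shows "integrable M (\<lambda>x. \<integral>w. f w x \<partial>count_space D)"
    and "(\<integral>x. (\<integral>w. f w x \<partial>count_space D) \<partial>M) = (\<integral>w. (\<integral>x. f w x \<partial>M) \<partial>count_space D)"
proof -
  interpret M: finite_measure M by fact
  interpret D: sigma_finite_measure "count_space D"
    using D by (rule sigma_finite_measure_count_space_countable)
  interpret DM: pair_sigma_finite "count_space D" M ..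
  have meas: "case_prod f \<in> borel_measurable (count_space D \<Otimes>\<^sub>M M)"
    using D f by (intro measurable_pair_measure_countable1) auto
  have int: "integrable (count_space D \<Otimes>\<^sub>M M) (case_prod f)"
  proof (rule DM.Fubini_integrable[OF meas])
    show "integrable (count_space D) (\<lambda>w. \<integral>x. norm (case_prod f (w, x)) \<partial>M)"
    proof (rule integrable_count_space_bound)
      show "integrable (count_space D) (\<lambda>w. b w * measure M (space M))" using b(1) by simp
      fix w assume w: "w \<in> D"
      have "(\<integral>x. norm (case_prod f (w, x)) \<partial>M) \<le> (\<integral>x. b w \<partial>M)"
        using b(2)[OF w] f[OF w] order_trans[OF abs_ge_zero b(2)[OF w]]
        by (intro integral_mono M.integrable_const_bound[where B="b w"]) (auto intro!: AE_I2)
      then show "\<bar>\<integral>x. norm (case_prod f (w, x)) \<partial>M\<bar> \<le> b w * measure M (space M)"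
        by (simp add: mult.commute)
    qed
    show "AE w in count_space D. integrable M (\<lambda>x. case_prod f (w, x))"
      using b(2) f by (auto simp: AE_count_space intro!: M.integrable_const_bound AE_I2)
  qed
  show "integrable M (\<lambda>x. \<integral>w. f w x \<partial>count_space D)"
    using DM.integrable_snd[OF int] by simp
  show "(\<integral>x. (\<integral>w. f w x \<partial>count_space D) \<partial>M) = (\<integral>w. (\<integral>x. f w x \<partial>M) \<partial>count_space D)"
    using DM.Fubini_integral[OF int] by simp
qed

subsection \<open>Gaussian integrals\<close>

text \<open>This is the characteristic function of the standard normal distribution after the
  substitution with \<open>c = sqrt (2 * t)\<close>, chosen so that
  \<open>(c * x)\<^sup>2 / 2 = t * x\<^sup>2\<close>.\<close>

lemma has_bochner_integral_gaussian_cis_1: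
  fixes t a :: real
  assumes t: "t > 0"
  shows "has_bochner_integral lborel (\<lambda>x. of_real (exp (- t * x\<^sup>2)) * cis (a * x))
    (of_real (sqrt (pi / t) * exp (- a\<^sup>2 / (4 * t))) :: complex)"
proof -
  define c where "c = sqrt (2 * t)"
  have c: "c > 0" "c\<^sup>2 = 2 * t" using t by (auto simp: c_def)
  define f where "f x = std_normal_density x *\<^sub>R iexp (a / c * x)" for x
  have int: "integrable lborel f"
    unfolding f_def
    by (rule Bochner_Integration.integrable_bound[of _ "\<lambda>x. std_normal_density x"]) (auto intro: integrable_normal_density)
  have "integral\<^sup>L lborel f = char std_normal_distribution (a / c)"
    unfolding char_def f_def by (subst integral_density) (auto simp: AE_I2)
  also have "\<dots> = complex_of_real (exp (- (a / c)\<^sup>2 / 2))" by (simp add: char_std_normal_distribution)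
  also have "- (a / c)\<^sup>2 / 2 = - a\<^sup>2 / (4 * t)" using c by (simp add: power_divide)
  finally have "has_bochner_integral lborel f (complex_of_real (exp (- a\<^sup>2 / (4 * t))))"
    using int by (simp add: has_bochner_integral_iff)
  then have "has_bochner_integral lborel (\<lambda>x. f (0 + c * x)) (complex_of_real (exp (- a\<^sup>2 / (4 * t))) /\<^sub>R \<bar>c\<bar>)"
    using c by (subst (asm) lborel_has_bochner_integral_real_affine_iff[where c=c and t=0]) auto
  then have *: "has_bochner_integral lborel (\<lambda>x. sqrt (2 * pi) *\<^sub>R f (0 + c * x))
      (sqrt (2 * pi) *\<^sub>R (complex_of_real (exp (- a\<^sup>2 / (4 * t))) /\<^sub>R \<bar>c\<bar>))"
    by (intro has_bochner_integral_scaleR_right)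
  have "sqrt (2 * pi) *\<^sub>R f (0 + c * x) = of_real (exp (- t * x\<^sup>2)) * cis (a * x)" for x
  proof -
    have "(c * x)\<^sup>2 / 2 = t * x\<^sup>2" using c by (simp add: power_mult_distrib)
    then show ?thesis using c
      by (simp add: f_def std_normal_density_def cis_conv_exp scaleR_conv_of_real real_sqrt_mult field_simps)
  qed
  moreover have "sqrt (2 * pi) *\<^sub>R (complex_of_real (exp (- a\<^sup>2 / (4 * t))) /\<^sub>R \<bar>c\<bar>) =
      of_real (sqrt (pi / t) * exp (- a\<^sup>2 / (4 * t)))"
    using t by (simp add: c_def scaleR_conv_of_real real_sqrt_mult real_sqrt_divide field_simps)
  ultimately show ?thesis using * by simp
qed

text \<open>The Gaussian and the character both factor over the coordinates, so the integral is a
  product of one-dimensional ones.\<close>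

lemma has_bochner_integral_gaussian_cis:
  fixes w :: "'a::euclidean_space"
  assumes t: "t > 0"
  shows "has_bochner_integral lborel (\<lambda>x. of_real (exp (- t * (norm x)\<^sup>2)) * cis (w \<bullet> x))
    (of_real (sqrt (pi / t) ^ DIM('a) * exp (- (norm w)\<^sup>2 / (4 * t))) :: complex)"
proof -
  let ?f = "\<lambda>b x. of_real (exp (- t * x\<^sup>2)) * cis ((w \<bullet> b) * x) :: complex"
  interpret product_sigma_finite "\<lambda>_ :: 'a. lborel :: real measure" ..
  have 1: "has_bochner_integral lborel (?f b) (of_real (sqrt (pi / t) * exp (- (w \<bullet> b)\<^sup>2 / (4 * t))))" for b
    by (rule has_bochner_integral_gaussian_cis_1[OF t])
  have "has_bochner_integral (\<Pi>\<^sub>M b\<in>Basis. lborel) (\<lambda>x. \<Prod>b\<in>Basis. ?f b (x b))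
      (\<Prod>b\<in>Basis. of_real (sqrt (pi / t) * exp (- (w \<bullet> b)\<^sup>2 / (4 * t))))"
    unfolding has_bochner_integral_iff
  proof
    show "integrable (\<Pi>\<^sub>M b\<in>Basis. lborel) (\<lambda>x. \<Prod>b\<in>Basis. ?f b (x b))"
      using 1 by (intro product_integrable_prod) (auto simp: has_bochner_integral_iff)
    show "integral\<^sup>L (\<Pi>\<^sub>M b\<in>Basis. lborel) (\<lambda>x. \<Prod>b\<in>Basis. ?f b (x b)) =
      (\<Prod>b\<in>Basis. of_real (sqrt (pi / t) * exp (- (w \<bullet> b)\<^sup>2 / (4 * t))))"
      using 1 by (subst product_integral_prod) (auto simp: has_bochner_integral_iff intro!: prod.cong)
  qed
  also have "(\<Prod>b\<in>Basis. of_real (sqrt (pi / t) * exp (- (w \<bullet> b)\<^sup>2 / (4 * t)))) =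
      (of_real (sqrt (pi / t) ^ DIM('a) * exp (- (norm w)\<^sup>2 / (4 * t))) :: complex)"
  proof -
    have "(norm w)\<^sup>2 = (\<Sum>b\<in>Basis. (w \<bullet> b)\<^sup>2)"
      unfolding power2_norm_eq_inner using euclidean_inner[of w w] by (simp add: power2_eq_square)
    then have "exp (- (norm w)\<^sup>2 / (4 * t)) = (\<Prod>b\<in>Basis. exp (- (w \<bullet> b)\<^sup>2 / (4 * t)))"
      by (simp only: exp_sum[OF finite_Basis, symmetric] sum_divide_distrib sum_negf[symmetric])
    then show ?thesis
      by (simp add: prod.distrib flip: of_real_prod of_real_mult)
  qed
  finally have 2: "has_bochner_integral (\<Pi>\<^sub>M b\<in>Basis. lborel) (\<lambda>x. \<Prod>b\<in>Basis. ?f b (x b))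
    (of_real (sqrt (pi / t) ^ DIM('a) * exp (- (norm w)\<^sup>2 / (4 * t))))" .
  have F: "(\<Prod>b\<in>Basis. ?f b (x \<bullet> b)) = of_real (exp (- t * (norm x)\<^sup>2)) * cis (w \<bullet> x)" for x
  proof -
    have "(norm x)\<^sup>2 = (\<Sum>b\<in>Basis. (x \<bullet> b)\<^sup>2)"
      unfolding power2_norm_eq_inner using euclidean_inner[of x x] by (simp add: power2_eq_square)
    moreover have "w \<bullet> x = (\<Sum>b\<in>Basis. (w \<bullet> b) * (x \<bullet> b))" by (rule euclidean_inner)
    ultimately have "exp (- t * (norm x)\<^sup>2) = (\<Prod>b\<in>Basis. exp (- t * (x \<bullet> b)\<^sup>2))"
      "cis (w \<bullet> x) = (\<Prod>b\<in>Basis. cis ((w \<bullet> b) * (x \<bullet> b)))"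
      by (simp_all only: exp_sum[OF finite_Basis, symmetric] sum_distrib_left cis_conv_exp of_real_sum)
    then show ?thesis by (simp add: prod.distrib)
  qed
  have "has_bochner_integral (distr (\<Pi>\<^sub>M b\<in>Basis. lborel) borel (\<lambda>f. \<Sum>b\<in>Basis. f b *\<^sub>R b))
      (\<lambda>x::'a. \<Prod>b\<in>Basis. ?f b (x \<bullet> b)) (of_real (sqrt (pi / t) ^ DIM('a) * exp (- (norm w)\<^sup>2 / (4 * t))))"
  proof -
    have "(\<lambda>x. \<Prod>b\<in>Basis. ?f b ((\<Sum>c\<in>Basis. x c *\<^sub>R c) \<bullet> b)) = (\<lambda>x. \<Prod>b\<in>Basis. ?f b (x b))"
      by (intro ext prod.cong) (simp_all add: inner_sum_left_Basis)
    moreover have "(\<lambda>x::'a. \<Prod>b\<in>Basis. ?f b (x \<bullet> b)) \<in> borel_measurable borel"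
      unfolding cis_conv_exp by measurable
    ultimately show ?thesis
      using 2 by (simp add: has_bochner_integral_iff integrable_distr_eq integral_distr)
  qed
  then show ?thesis unfolding F lborel_eq[symmetric] .
qed

text \<open>In this form \<open>dual_heat w t\<close> is recognized as the Fourier transform of the
  Gaussian at the frequency \<open>2 * pi * w\<close>.\<close>

lemma dual_heat_alt:
  assumes "t > 0"
  shows "dual_heat (w :: real^'d) t = sqrt (pi / t) ^ CARD('d) * exp (- (norm ((2 * pi) *\<^sub>R w))\<^sup>2 / (4 * t))"
proof -
  have "sqrt (pi / t) ^ CARD('d) = (pi / t) powr (real CARD('d) / 2)"
    using assms by (simp add: powr_half_sqrt[symmetric] powr_realpow[symmetric] powr_powr)
  also have "\<dots> = pi powr (real CARD('d) / 2) / t powr (real CARD('d) / 2)"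
    using assms by (simp add: powr_divide)
  finally show ?thesis
    by (simp add: dual_heat_def power_mult_distrib)
qed

lemma dual_heat_pos: "t > 0 \<Longrightarrow> dual_heat w t > 0"
  by (simp add: dual_heat_def)

lemma borel_measurable_dual_heat [measurable]: "dual_heat w \<in> borel_measurable borel"
  unfolding dual_heat_def[abs_def] by measurable

lemma has_bochner_integral_gaussian_cos:
  fixes w :: "real^'d"
  assumes t: "t > 0"
  shows "has_bochner_integral lborel (\<lambda>x. exp (- t * (norm x)\<^sup>2) * cos (2 * pi * (w \<bullet> x))) (dual_heat w t)"
    and "has_bochner_integral lborel (\<lambda>x. exp (- t * (norm x)\<^sup>2) * sin (2 * pi * (w \<bullet> x))) 0"
proof -
  have *: "has_bochner_integral lborel (\<lambda>x. of_real (exp (- t * (norm x)\<^sup>2)) * cis (((2 * pi) *\<^sub>R w) \<bullet> x))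
    (of_real (dual_heat w t) :: complex)"
    using has_bochner_integral_gaussian_cis[OF t, of "(2 * pi) *\<^sub>R w"] by (simp add: dual_heat_alt[OF t])
  show "has_bochner_integral lborel (\<lambda>x. exp (- t * (norm x)\<^sup>2) * cos (2 * pi * (w \<bullet> x))) (dual_heat w t)"
    using has_bochner_integral_bounded_linear[OF bounded_linear_Re *] by simp
  show "has_bochner_integral lborel (\<lambda>x. exp (- t * (norm x)\<^sup>2) * sin (2 * pi * (w \<bullet> x))) 0"
    using has_bochner_integral_bounded_linear[OF bounded_linear_Im *] by simp
qed

lemma has_bochner_integral_gaussian:
  "t > 0 \<Longrightarrow> has_bochner_integral lborel (\<lambda>x :: real^'d. exp (- t * (norm x)\<^sup>2)) (dual_heat (0 :: real^'d) t)"
  using has_bochner_integral_gaussian_cos(1)[of t "0 :: real^'d"] by simp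

subsection \<open>Lattice sums\<close>

context unimodular_lattice
begin

text \<open>Unfolding turns a Gaussian integral over the whole space into lattice sums over shifted
  lattices, integrated over the cell. For \<open>x\<close> in the cell each shifted sum dominates a
  multiple of the unshifted one. Halving the exponent to \<open>c = s / 2\<close> pays for the
  factor 2 in the bound of the squared norm of \<open>x + v\<close>.\<close>

lemma integrable_gaussian_0:
  assumes s: "s > 0"
  shows "integrable (count_space \<Lambda>) (\<lambda>v. exp (- s * (norm v)\<^sup>2))"
proof -
  define c where "c = s / 2"
  have c: "c > 0" using s by (simp add: c_def)
  from bounded_cell obtain R where R: "\<And>x. x \<in> cell \<Longrightarrow> norm x \<le> R"
    by (auto simp: bounded_iff)
  define E where "E = exp (- s * R\<^sup>2)"
  have "E * exp (- s * (norm v)\<^sup>2) \<le> exp (- c * (norm (x + v))\<^sup>2)" if x: "x \<in> cell" for x v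
  proof -
    have "(norm (x + v))\<^sup>2 \<le> (norm x + norm v)\<^sup>2" by (intro power_mono norm_triangle_ineq) simp
    also have "\<dots> \<le> 2 * (norm x)\<^sup>2 + 2 * (norm v)\<^sup>2"
      using sum_squares_bound[of "norm x" "norm v"] by (simp add: power2_sum)
    also have "(norm x)\<^sup>2 \<le> R\<^sup>2" using R[OF x] by (intro power_mono) auto
    finally have "c * (norm (x + v))\<^sup>2 \<le> c * (2 * R\<^sup>2 + 2 * (norm v)\<^sup>2)"
      using c by (intro mult_left_mono) auto
    then show ?thesis by (simp add: E_def c_def exp_add[symmetric] algebra_simps)
  qed
  then have "(\<integral>\<^sup>+x. (\<integral>\<^sup>+v. ennreal E * ennreal (exp (- s * (norm v)\<^sup>2)) \<partial>count_space \<Lambda>) * indicator cell x \<partial>lborel)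
     \<le> (\<integral>\<^sup>+x. (\<integral>\<^sup>+v. ennreal (exp (- c * (norm (x + v))\<^sup>2)) \<partial>count_space \<Lambda>) * indicator cell x \<partial>lborel)"
    by (intro nn_integral_mono) (auto simp: indicator_def E_def ennreal_mult[symmetric] intro!: nn_integral_mono ennreal_leI)
  also have "\<dots> = (\<integral>\<^sup>+x. ennreal (exp (- c * (norm (x :: real^'d))\<^sup>2)) \<partial>lborel)"
    by (rule nn_integral_unfold[symmetric]) measurable
  also have "\<dots> = ennreal (dual_heat (0 :: real^'d) c)"
    using has_bochner_integral_gaussian[OF c, where 'd = 'd]
    by (subst nn_integral_eq_integral) (auto simp: has_bochner_integral_iff)
  finally have "ennreal E * (\<integral>\<^sup>+v. ennreal (exp (- s * (norm v)\<^sup>2)) \<partial>count_space \<Lambda>) \<le> ennreal (dual_heat (0 :: real^'d) c)"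
    by (simp add: nn_integral_cmult emeasure_cell)
  then have "ennreal E * (\<integral>\<^sup>+v. ennreal (exp (- s * (norm v)\<^sup>2)) \<partial>count_space \<Lambda>) < \<top>"
    by (rule order_le_less_trans) simp
  moreover have "E > 0" by (simp add: E_def)
  ultimately have "(\<integral>\<^sup>+v. ennreal (exp (- s * (norm v)\<^sup>2)) \<partial>count_space \<Lambda>) < \<infinity>"
    by (auto simp: ennreal_mult_less_top ennreal_eq_0_iff)
  then show ?thesis by (simp add: integrable_iff_bounded)
qed

text \<open>The bound depends on \<open>x\<close> only through \<open>R\<close> and is summable in
  \<open>v\<close>: a majorant that is uniform on balls.\<close>

lemma gaussian_shift_bound:
  fixes x v :: "'x::real_normed_vector"
  assumes "t > 0" "norm x \<le> R"
  shows "exp (- t * (norm (x + v))\<^sup>2) \<le> exp (t * R\<^sup>2) * exp (- (t / 2) * (norm v)\<^sup>2)"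
proof -
  have "(norm v)\<^sup>2 \<le> (norm (x + v) + norm x)\<^sup>2"
    using norm_triangle_ineq4[of "x + v" x] by (intro power_mono) auto
  also have "\<dots> \<le> 2 * (norm (x + v))\<^sup>2 + 2 * (norm x)\<^sup>2"
    using sum_squares_bound[of "norm (x + v)" "norm x"] by (simp add: power2_sum)
  also have "(norm x)\<^sup>2 \<le> R\<^sup>2" using assms by (intro power_mono) auto
  finally have "t * (norm v)\<^sup>2 \<le> t * (2 * (norm (x + v))\<^sup>2 + 2 * R\<^sup>2)"
    using assms by (intro mult_left_mono) auto
  then show ?thesis by (simp add: exp_add[symmetric] algebra_simps)
qed

lemma integrable_gaussian:
  assumes "t > 0" shows "integrable (count_space \<Lambda>) (\<lambda>v. exp (- t * (norm (x + v))\<^sup>2))"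
proof (rule integrable_count_space_bound)
  show "integrable (count_space \<Lambda>) (\<lambda>v. exp (t * (norm x)\<^sup>2) * exp (- (t / 2) * (norm v)\<^sup>2))"
    by (rule integrable_mult_right, rule integrable_gaussian_0) (use assms in simp)
  show "\<bar>exp (- t * (norm (x + v))\<^sup>2)\<bar> \<le> exp (t * (norm x)\<^sup>2) * exp (- (t / 2) * (norm v)\<^sup>2)" for v
    using gaussian_shift_bound[OF assms order_refl, of x v] by simp
qed

text \<open>For each \<open>t\<close>, a multiple of a heat kernel of the torus; the time of the
  heat flow is \<open>1 / (4 * t)\<close>.\<close>

definition theta :: "real \<Rightarrow> real^'d \<Rightarrow> real" where
  "theta t x = (\<integral>v. exp (- t * (norm (x + v))\<^sup>2) \<partial>count_space \<Lambda>)"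

lemma theta_nonneg: "theta t x \<ge> 0"
  by (simp add: theta_def)

lemma nn_integral_theta:
  "t > 0 \<Longrightarrow> (\<integral>\<^sup>+v. ennreal (exp (- t * (norm (x + v))\<^sup>2)) \<partial>count_space \<Lambda>) = ennreal (theta t x)"
  unfolding theta_def by (intro nn_integral_eq_integral integrable_gaussian) auto

lemma continuous_on_theta:
  assumes "t > 0" shows "continuous_on UNIV (theta t)"
proof -
  \<comment> \<open>The majorant is uniform on balls only, so continuity is shown on each
    ball.\<close>
  have "continuous_on (ball 0 R) (theta t)" for R
    unfolding theta_def[abs_def]
  proof (rule continuous_on_integral_count_space)
    show "integrable (count_space \<Lambda>) (\<lambda>v. exp (t * R\<^sup>2) * exp (- (t / 2) * (norm v)\<^sup>2))"
      by (rule integrable_mult_right, rule integrable_gaussian_0) (use assms in simp)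
    show "\<bar>exp (- t * (norm (x + v))\<^sup>2)\<bar> \<le> exp (t * R\<^sup>2) * exp (- (t / 2) * (norm v)\<^sup>2)" if "x \<in> ball 0 R" for v x
      using gaussian_shift_bound[of t x R v] assms that by simp
  qed (intro continuous_intros)
  then have "continuous (at x) (theta t)" for x
    using continuous_on_interior[of "ball 0 (norm x + 1)" "theta t" x] by (auto simp: interior_open)
  then show ?thesis by (simp add: continuous_on_eq_continuous_at)
qed

definition periodic :: "(real^'d \<Rightarrow> 'b) \<Rightarrow> bool" where
  "periodic g \<longleftrightarrow> (\<forall>x v. v \<in> \<Lambda> \<longrightarrow> g (x + v) = g x)"

lemma periodicD: "periodic g \<Longrightarrow> v \<in> \<Lambda> \<Longrightarrow> g (x + v) = g x"
  by (simp add: periodic_def)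

lemma periodic_cell_rep: "periodic g \<Longrightarrow> g (cell_rep x) = g x"
  using periodicD[of g "x - cell_rep x" "cell_rep x"] diff_cell_rep_in_lattice by simp

lemma periodic_theta: "periodic (theta t)"
  unfolding periodic_def
proof (intro allI impI)
  fix x u assume u: "u \<in> \<Lambda>"
  have "bij_betw ((+) u) \<Lambda> \<Lambda>"
    by (rule bij_betwI[where g = "\<lambda>v. v - u"]) (auto simp: u lattice_add lattice_diff)
  from integral_bij_count_space[OF this, of "\<lambda>v. exp (- t * (norm (x + v))\<^sup>2)"]
  show "theta t (x + u) = theta t x" by (simp add: theta_def add.assoc)
qed

section \<open>The dual lattice\<close>

abbreviation "dual \<equiv> dual_lattice V"

text \<open>Pairing with the columns of \<open>V\<close> reads off the coordinates with respect to
  the dual basis. With \<open>dual_unimodular\<close>, every fact on lattices in this locale carries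
  over to the dual lattice.\<close>

lemma dual_lattice_eq: "dual = period_lattice (transpose (matrix_inv V))"
proof -
  let ?W = "transpose (matrix_inv V)"
  have W: "?W *v (transpose V *v w) = w" "transpose V *v (?W *v w) = w" for w
    by (simp_all add: matrix_vector_mul_assoc V_inverse transpose_mat del: transpose_matrix_vector flip: matrix_transpose_mul)
  have ip: "w \<bullet> (V *v k) = (transpose V *v w) \<bullet> k" for w k :: "real^'d"
    by (simp add: dot_lmul_matrix transpose_matrix_vector)
  have "w \<in> dual \<longleftrightarrow> (\<forall>j. (transpose V *v w) $ j \<in> \<int>)" for w
  proof
    assume w: "w \<in> dual"
    show "\<forall>j. (transpose V *v w) $ j \<in> \<int>"
    proof
      fix j
      have "V *v axis j 1 \<in> \<Lambda>" by (simp add: in_lattice_iff axis_def)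
      then have "w \<bullet> (V *v axis j 1) \<in> \<int>" using w by (auto simp: dual_lattice_def)
      then show "(transpose V *v w) $ j \<in> \<int>" by (simp add: ip inner_axis)
    qed
  next
    assume w: "\<forall>j. (transpose V *v w) $ j \<in> \<int>"
    have "w \<bullet> (V *v k) \<in> \<int>" if "\<forall>i. k $ i \<in> \<int>" for k
      by (subst ip) (use w that in \<open>simp add: inner_vec_def Ints_sum Ints_mult\<close>)
    then show "w \<in> dual"
      unfolding dual_lattice_def period_lattice_def by blast
  qed
  moreover have "w \<in> period_lattice ?W \<longleftrightarrow> (\<forall>j. (transpose V *v w) $ j \<in> \<int>)" for w
  proof
    assume "w \<in> period_lattice ?W"
    then obtain k where "w = ?W *v k" "\<forall>i. k $ i \<in> \<int>" unfolding period_lattice_def by blast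
    then show "\<forall>j. (transpose V *v w) $ j \<in> \<int>" using W(2) by (simp del: transpose_matrix_vector)
  next
    assume "\<forall>j. (transpose V *v w) $ j \<in> \<int>"
    then show "w \<in> period_lattice ?W"
      unfolding period_lattice_def using W(1)[of w, symmetric] by blast
  qed
  ultimately show ?thesis by blast
qed

lemma dual_unimodular: "unimodular_lattice (transpose (matrix_inv V))"
proof
  show "det (transpose (matrix_inv V)) = 1"
    using det_mul[of V "matrix_inv V"] by (simp add: V_inverse det_V det_transpose)
qed

lemma countable_dual: "countable dual"
  unfolding dual_lattice_eq by (rule unimodular_lattice.countable_lattice[OF dual_unimodular])

lemma dual_0 [simp]: "0 \<in> dual" by (simp add: dual_lattice_def)

lemma dual_add: "w \<in> dual \<Longrightarrow> u \<in> dual \<Longrightarrow> w + u \<in> dual"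
  by (simp add: dual_lattice_def inner_add_left)

lemma dual_diff: "w \<in> dual \<Longrightarrow> u \<in> dual \<Longrightarrow> w - u \<in> dual"
  by (simp add: dual_lattice_def inner_diff_left)

lemma dual_uminus: "w \<in> dual \<Longrightarrow> - w \<in> dual"
  by (simp add: dual_lattice_def)

lemma dual_nontrivial: "\<exists>w\<in>dual. w \<noteq> 0"
proof -
  interpret D: unimodular_lattice "transpose (matrix_inv V)" by (rule dual_unimodular)
  let ?w = "transpose (matrix_inv V) *v axis undefined 1"
  have "D.coord ?w = axis undefined 1" by (rule D.coord_V)
  moreover have "D.coord 0 = 0" by (simp add: D.coord_def)
  ultimately have "?w \<noteq> 0" by (metis axis_eq_0_iff zero_neq_one)
  moreover have "?w \<in> dual" unfolding dual_lattice_eq by (auto simp: D.in_lattice_iff D.coord_V axis_def simp del: transpose_matrix_vector)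
  ultimately show ?thesis by blast
qed

lemma integrable_dual_gaussian:
  "s > 0 \<Longrightarrow> integrable (count_space dual) (\<lambda>w. exp (- s * (norm w)\<^sup>2))"
  unfolding dual_lattice_eq by (rule unimodular_lattice.integrable_gaussian_0[OF dual_unimodular])

lemma integrable_dual_heat:
  assumes "t > 0" shows "integrable (count_space dual) (\<lambda>w. dual_heat w t)"
proof -
  have "integrable (count_space dual) (\<lambda>w. (pi powr (real CARD('d) / 2) / t powr (real CARD('d) / 2)) * exp (- (pi\<^sup>2 / t) * (norm w)\<^sup>2))"
    by (rule integrable_mult_right, rule integrable_dual_gaussian) (use assms in simp)
  then show ?thesis by (simp add: dual_heat_def[abs_def])
qed

text \<open>Each point of the ball contributes at least \<open>exp (- r\<^sup>2)\<close> to a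
  convergent Gaussian sum.\<close>

lemma finite_dual_ball: "finite {w \<in> dual. norm w \<le> r}"
proof -
  define B where "B = {w \<in> dual. norm w \<le> r}"
  have "exp (- r\<^sup>2) * emeasure (count_space dual) B = (\<integral>\<^sup>+w. ennreal (exp (- r\<^sup>2)) * indicator B w \<partial>count_space dual)"
    by (subst nn_integral_cmult_indicator) (auto simp: B_def)
  also have "\<dots> \<le> (\<integral>\<^sup>+w. ennreal (exp (- 1 * (norm w)\<^sup>2)) \<partial>count_space dual)"
    by (intro nn_integral_mono) (auto simp: B_def indicator_def intro!: power_mono)
  also have "\<dots> < \<infinity>" using integrable_dual_gaussian[of 1] by (simp add: integrable_iff_bounded)
  finally have "emeasure (count_space dual) B < \<infinity>"
    by (auto simp: ennreal_mult_less_top ennreal_eq_0_iff)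
  then have "finite B" by (subst (asm) emeasure_count_space) (auto simp: B_def split: if_splits)
  then show ?thesis by (simp add: B_def)
qed

text \<open>Condition (W2) speaks of a shortest nonzero dual vector and gives information only once
  such a vector is known to exist.\<close>

lemma minimal_dual_vector:
  "\<exists>w\<^sub>0 \<in> dual - {0}. \<forall>w \<in> dual - {0}. norm w\<^sub>0 \<le> norm w"
proof -
  obtain u where u: "u \<in> dual" "u \<noteq> 0" using dual_nontrivial by blast
  let ?S = "{w \<in> dual. norm w \<le> norm u} - {0}"
  have "finite ?S" "?S \<noteq> {}" using finite_dual_ball u by auto
  then obtain w where w: "w \<in> ?S" "\<And>y. y \<in> ?S \<Longrightarrow> norm w \<le> norm y"
    using ex_min_if_finite[of "norm ` ?S"] by (auto simp: not_less)
  have "norm w \<le> norm y" if "y \<in> dual - {0}" for y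
    using w(2)[of y] w(1) that by (cases "norm y \<le> norm u") auto
  then show ?thesis using w(1) by blast
qed

lemma periodic_cos: "w \<in> dual \<Longrightarrow> periodic (\<lambda>x. cos (2 * pi * (w \<bullet> x)))"
  and periodic_sin: "w \<in> dual \<Longrightarrow> periodic (\<lambda>x. sin (2 * pi * (w \<bullet> x)))"
  unfolding periodic_def
  by (auto simp: dual_lattice_def inner_add_right distrib_left cos_add sin_add sin_integer_2pi cos_integer_2pi)

end

subsection \<open>Trigonometric polynomials and Poisson summation\<close>

context unimodular_lattice
begin

inductive_set trig_poly :: "(real^'d \<Rightarrow> real) set" where
  cosI: "w \<in> dual \<Longrightarrow> (\<lambda>x. c * cos (2 * pi * (w \<bullet> x))) \<in> trig_poly"
| sinI: "w \<in> dual \<Longrightarrow> (\<lambda>x. c * sin (2 * pi * (w \<bullet> x))) \<in> trig_poly"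
| addI: "p \<in> trig_poly \<Longrightarrow> q \<in> trig_poly \<Longrightarrow> (\<lambda>x. p x + q x) \<in> trig_poly"

lemma trig_poly_const: "(\<lambda>x. c) \<in> trig_poly"
  using cosI[of 0 c] by simp

lemma trig_products:
  fixes w u x :: "real^'d"
  shows "cos (2 * pi * (w \<bullet> x)) * cos (2 * pi * (u \<bullet> x)) = (cos (2 * pi * ((w - u) \<bullet> x)) + cos (2 * pi * ((w + u) \<bullet> x))) / 2"
    and "sin (2 * pi * (w \<bullet> x)) * sin (2 * pi * (u \<bullet> x)) = (cos (2 * pi * ((w - u) \<bullet> x)) - cos (2 * pi * ((w + u) \<bullet> x))) / 2"
    and "cos (2 * pi * (w \<bullet> x)) * sin (2 * pi * (u \<bullet> x)) = (sin (2 * pi * ((w + u) \<bullet> x)) - sin (2 * pi * ((w - u) \<bullet> x))) / 2"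
  by (simp_all only: cos_times_cos sin_times_sin cos_times_sin inner_add_left inner_diff_left distrib_left right_diff_distrib)

text \<open>Brings the product formulas with arbitrary coefficients into the shape of the
  introduction rules of \<open>trig_poly\<close>.\<close>

lemma mult_half_sum:
  fixes A B X Y c a :: real
  shows "A * B = (X + Y) / 2 \<Longrightarrow> c * A * (a * B) = (c * a / 2) * X + (c * a / 2) * Y"
    and "A * B = (X - Y) / 2 \<Longrightarrow> c * A * (a * B) = (c * a / 2) * X + (- c * a / 2) * Y"
    and "B * A = (X - Y) / 2 \<Longrightarrow> c * A * (a * B) = (c * a / 2) * X + (- c * a / 2) * Y"
proof -
  have *: "c * A * (a * B) = c * a * (A * B)" "c * A * (a * B) = c * a * (B * A)" by simp_all
  show "c * A * (a * B) = (c * a / 2) * X + (c * a / 2) * Y" if "A * B = (X + Y) / 2"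
    unfolding *(1) that by (simp add: field_simps)
  show "c * A * (a * B) = (c * a / 2) * X + (- c * a / 2) * Y" if "A * B = (X - Y) / 2"
    unfolding *(1) that by (simp add: field_simps)
  show "c * A * (a * B) = (c * a / 2) * X + (- c * a / 2) * Y" if "B * A = (X - Y) / 2"
    unfolding *(2) that by (simp add: field_simps)
qed

lemma trig_poly_mult_basic:
  assumes p: "p \<in> trig_poly" and w: "w \<in> dual"
  shows "(\<lambda>x. c * cos (2 * pi * (w \<bullet> x)) * p x) \<in> trig_poly"
    and "(\<lambda>x. c * sin (2 * pi * (w \<bullet> x)) * p x) \<in> trig_poly"
proof -
  have "(\<lambda>x. c * cos (2 * pi * (w \<bullet> x)) * p x) \<in> trig_poly \<and> (\<lambda>x. c * sin (2 * pi * (w \<bullet> x)) * p x) \<in> trig_poly"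
    using p
  proof induction
    case (cosI u a)
    have "c * cos (2 * pi * (w \<bullet> x)) * (a * cos (2 * pi * (u \<bullet> x))) =
        (c * a / 2) * cos (2 * pi * ((w - u) \<bullet> x)) + (c * a / 2) * cos (2 * pi * ((w + u) \<bullet> x))" for x
      by (rule mult_half_sum(1)[OF trig_products(1)])
    moreover have "c * sin (2 * pi * (w \<bullet> x)) * (a * cos (2 * pi * (u \<bullet> x))) =
        (c * a / 2) * sin (2 * pi * ((u + w) \<bullet> x)) + (- c * a / 2) * sin (2 * pi * ((u - w) \<bullet> x))" for x
      by (rule mult_half_sum(3)[OF trig_products(3)])
    ultimately show ?case
      using cosI w by (simp only:) (intro conjI trig_poly.intros dual_add dual_diff)
  next
    case (sinI u a)
    have "c * cos (2 * pi * (w \<bullet> x)) * (a * sin (2 * pi * (u \<bullet> x))) =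
        (c * a / 2) * sin (2 * pi * ((w + u) \<bullet> x)) + (- c * a / 2) * sin (2 * pi * ((w - u) \<bullet> x))" for x
      by (rule mult_half_sum(2)[OF trig_products(3)])
    moreover have "c * sin (2 * pi * (w \<bullet> x)) * (a * sin (2 * pi * (u \<bullet> x))) =
        (c * a / 2) * cos (2 * pi * ((w - u) \<bullet> x)) + (- c * a / 2) * cos (2 * pi * ((w + u) \<bullet> x))" for x
      by (rule mult_half_sum(2)[OF trig_products(2)])
    ultimately show ?case
      using sinI w by (simp only:) (intro conjI trig_poly.intros dual_add dual_diff)
  next
    case (addI p q)
    then show ?case by (auto simp: distrib_left intro!: trig_poly.addI)
  qed
  then show "(\<lambda>x. c * cos (2 * pi * (w \<bullet> x)) * p x) \<in> trig_poly"
    "(\<lambda>x. c * sin (2 * pi * (w \<bullet> x)) * p x) \<in> trig_poly" by auto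
qed

lemma trig_poly_mult:
  assumes "p \<in> trig_poly" and q: "q \<in> trig_poly" shows "(\<lambda>x. p x * q x) \<in> trig_poly"
  using assms(1)
proof induction
  case (addI p p')
  then show ?case by (auto simp: distrib_right intro!: trig_poly.addI)
qed (use trig_poly_mult_basic[OF q] in auto)

definition coord_dual :: "'d \<Rightarrow> real^'d" where
  "coord_dual j = row j (matrix_inv V)"

lemma coord_dual_inner: "coord_dual j \<bullet> x = coord x $ j"
  by (simp add: coord_dual_def coord_def matrix_vector_mul_component row_def)

lemma coord_dual_in_dual: "coord_dual j \<in> dual"
  by (auto simp: dual_lattice_def coord_dual_inner in_lattice_iff)

text \<open>The embedding of the torus as a product of circles. It turns periodic functions into
  functions on a compact Euclidean set, where Stone-Weierstrass applies, and it separates the points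
  of the torus.\<close>

definition torus_map :: "real^'d \<Rightarrow> (real^'d) \<times> (real^'d)" where
  "torus_map x = (\<chi> j. cos (2 * pi * coord x $ j), \<chi> j. sin (2 * pi * coord x $ j))"

lemma torus_map_eq_iff: "torus_map x = torus_map y \<longleftrightarrow> x - y \<in> \<Lambda>"
proof -
  have *: "(sin (2 * pi * a) = sin (2 * pi * b) \<and> cos (2 * pi * a) = cos (2 * pi * b)) \<longleftrightarrow> a - b \<in> \<int>" for a b :: real
  proof -
    have "2 * pi * a = 2 * pi * b + 2 * pi * of_int n \<longleftrightarrow> a - b = of_int n" for n :: int
    proof -
      have "2 * pi * a = 2 * pi * b + 2 * pi * of_int n \<longleftrightarrow> 2 * pi * a = 2 * pi * (b + of_int n)"
        by (simp only: distrib_left)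
      also have "\<dots> \<longleftrightarrow> a = b + of_int n" by simp
      finally show ?thesis by linarith
    qed
    then show ?thesis unfolding sin_cos_eq_iff Ints_def by blast
  qed
  have "torus_map x = torus_map y \<longleftrightarrow>
    (\<forall>j. sin (2 * pi * coord x $ j) = sin (2 * pi * coord y $ j) \<and> cos (2 * pi * coord x $ j) = cos (2 * pi * coord y $ j))"
    unfolding torus_map_def prod.inject vec_eq_iff vec_lambda_beta by blast
  then show ?thesis by (simp only: * in_lattice_iff coord_diff vector_minus_component)
qed

lemma continuous_on_torus_map: "continuous_on S torus_map"
  unfolding torus_map_def[abs_def]
  by (intro continuous_intros continuous_on_vec_lambda)

text \<open>Periodicity lets \<open>g\<close> descend to a function \<open>h\<close> on the image
  \<open>S\<close> of \<open>torus_map\<close>. The coordinates of \<open>S\<close> pull back to the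
  cosines and sines of the basic dual vectors, so polynomials in them pull back to trigonometric
  polynomials.\<close>

lemma trig_poly_dense:
  assumes g: "continuous_on UNIV g" "periodic g" and e: "e > 0"
  shows "\<exists>p\<in>trig_poly. \<forall>x. \<bar>g x - p x\<bar> < e"
proof -
  define K where "K = (*v) V ` cbox 0 1"
  have K: "compact K" unfolding K_def
    by (intro compact_continuous_image continuous_intros compact_cbox matrix_vector_mult_linear_continuous_on)
  have cellK: "cell \<subseteq> K"
  proof
    fix x assume "x \<in> cell"
    then have "coord x \<in> cbox 0 1" by (auto simp: in_cell_iff mem_box_cart less_imp_le)
    then have "V *v coord x \<in> K" unfolding K_def by (rule imageI)
    then show "x \<in> K" by simp
  qed
  define S where "S = torus_map ` K"
  have rep: "torus_map (cell_rep x) = torus_map x" for x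
    using diff_cell_rep_in_lattice[of x] by (simp flip: torus_map_eq_iff)
  have range_S: "torus_map x \<in> S" for x
    unfolding S_def rep[of x, symmetric] by (intro imageI subsetD[OF cellK] cell_rep_in_cell)
  define h where "h s = g (SOME x. torus_map x = s)" for s
  have h: "h (torus_map x) = g x" for x
  proof -
    have "torus_map (SOME y. torus_map y = torus_map x) = torus_map x"
      by (rule someI[of "\<lambda>y. torus_map y = torus_map x" x]) simp
    then have "(SOME y. torus_map y = torus_map x) - x \<in> \<Lambda>" by (simp add: torus_map_eq_iff)
    from periodicD[OF g(2) this, of x] show ?thesis by (simp add: h_def)
  qed
  have S: "compact S" unfolding S_def by (intro compact_continuous_image continuous_on_torus_map K)
  \<comment> \<open>The preimage under \<open>h\<close> of a closed set is the image of a compact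
    part of \<open>K\<close>, hence closed.\<close>
  have h_cont: "continuous_on S h"
    unfolding continuous_on_closed_vimage[OF compact_imp_closed[OF S]]
  proof (intro allI impI)
    fix B :: "real set" assume B: "closed B"
    have "h -` B \<inter> S = torus_map ` (K \<inter> g -` B)"
      by (auto simp: S_def h)
    moreover have "closed (g -` B)" using g(1) B by (simp add: continuous_on_closed_vimage)
    then have "compact (torus_map ` (K \<inter> g -` B))"
      by (intro compact_continuous_image continuous_on_torus_map compact_Int_closed K)
    ultimately show "closed (h -` B \<inter> S)" by (simp add: compact_imp_closed)
  qed
  \<comment> \<open>The algebra consists of the continuous functions on \<open>S\<close> whose
    pullback is a trigonometric polynomial; the coordinate functions belong to it and separate
    points.\<close>
  interpret function_ring_on "{F. continuous_on S F \<and> (\<lambda>x. F (torus_map x)) \<in> trig_poly}" S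
  proof
    fix s s' assume s: "s \<in> S" "s' \<in> S" "s \<noteq> s'"
    then obtain x x' where x: "s = torus_map x" "s' = torus_map x'" by (auto simp: S_def)
    have 1: "(\<lambda>s. fst s $ j) \<in> {F. continuous_on S F \<and> (\<lambda>x. F (torus_map x)) \<in> trig_poly}" for j
      using cosI[OF coord_dual_in_dual, of 1 j]
      by (auto simp: torus_map_def coord_dual_inner intro!: continuous_intros)
    have 2: "(\<lambda>s. snd s $ j) \<in> {F. continuous_on S F \<and> (\<lambda>x. F (torus_map x)) \<in> trig_poly}" for j
      using sinI[OF coord_dual_in_dual, of 1 j]
      by (auto simp: torus_map_def coord_dual_inner intro!: continuous_intros)
    have "(\<exists>j. fst s $ j \<noteq> fst s' $ j) \<or> (\<exists>j. snd s $ j \<noteq> snd s' $ j)"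
      using s(3) by (auto simp: prod_eq_iff vec_eq_iff)
    then show "\<exists>f\<in>{F. continuous_on S F \<and> (\<lambda>x. F (torus_map x)) \<in> trig_poly}. f s \<noteq> f s'"
      by (elim disjE exE) (rule bexI[OF _ 1], assumption, rule bexI[OF _ 2], assumption)
  qed (auto simp: S trig_poly_const intro: continuous_on_add continuous_on_mult trig_poly.addI trig_poly_mult)
  from Stone_Weierstrass_basic[OF h_cont e]
  obtain F where F: "(\<lambda>x. F (torus_map x)) \<in> trig_poly" "\<forall>s\<in>S. \<bar>h s - F s\<bar> < e" by auto
  have "\<bar>g x - F (torus_map x)\<bar> < e" for x
    using F(2) range_S[of x] h[of x] by force
  then show ?thesis by (intro bexI[OF _ F(1)] allI)
qed

lemma trig_poly_continuous: "p \<in> trig_poly \<Longrightarrow> continuous_on S p"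
  by (induction rule: trig_poly.induct) (intro continuous_intros; assumption)+

lemma trig_poly_periodic: "p \<in> trig_poly \<Longrightarrow> periodic p"
proof (induction rule: trig_poly.induct)
  case (cosI w c) then show ?case using periodic_cos by (simp add: periodic_def)
next
  case (sinI w c) then show ?case using periodic_sin by (simp add: periodic_def)
qed (simp add: periodic_def)

lemma periodic_bounded:
  fixes g :: "real^'d \<Rightarrow> real"
  assumes "continuous_on UNIV g" "periodic g"
  shows "\<exists>B. \<forall>x. \<bar>g x\<bar> \<le> B"
proof -
  have "compact (closure cell)" using bounded_cell by (simp add: compact_closure)
  then have "bounded (g ` closure cell)"
    using assms(1) by (intro compact_imp_bounded compact_continuous_image) (auto intro: continuous_on_subset)
  then obtain B where B: "\<And>x. x \<in> closure cell \<Longrightarrow> \<bar>g x\<bar> \<le> B" by (auto simp: bounded_iff)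
  have "\<bar>g x\<bar> \<le> B" for x
    using B[OF subsetD[OF closure_subset cell_rep_in_cell]] periodic_cell_rep[OF assms(2)] by metis
  then show ?thesis by blast
qed

section \<open>Haar measure of the torus, carried by the cell, and orthogonality relations\<close>

definition cell_measure :: "(real^'d) measure" where
  "cell_measure = density lborel (indicator cell)"

lemma sets_cell_measure [simp, measurable_cong]: "sets cell_measure = sets borel"
  by (simp add: cell_measure_def)

lemma space_cell_measure [simp]: "space cell_measure = UNIV"
  by (simp add: cell_measure_def)

lemma prob_space_cell_measure: "prob_space cell_measure"
  by (intro prob_spaceI) (simp add: cell_measure_def emeasure_density emeasure_cell)

lemma measure_cell_measure_UNIV [simp]: "measure cell_measure UNIV = 1"
  using prob_space.prob_space[OF prob_space_cell_measure] by simp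

lemma nn_integral_cell_measure:
  "f \<in> borel_measurable borel \<Longrightarrow> (\<integral>\<^sup>+x. f x \<partial>cell_measure) = (\<integral>\<^sup>+x. f x * indicator cell x \<partial>lborel)"
  unfolding cell_measure_def by (subst nn_integral_density) (auto simp: mult.commute)

text \<open>Translation invariance of Haar measure: the translated cell is again a fundamental
  domain, so exactly one lattice translate of each point lies in it, and unfolding moves the
  integral back to the original cell.\<close>

lemma nn_integral_cell_measure_shift:
  assumes [measurable]: "F \<in> borel_measurable borel" and F: "periodic F"
  shows "(\<integral>\<^sup>+x. F (y + x) \<partial>cell_measure) = (\<integral>\<^sup>+x. F x \<partial>cell_measure)"
proof -
  have 1: "(\<integral>\<^sup>+v. F (x + v) * indicator cell (x + v - y) \<partial>count_space \<Lambda>) = F x" for x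
  proof -
    have "(\<integral>\<^sup>+v. F (x + v) * indicator cell (x + v - y) \<partial>count_space \<Lambda>) =
          (\<integral>\<^sup>+v. F x * indicator {cell_rep (x - y) - (x - y)} v \<partial>count_space \<Lambda>)"
    proof (rule nn_integral_cong)
      fix v assume "v \<in> space (count_space \<Lambda>)"
      then have v: "v \<in> \<Lambda>" by simp
      have "x + v - y \<in> cell \<longleftrightarrow> v = cell_rep (x - y) - (x - y)"
      proof
        assume "x + v - y \<in> cell"
        from cell_rep_unique[OF this, of "x - y"] v show "v = cell_rep (x - y) - (x - y)"
          by (simp add: lattice_uminus_iff algebra_simps)
      next
        assume "v = cell_rep (x - y) - (x - y)"
        then have "x + v - y = cell_rep (x - y)" by simp
        then show "x + v - y \<in> cell" by simp
      qed
      then show "F (x + v) * indicator cell (x + v - y) = F x * indicator {cell_rep (x - y) - (x - y)} v"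
        using periodicD[OF F v, of x] by (auto simp: indicator_def)
    qed
    moreover have "cell_rep (x - y) - (x - y) \<in> \<Lambda>"
      using diff_cell_rep_in_lattice[of "x - y"] lattice_uminus_iff[of "x - y - cell_rep (x - y)"] by simp
    ultimately show ?thesis by (simp add: nn_integral_cmult)
  qed
  have "(\<integral>\<^sup>+x. F (y + x) \<partial>cell_measure) = (\<integral>\<^sup>+x. F (y + x) * indicator cell (y + x - y) \<partial>lborel)"
    by (subst nn_integral_cell_measure) auto
  also have "\<dots> = (\<integral>\<^sup>+x. F x * indicator cell (x - y) \<partial>lborel)"
    by (rule nn_integral_lborel_shift) measurable
  also have "\<dots> = (\<integral>\<^sup>+x. (\<integral>\<^sup>+v. F (x + v) * indicator cell (x + v - y) \<partial>count_space \<Lambda>) * indicator cell x \<partial>lborel)"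
    by (rule nn_integral_unfold) measurable
  also have "\<dots> = (\<integral>\<^sup>+x. F x \<partial>cell_measure)"
    by (simp add: 1 nn_integral_cell_measure)
  finally show ?thesis .
qed

lemma integrable_cell_measure:
  fixes g :: "real^'d \<Rightarrow> real"
  assumes "continuous_on UNIV g" "periodic g"
  shows "integrable cell_measure g"
proof -
  interpret prob_space cell_measure by (rule prob_space_cell_measure)
  obtain B where "\<And>x. \<bar>g x\<bar> \<le> B" using periodic_bounded[OF assms] by blast
  then show ?thesis
    using borel_measurable_continuous_onI[OF assms(1)]
    by (intro integrable_const_bound[where B=B]) (auto intro!: AE_I2 simp: measurable_cong_sets[OF sets_cell_measure refl])
qed

text \<open>Translation by \<open>y\<close> reverses the sign of \<open>g\<close> but preserves the
  integral. Invariance is available for nonnegative integrands only, hence the comparison of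
  \<open>1 - g\<close> with \<open>1 + g\<close>.\<close>

lemma integral_cell_measure_antiperiodic:
  fixes g :: "real^'d \<Rightarrow> real"
  assumes g: "continuous_on UNIV g" "periodic g" "\<And>x. \<bar>g x\<bar> \<le> 1" and y: "\<And>x. g (y + x) = - g x"
  shows "(\<integral>x. g x \<partial>cell_measure) = 0"
proof -
  interpret prob_space cell_measure by (rule prob_space_cell_measure)
  have int: "integrable cell_measure g" by (rule integrable_cell_measure) fact+
  have nn: "0 \<le> 1 + g x" "0 \<le> 1 - g x" for x using g(3)[of x] by auto
  have [measurable]: "g \<in> borel_measurable borel"
    by (rule borel_measurable_continuous_onI) fact
  have "ennreal (1 - (\<integral>x. g x \<partial>cell_measure)) = (\<integral>\<^sup>+x. ennreal (1 + g (y + x)) \<partial>cell_measure)"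
    using int nn by (subst nn_integral_eq_integral) (auto simp: y prob_space intro!: AE_I2)
  also have "\<dots> = (\<integral>\<^sup>+x. ennreal (1 + g x) \<partial>cell_measure)"
    using g(2) by (intro nn_integral_cell_measure_shift) (auto simp: periodic_def)
  also have "\<dots> = ennreal (1 + (\<integral>x. g x \<partial>cell_measure))"
    using int nn by (subst nn_integral_eq_integral) (auto simp: prob_space intro!: AE_I2)
  finally have eq: "ennreal (1 - (\<integral>x. g x \<partial>cell_measure)) = ennreal (1 + (\<integral>x. g x \<partial>cell_measure))" .
  have "\<bar>\<integral>x. g x \<partial>cell_measure\<bar> \<le> (\<integral>x. \<bar>g x\<bar> \<partial>cell_measure)" by (rule integral_abs_bound)
  also have "\<dots> \<le> (\<integral>x. 1 \<partial>cell_measure)" using int g(3) by (intro integral_mono) auto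
  finally have "\<bar>\<integral>x. g x \<partial>cell_measure\<bar> \<le> 1" by (simp add: prob_space)
  with eq show ?thesis by (simp add: ennreal_inj)
qed

lemma integral_cos_cell:
  assumes w: "w \<in> dual"
  shows "(\<integral>x. cos (2 * pi * (w \<bullet> x)) \<partial>cell_measure) = (if w = 0 then 1 else 0)"
    and "(\<integral>x. sin (2 * pi * (w \<bullet> x)) \<partial>cell_measure) = 0"
proof -
  interpret prob_space cell_measure by (rule prob_space_cell_measure)
  \<comment> \<open>Chosen so that \<open>w \<bullet> y = 1 / 2\<close>: translation by
    \<open>y\<close> is half a period of the wave with frequency \<open>w\<close>.\<close>
  define y where "y = (1 / (2 * (w \<bullet> w))) *\<^sub>R w"
  have y: "2 * pi * (w \<bullet> (y + x)) = 2 * pi * (w \<bullet> x) + pi" if "w \<noteq> 0" for x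
  proof -
    have "w \<bullet> (y + x) = 1 / 2 + w \<bullet> x" using that by (simp add: y_def inner_add_right)
    then show ?thesis by (simp add: distrib_left)
  qed
  have "(\<integral>x. cos (2 * pi * (w \<bullet> x)) \<partial>cell_measure) = 0" if "w \<noteq> 0"
    by (rule integral_cell_measure_antiperiodic[where y=y])
      (auto intro!: continuous_intros periodic_cos w simp: y[OF that])
  then show "(\<integral>x. cos (2 * pi * (w \<bullet> x)) \<partial>cell_measure) = (if w = 0 then 1 else 0)"
    by (auto simp: prob_space)
  have "(\<integral>x. sin (2 * pi * (w \<bullet> x)) \<partial>cell_measure) = 0" if "w \<noteq> 0"
    by (rule integral_cell_measure_antiperiodic[where y=y])
      (auto intro!: continuous_intros periodic_sin w simp: y[OF that])
  then show "(\<integral>x. sin (2 * pi * (w \<bullet> x)) \<partial>cell_measure) = 0"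
    by (cases "w = 0") auto
qed

lemma integrable_trig_cell:
  assumes "w \<in> dual"
  shows "integrable cell_measure (\<lambda>x. cos (2 * pi * (w \<bullet> x)))" "integrable cell_measure (\<lambda>x. sin (2 * pi * (w \<bullet> x)))"
  by (intro integrable_cell_measure periodic_cos periodic_sin assms continuous_intros)+

text \<open>Cosines do not distinguish \<open>w\<close> from \<open>- w\<close>, hence two
  indicators; for \<open>u = 0\<close> they coincide and add up to the value 1.\<close>

lemma integral_trig_products_cell:
  assumes w: "w \<in> dual" "u \<in> dual"
  shows "(\<integral>x. cos (2 * pi * (w \<bullet> x)) * cos (2 * pi * (u \<bullet> x)) \<partial>cell_measure) = (indicator {u} w + indicator {- u} w) / 2"
    and "(\<integral>x. cos (2 * pi * (w \<bullet> x)) * sin (2 * pi * (u \<bullet> x)) \<partial>cell_measure) = 0"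
proof -
  have d: "w - u \<in> dual" "w + u \<in> dual" using w by (auto intro: dual_diff dual_add)
  note [simp] = integrable_trig_cell[OF d(1)] integrable_trig_cell[OF d(2)]
    integral_cos_cell[OF d(1)] integral_cos_cell[OF d(2)]
  show "(\<integral>x. cos (2 * pi * (w \<bullet> x)) * cos (2 * pi * (u \<bullet> x)) \<partial>cell_measure) = (indicator {u} w + indicator {- u} w) / 2"
    unfolding trig_products by (auto simp: indicator_def eq_neg_iff_add_eq_0)
  show "(\<integral>x. cos (2 * pi * (w \<bullet> x)) * sin (2 * pi * (u \<bullet> x)) \<partial>cell_measure) = 0"
    unfolding trig_products by simp
qed

text \<open>Since \<open>\<phi>\<close> is periodic, it can be moved inside the lattice sum, and
  unfolding turns the integral over the cell into one over the whole space.\<close>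

lemma integral_theta_cell:
  fixes \<phi> :: "real^'d \<Rightarrow> real"
  assumes t: "t > 0" and \<phi>: "continuous_on UNIV \<phi>" "periodic \<phi>" "\<And>x. \<bar>\<phi> x\<bar> \<le> 1"
    and c: "has_bochner_integral lborel (\<lambda>x. exp (- t * (norm x)\<^sup>2) * \<phi> x) c"
  shows "(\<integral>x. theta t x * \<phi> x \<partial>cell_measure) = c"
proof -
  \<comment> \<open>Stated for \<open>1 + \<psi>\<close>, which is nonnegative, so that the
    unfolding of nonnegative integrals applies; the instance \<open>\<psi> = 0\<close> is subtracted
    at the end.\<close>
  have main: "(\<integral>x. theta t x * (1 + \<psi> x) \<partial>cell_measure) = dual_heat (0 :: real^'d) t + c"
    if \<psi>: "continuous_on UNIV \<psi>" "periodic \<psi>" "\<And>x. \<bar>\<psi> x\<bar> \<le> 1"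
      and c: "has_bochner_integral lborel (\<lambda>x. exp (- t * (norm x)\<^sup>2) * \<psi> x) c" for \<psi> c
  proof -
    have [measurable]: "\<psi> \<in> borel_measurable borel"
      by (rule borel_measurable_continuous_onI) fact
    have [measurable]: "theta t \<in> borel_measurable borel"
      by (rule borel_measurable_continuous_onI) (rule continuous_on_theta[OF t])
    have nn: "0 \<le> 1 + \<psi> x" for x using \<psi>(3)[of x] by auto
    have hb: "has_bochner_integral lborel (\<lambda>x. exp (- t * (norm x)\<^sup>2) * (1 + \<psi> x)) (dual_heat (0 :: real^'d) t + c)"
      using has_bochner_integral_add[OF has_bochner_integral_gaussian[OF t] c] by (simp add: distrib_left)
    have "0 \<le> (\<integral>x. exp (- t * (norm (x :: real^'d))\<^sup>2) * (1 + \<psi> x) \<partial>lborel)"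
      using nn by (intro integral_nonneg_AE) auto
    then have pos: "0 \<le> dual_heat (0 :: real^'d) t + c"
      using hb by (simp add: has_bochner_integral_iff)
    have pt: "periodic (theta t)" by (rule periodic_theta)
    have int: "integrable cell_measure (\<lambda>x. theta t x * (1 + \<psi> x))"
      using \<psi> pt by (intro integrable_cell_measure continuous_intros continuous_on_theta[OF t]) (auto simp: periodic_def)
    have "ennreal (\<integral>x. theta t x * (1 + \<psi> x) \<partial>cell_measure) = (\<integral>\<^sup>+x. ennreal (theta t x * (1 + \<psi> x)) \<partial>cell_measure)"
      using int nn theta_nonneg by (subst nn_integral_eq_integral) auto
    also have "\<dots> = (\<integral>\<^sup>+x. ennreal (theta t x * (1 + \<psi> x)) * indicator cell x \<partial>lborel)"
      by (rule nn_integral_cell_measure) measurable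
    also have "\<dots> = (\<integral>\<^sup>+x. (\<integral>\<^sup>+v. ennreal (exp (- t * (norm (x + v))\<^sup>2) * (1 + \<psi> (x + v))) \<partial>count_space \<Lambda>) * indicator cell x \<partial>lborel)"
    proof (rule nn_integral_cong)
      fix x :: "real^'d"
      have "(\<integral>\<^sup>+v. ennreal (exp (- t * (norm (x + v))\<^sup>2) * (1 + \<psi> (x + v))) \<partial>count_space \<Lambda>) =
          (\<integral>\<^sup>+v. ennreal (exp (- t * (norm (x + v))\<^sup>2)) * ennreal (1 + \<psi> x) \<partial>count_space \<Lambda>)"
        using nn by (intro nn_integral_cong) (simp add: ennreal_mult periodicD[OF \<psi>(2)])
      also have "\<dots> = ennreal (theta t x * (1 + \<psi> x))"
        using nn theta_nonneg by (simp only: nn_integral_multc nn_integral_theta[OF t] ennreal_mult borel_measurable_count_space)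
      finally show "ennreal (theta t x * (1 + \<psi> x)) * indicator cell x =
        (\<integral>\<^sup>+v. ennreal (exp (- t * (norm (x + v))\<^sup>2) * (1 + \<psi> (x + v))) \<partial>count_space \<Lambda>) * indicator cell x"
        by simp
    qed
    also have "\<dots> = (\<integral>\<^sup>+x. ennreal (exp (- t * (norm x)\<^sup>2) * (1 + \<psi> x)) \<partial>lborel)"
      by (rule nn_integral_unfold[symmetric]) measurable
    also have "\<dots> = ennreal (dual_heat (0 :: real^'d) t + c)"
      using hb nn by (subst nn_integral_eq_integral) (auto simp: has_bochner_integral_iff)
    finally show ?thesis
      using pos nn theta_nonneg by (subst (asm) ennreal_inj) (auto intro!: integral_nonneg_AE)
  qed
  have 0: "(\<integral>x. theta t x \<partial>cell_measure) = dual_heat (0 :: real^'d) t"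
  proof -
    have "has_bochner_integral lborel (\<lambda>x :: real^'d. 0 :: real) 0" by (rule has_bochner_integral_zero)
    then show ?thesis using main[of "\<lambda>_. 0" 0] by (simp add: periodic_def)
  qed
  have pt: "periodic (theta t)" by (rule periodic_theta)
  have "integrable cell_measure (theta t)" "integrable cell_measure (\<lambda>x. theta t x * \<phi> x)"
    using \<phi> pt by (intro integrable_cell_measure continuous_intros continuous_on_theta[OF t]; auto simp: periodic_def)+
  then show ?thesis using main[OF \<phi> c] 0 by (simp add: distrib_left)
qed

lemma integral_count_space_dual_indicator:
  assumes "u \<in> dual"
  shows "(\<integral>w. g w * ((indicator {u} w + indicator {- u} w) / 2) \<partial>count_space dual) = (g u + g (- u)) / (2 :: real)"
proof -
  have "(\<integral>w. g w * ((indicator {u} w + indicator {- u} w) / 2) \<partial>count_space dual) =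
      (\<integral>w. (g u / 2) * indicator {u} w + (g (- u) / 2) * indicator {- u} w \<partial>count_space dual)"
  proof (intro Bochner_Integration.integral_cong refl)
    fix w
    have *: "g w * indicator {u} w = g u * indicator {u} w" "g w * indicator {- u} w = g (- u) * indicator {- u} w"
      by (cases "w = u"; simp) (cases "w = - u"; simp)
    have "g w * ((indicator {u} w + indicator {- u} w) / 2) =
        (g w * indicator {u} w) / 2 + (g w * indicator {- u} w) / 2"
      by (simp add: add_divide_distrib distrib_left)
    also have "\<dots> = (g u / 2) * indicator {u} w + (g (- u) / 2) * indicator {- u} w"
      unfolding * by simp
    finally show "g w * ((indicator {u} w + indicator {- u} w) / 2) =
        (g u / 2) * indicator {u} w + (g (- u) / 2) * indicator {- u} w" .
  qed
  also have "\<dots> = g u / 2 + g (- u) / 2"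
    using assms dual_uminus[OF assms] by (subst Bochner_Integration.integral_add) (auto simp: integrable_indicator_iff measure_count_space)
  finally show ?thesis by (simp add: add_divide_distrib)
qed

text \<open>Both sides are continuous and periodic with the same Fourier coefficients, the left one by
  unfolding the integral over the cell to an integral over the whole space.\<close>

theorem poisson_summation:
  assumes t: "t > 0"
  shows "theta t x = (\<integral>w. dual_heat w t * cos (2 * pi * (w \<bullet> x)) \<partial>count_space dual)"
proof -
  interpret prob_space cell_measure by (rule prob_space_cell_measure)
  define \<sigma> where "\<sigma> x = (\<integral>w. dual_heat w t * cos (2 * pi * (w \<bullet> x)) \<partial>count_space dual)" for x
  have h: "dual_heat w t \<ge> 0" for w :: "real^'d" using dual_heat_pos[OF t, of w] by simp
  have bd: "\<bar>dual_heat w t * cos (2 * pi * (w \<bullet> x))\<bar> \<le> dual_heat w t" for w x :: "real^'d"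
    using h[of w] by (simp add: abs_mult mult_left_le)
  have \<sigma>_cont: "continuous_on UNIV \<sigma>"
    unfolding \<sigma>_def[abs_def]
    by (rule continuous_on_integral_count_space[OF _ integrable_dual_heat[OF t]]) (auto intro!: continuous_intros bd)
  have \<sigma>_per: "periodic \<sigma>"
    unfolding periodic_def \<sigma>_def
    by (auto intro!: Bochner_Integration.integral_cong simp: periodicD[OF periodic_cos])
  have \<sigma>_trig: "(\<integral>x. \<sigma> x * \<phi> x \<partial>cell_measure) = (\<integral>w. dual_heat w t * (\<integral>x. cos (2 * pi * (w \<bullet> x)) * \<phi> x \<partial>cell_measure) \<partial>count_space dual)"
    if \<phi>: "continuous_on UNIV \<phi>" "\<And>x. \<bar>\<phi> x\<bar> \<le> 1" for \<phi>
  proof -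
    have [measurable]: "\<phi> \<in> borel_measurable borel" by (rule borel_measurable_continuous_onI) fact
    have "(\<integral>x. \<sigma> x * \<phi> x \<partial>cell_measure) =
        (\<integral>x. (\<integral>w. dual_heat w t * (cos (2 * pi * (w \<bullet> x)) * \<phi> x) \<partial>count_space dual) \<partial>cell_measure)"
      by (simp add: \<sigma>_def mult.assoc[symmetric])
    also have "\<dots> = (\<integral>w. (\<integral>x. dual_heat w t * (cos (2 * pi * (w \<bullet> x)) * \<phi> x) \<partial>cell_measure) \<partial>count_space dual)"
    proof (rule integral_count_space_swap(2)[OF countable_dual _ _ integrable_dual_heat[OF t]])
      show "\<bar>dual_heat w t * (cos (2 * pi * (w \<bullet> x)) * \<phi> x)\<bar> \<le> dual_heat w t" for w x
        using h[of w] mult_mono[of "\<bar>cos (2 * pi * (w \<bullet> x))\<bar>" 1 "\<bar>\<phi> x\<bar>" 1] \<phi>(2)[of x]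
        by (simp add: abs_mult mult_left_le)
    qed (auto intro: finite_measure_axioms)
    finally show ?thesis by simp
  qed
  \<comment> \<open>All cosine and sine coefficients of \<open>F\<close> vanish, so \<open>F\<close>
    is orthogonal to every trigonometric polynomial, and by density to itself.\<close>
  define F where "F x = theta t x - \<sigma> x" for x
  have F_cont: "continuous_on UNIV F"
    unfolding F_def[abs_def] by (intro continuous_intros continuous_on_theta[OF t] \<sigma>_cont)
  have F_per: "periodic F"
    using periodic_theta \<sigma>_per by (simp add: periodic_def F_def)
  have F_cos: "(\<integral>x. F x * cos (2 * pi * (u \<bullet> x)) \<partial>cell_measure) = 0"
    and F_sin: "(\<integral>x. F x * sin (2 * pi * (u \<bullet> x)) \<partial>cell_measure) = 0" if u: "u \<in> dual" for u
  proof -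
    have int: "integrable cell_measure (\<lambda>x. g x * cos (2 * pi * (u \<bullet> x)))"
       "integrable cell_measure (\<lambda>x. g x * sin (2 * pi * (u \<bullet> x)))"
      if "continuous_on UNIV g" "periodic g" for g
      using that periodic_cos[OF u] periodic_sin[OF u]
      by (intro integrable_cell_measure continuous_intros; auto simp: periodic_def)+
    have "(\<integral>x. theta t x * cos (2 * pi * (u \<bullet> x)) \<partial>cell_measure) = dual_heat u t"
      by (intro integral_theta_cell t continuous_intros periodic_cos u has_bochner_integral_gaussian_cos) auto
    moreover have "(\<integral>x. \<sigma> x * cos (2 * pi * (u \<bullet> x)) \<partial>cell_measure) = dual_heat u t"
    proof -
      have "(\<integral>x. \<sigma> x * cos (2 * pi * (u \<bullet> x)) \<partial>cell_measure) =
          (\<integral>w. dual_heat w t * ((indicator {u} w + indicator {- u} w) / 2) \<partial>count_space dual)"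
      proof (subst \<sigma>_trig)
        show "continuous_on UNIV (\<lambda>x. cos (2 * pi * (u \<bullet> x)))" by (intro continuous_intros)
        show "(\<integral>w. dual_heat w t * (\<integral>x. cos (2 * pi * (w \<bullet> x)) * cos (2 * pi * (u \<bullet> x)) \<partial>cell_measure) \<partial>count_space dual) =
          (\<integral>w. dual_heat w t * ((indicator {u} w + indicator {- u} w) / 2) \<partial>count_space dual)"
          by (intro Bochner_Integration.integral_cong refl) (simp only: space_count_space integral_trig_products_cell(1)[OF _ u])
      qed simp
      also have "\<dots> = (dual_heat u t + dual_heat (- u) t) / 2"
        by (rule integral_count_space_dual_indicator[OF u])
      finally show ?thesis by (simp add: dual_heat_def)
    qed
    ultimately show "(\<integral>x. F x * cos (2 * pi * (u \<bullet> x)) \<partial>cell_measure) = 0"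
      using int(1)[OF continuous_on_theta[OF t] periodic_theta] int(1)[OF \<sigma>_cont \<sigma>_per]
      by (simp add: F_def left_diff_distrib)
    have "(\<integral>x. theta t x * sin (2 * pi * (u \<bullet> x)) \<partial>cell_measure) = 0"
      by (intro integral_theta_cell t continuous_intros periodic_sin u has_bochner_integral_gaussian_cos) auto
    moreover have "(\<integral>x. \<sigma> x * sin (2 * pi * (u \<bullet> x)) \<partial>cell_measure) = (\<integral>w. 0 \<partial>count_space dual)"
    proof (subst \<sigma>_trig)
      show "continuous_on UNIV (\<lambda>x. sin (2 * pi * (u \<bullet> x)))" by (intro continuous_intros)
      show "(\<integral>w. dual_heat w t * (\<integral>x. cos (2 * pi * (w \<bullet> x)) * sin (2 * pi * (u \<bullet> x)) \<partial>cell_measure) \<partial>count_space dual) =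
        (\<integral>w. 0 \<partial>count_space dual)"
        by (intro Bochner_Integration.integral_cong refl)
          (simp only: space_count_space integral_trig_products_cell(2)[OF _ u] mult_zero_right)
    qed simp
    ultimately show "(\<integral>x. F x * sin (2 * pi * (u \<bullet> x)) \<partial>cell_measure) = 0"
      using int(2)[OF continuous_on_theta[OF t] periodic_theta] int(2)[OF \<sigma>_cont \<sigma>_per]
      by (simp add: F_def left_diff_distrib)
  qed
  have int_mult: "integrable cell_measure (\<lambda>x. F x * g x)" if "continuous_on UNIV g" "periodic g" for g
    using that F_per by (intro integrable_cell_measure continuous_intros F_cont) (auto simp: periodic_def)
  have F_poly: "(\<integral>x. F x * p x \<partial>cell_measure) = 0" if "p \<in> trig_poly" for p
    using that
  proof induction
    case (cosI w c)
    have "(\<lambda>x. F x * (c * cos (2 * pi * (w \<bullet> x)))) = (\<lambda>x. c * (F x * cos (2 * pi * (w \<bullet> x))))" by auto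
    then show ?case using F_cos[OF cosI] by simp
  next
    case (sinI w c)
    have "(\<lambda>x. F x * (c * sin (2 * pi * (w \<bullet> x)))) = (\<lambda>x. c * (F x * sin (2 * pi * (w \<bullet> x))))" by auto
    then show ?case using F_sin[OF sinI] by simp
  next
    case (addI p q)
    then show ?case
      using int_mult[OF trig_poly_continuous trig_poly_periodic] by (simp add: distrib_left)
  qed
  obtain B where B: "\<And>x. \<bar>F x\<bar> \<le> B" using periodic_bounded[OF F_cont F_per] by blast
  have F2: "(\<integral>x. F x * F x \<partial>cell_measure) = 0"
  proof (rule antisym)
    show "(\<integral>x. F x * F x \<partial>cell_measure) \<le> 0"
    proof (rule field_le_epsilon)
      fix e :: real assume e: "e > 0"
      define d where "d = e / (\<bar>B\<bar> + 1)"
      have d: "d > 0" using e by (simp add: d_def)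
      obtain p where p: "p \<in> trig_poly" "\<And>x. \<bar>F x - p x\<bar> < d"
        using trig_poly_dense[OF F_cont F_per d] by blast
      note pc = trig_poly_continuous[OF p(1)] trig_poly_periodic[OF p(1)]
      have "(\<integral>x. F x * F x \<partial>cell_measure) = (\<integral>x. F x * (F x - p x) \<partial>cell_measure)"
        using int_mult[OF F_cont F_per] int_mult[OF pc] F_poly[OF p(1)] by (simp add: right_diff_distrib)
      also have "\<dots> \<le> (\<integral>x. \<bar>B\<bar> * d \<partial>cell_measure)"
      proof (rule integral_mono)
        show "integrable cell_measure (\<lambda>x. F x * (F x - p x))"
          using int_mult[OF F_cont F_per] int_mult[OF pc] by (simp add: right_diff_distrib)
        show "F x * (F x - p x) \<le> \<bar>B\<bar> * d" for x
        proof -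
          have "F x * (F x - p x) \<le> \<bar>F x\<bar> * \<bar>F x - p x\<bar>" by (metis abs_ge_self abs_mult)
          also have "\<dots> \<le> \<bar>B\<bar> * d" using B[of x] p(2)[of x] by (intro mult_mono) auto
          finally show ?thesis .
        qed
      qed simp
      also have "\<dots> = \<bar>B\<bar> * d" by (simp add: prob_space)
      also have "\<dots> \<le> (\<bar>B\<bar> + 1) * d" using d by (intro mult_right_mono) auto
      also have "\<dots> = 0 + e" by (simp add: d_def)
      finally show "(\<integral>x. F x * F x \<partial>cell_measure) \<le> 0 + e" .
    qed
  qed (simp add: integral_nonneg_AE)
  have F_meas [measurable]: "F \<in> borel_measurable borel" by (rule borel_measurable_continuous_onI) fact
  have "AE x in cell_measure. F x * F x = 0"
    using F2 int_mult[OF F_cont F_per] by (subst (asm) integral_nonneg_eq_0_iff_AE) auto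
  then have AE: "AE x in lborel. x \<in> cell \<longrightarrow> F x = 0"
    unfolding cell_measure_def by (subst (asm) AE_density) (auto simp: indicator_def)
  \<comment> \<open>From almost everywhere on the cell to everywhere: periodicity and unfolding make
    the open set \<open>S\<close> a null set, and a nonempty open set is never null.\<close>
  define S where "S = {x. F x \<noteq> 0}"
  have S: "open S" unfolding S_def
    by (intro open_Collect_neq F_cont continuous_on_const)
  have "emeasure lborel S = (\<integral>\<^sup>+x. (\<integral>\<^sup>+v. indicator S (x + v) \<partial>count_space \<Lambda>) * indicator cell x \<partial>lborel)"
    using S by (subst nn_integral_unfold[symmetric]) auto
  also have "\<dots> = (\<integral>\<^sup>+x. 0 \<partial>(lborel :: (real^'d) measure))"
  proof (rule nn_integral_cong_AE, use AE in eventually_elim)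
    fix x assume "x \<in> cell \<longrightarrow> F x = 0"
    then have "(\<integral>\<^sup>+v. indicator S (x + v) \<partial>count_space \<Lambda>) = (\<integral>\<^sup>+v. 0 \<partial>count_space \<Lambda>)" if "x \<in> cell"
      using that by (intro nn_integral_cong) (auto simp: S_def periodicD[OF F_per])
    then show "(\<integral>\<^sup>+v. indicator S (x + v) \<partial>count_space \<Lambda>) * indicator cell x = (0 :: ennreal)"
      by (cases "x \<in> cell") auto
  qed
  finally have "emeasure lborel S = 0" by simp
  then have "negligible S"
    using S by (simp add: negligible_iff_null_sets null_sets_def)
  then have "S = {}" using open_not_negligible[OF S] by blast
  then have "F x = 0" by (auto simp: S_def)
  then show ?thesis by (simp add: F_def \<sigma>_def)
qed

end

subsection \<open>Fourier representation of the truncated kernels\<close>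

text \<open>Connects the unordered sums in the definition of the kernel with integrals over counting
  measures, by exhausting \<open>A\<close> with finite sets.\<close>

lemma has_sum_nn_integral_count_space:
  fixes p :: "'a \<Rightarrow> ennreal"
  assumes "countable A"
  shows "(p has_sum (\<integral>\<^sup>+v. p v \<partial>count_space A)) A"
proof -
  have "(\<integral>\<^sup>+v. p v \<partial>count_space A) = (SUP F\<in>{F. finite F \<and> F \<subseteq> A}. sum p F)"
  proof (rule antisym)
    show "(SUP F\<in>{F. finite F \<and> F \<subseteq> A}. sum p F) \<le> (\<integral>\<^sup>+v. p v \<partial>count_space A)"
    proof (intro SUP_least)
      fix F assume F: "F \<in> {F. finite F \<and> F \<subseteq> A}"
      then have "sum p F = (\<integral>\<^sup>+v. p v * indicator F v \<partial>count_space A)"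
        by (subst nn_integral_count_space'[of F]) auto
      also have "\<dots> \<le> (\<integral>\<^sup>+v. p v \<partial>count_space A)"
        by (intro nn_integral_mono) (auto simp: indicator_def)
      finally show "sum p F \<le> (\<integral>\<^sup>+v. p v \<partial>count_space A)" .
    qed
  next
    define F where "F n = A \<inter> from_nat_into A ` {..n}" for n :: nat
    have F: "finite (F n)" "F n \<subseteq> A" for n by (auto simp: F_def)
    have incF: "incseq F" by (force simp: F_def incseq_def)
    have "(SUP n. p v * indicator (F n) v) = p v" if v: "v \<in> A" for v
    proof (rule antisym)
      obtain n where "from_nat_into A n = v" using from_nat_into_surj[OF assms v] by blast
      then have "v \<in> F n" using v by (auto simp: F_def)
      then show "p v \<le> (SUP n. p v * indicator (F n) v)" by (intro SUP_upper2[of n]) auto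
    qed (auto intro!: SUP_least simp: indicator_def)
    then have "(\<integral>\<^sup>+v. p v \<partial>count_space A) = (\<integral>\<^sup>+v. (SUP n. p v * indicator (F n) v) \<partial>count_space A)"
      by (intro nn_integral_cong) auto
    also have "\<dots> = (SUP n. \<integral>\<^sup>+v. p v * indicator (F n) v \<partial>count_space A)"
      using incF by (intro nn_integral_monotone_convergence_SUP)
        (auto simp: incseq_def le_fun_def indicator_def)
    also have "\<dots> = (SUP n. sum p (F n))"
    proof (intro SUP_cong refl)
      show "(\<integral>\<^sup>+v. p v * indicator (F n) v \<partial>count_space A) = sum p (F n)" for n
        using F by (subst nn_integral_count_space'[of "F n"]) auto
    qed
    also have "\<dots> \<le> (SUP F\<in>{F. finite F \<and> F \<subseteq> A}. sum p F)"
      using F by (intro SUP_least SUP_upper) auto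
    finally show "(\<integral>\<^sup>+v. p v \<partial>count_space A) \<le> (SUP F\<in>{F. finite F \<and> F \<subseteq> A}. sum p F)" .
  qed
  then show ?thesis using nonneg_has_sum_complete[of A p] by simp
qed

text \<open>Finiteness of the second sum excludes \<open>\<infinity> - \<infinity>\<close>, termwise
  as well as in the limit.\<close>

lemma infsum_ereal_diff:
  fixes p q :: "'a \<Rightarrow> ennreal"
  assumes A: "countable A" and q: "(\<integral>\<^sup>+v. q v \<partial>count_space A) < \<infinity>"
  shows "(\<Sum>\<^sub>\<infinity>v\<in>A. enn2ereal (p v) - enn2ereal (q v)) =
    enn2ereal (\<integral>\<^sup>+v. p v \<partial>count_space A) - enn2ereal (\<integral>\<^sup>+v. q v \<partial>count_space A)"
proof (rule infsumI)
  let ?P = "\<integral>\<^sup>+v. p v \<partial>count_space A" and ?Q = "\<integral>\<^sup>+v. q v \<partial>count_space A"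
  have lim: "((\<lambda>F. enn2ereal (sum f F)) \<longlongrightarrow> enn2ereal (\<integral>\<^sup>+v. f v \<partial>count_space A)) (finite_subsets_at_top A)"
    for f :: "'a \<Rightarrow> ennreal"
    using has_sum_nn_integral_count_space[OF A, of f] unfolding has_sum_def
    by (rule tendsto_enn2erealI)
  have "AE v in count_space A. q v \<noteq> \<infinity>"
    using q by (intro nn_integral_PInf_AE) auto
  then have fin: "q v < \<infinity>" if "v \<in> A" for v using that by (simp add: AE_count_space less_top)
  have eq: "(\<Sum>v\<in>F. enn2ereal (p v) - enn2ereal (q v)) = enn2ereal (sum p F) + - enn2ereal (sum q F)" if "F \<subseteq> A" for F
  proof -
    have r: "enn2ereal (q v) = ereal (enn2real (q v))" if "v \<in> F" for v
      using fin[of v] \<open>F \<subseteq> A\<close> that by (metis enn2ereal_ennreal enn2real_nonneg ennreal_enn2real infinity_ennreal_def subsetD)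
    have "(\<Sum>v\<in>F. - enn2ereal (q v)) = - enn2ereal (sum q F)"
      using r by (simp add: sum_ereal sum_negf cong: sum.cong flip: sum_enn2ereal)
    then show ?thesis
      by (simp add: minus_ereal_def sum.distrib flip: sum_enn2ereal)
  qed
  have "((\<lambda>F. enn2ereal (sum p F) + - enn2ereal (sum q F)) \<longlongrightarrow> enn2ereal ?P + - enn2ereal ?Q) (finite_subsets_at_top A)"
  proof (rule tendsto_add_ereal_nonneg)
    show "enn2ereal ?P \<noteq> - \<infinity>" by simp
    show "- enn2ereal ?Q \<noteq> - \<infinity>" using q by (cases ?Q) auto
  qed (intro lim tendsto_uminus_ereal)+
  then have "((\<lambda>F. \<Sum>v\<in>F. enn2ereal (p v) - enn2ereal (q v)) \<longlongrightarrow> enn2ereal ?P - enn2ereal ?Q) (finite_subsets_at_top A)"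
    unfolding minus_ereal_def[of "enn2ereal ?P"]
    by (rule Lim_transform_eventually)
      (intro eventually_finite_subsets_at_top_weakI eq[symmetric])
  then show "((\<lambda>v. enn2ereal (p v) - enn2ereal (q v)) has_sum (enn2ereal ?P - enn2ereal ?Q)) A"
    by (simp add: has_sum_def)
qed

text \<open>Use \<open>ln x \<le> x - 1\<close> at \<open>x = c / (p * t)\<close>. The maximum lies
  at \<open>t = c / p\<close>, and a factor \<open>exp (- p)\<close> is given away.\<close>

lemma powr_exp_bound:
  fixes p c t :: real
  assumes "p > 0" "c > 0" "t > 0"
  shows "t powr (- p) * exp (- c / t) \<le> (p / c) powr p"
proof -
  have "ln (c / (p * t)) \<le> c / (p * t) - 1" using assms by (intro ln_le_minus_one) auto
  then have "p * ln (c / (p * t)) \<le> p * (c / (p * t) - 1)" using assms by (intro mult_left_mono) auto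
  also have "\<dots> = c / t - p" using assms by (simp add: field_simps)
  finally have "- p * ln t + - c / t \<le> p * ln (p / c)"
    using assms by (simp add: ln_div ln_mult algebra_simps)
  then have "exp (- p * ln t + - c / t) \<le> exp (p * ln (p / c))" by simp
  then show ?thesis using assms by (simp add: powr_def flip: exp_add)
qed

text \<open>The bound is uniform in \<open>t\<close>, so a finite measure has finite dual mass at
  \<open>w\<close>. At \<open>w = 0\<close> the function is unbounded near
  \<open>t = 0\<close>.\<close>

lemma dual_heat_le:
  fixes w :: "real^'d"
  assumes "w \<noteq> 0" "t > 0"
  shows "dual_heat w t \<le> pi powr (real CARD('d) / 2) * (real CARD('d) / 2 / (pi\<^sup>2 * (norm w)\<^sup>2)) powr (real CARD('d) / 2)"
proof -
  have "t powr (- (real CARD('d) / 2)) * exp (- (pi\<^sup>2 * (norm w)\<^sup>2) / t) \<le> (real CARD('d) / 2 / (pi\<^sup>2 * (norm w)\<^sup>2)) powr (real CARD('d) / 2)"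
    using assms by (intro powr_exp_bound) auto
  then have "pi powr (real CARD('d) / 2) * (t powr (- (real CARD('d) / 2)) * exp (- (pi\<^sup>2 * (norm w)\<^sup>2) / t)) \<le>
     pi powr (real CARD('d) / 2) * (real CARD('d) / 2 / (pi\<^sup>2 * (norm w)\<^sup>2)) powr (real CARD('d) / 2)"
    by (intro mult_left_mono) auto
  moreover have "dual_heat w t = pi powr (real CARD('d) / 2) * (t powr (- (real CARD('d) / 2)) * exp (- (pi\<^sup>2 * (norm w)\<^sup>2) / t))"
    unfolding dual_heat_def powr_minus_divide by simp
  ultimately show ?thesis by simp
qed

section \<open>Masses of a measure seen from the dual lattice and from the lattice\<close>

definition dual_mass :: "real measure \<Rightarrow> real set \<Rightarrow> real^'d \<Rightarrow> ennreal" where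
  "dual_mass m B w = (\<integral>\<^sup>+t\<in>B. ennreal (dual_heat w t) \<partial>m)"

locale measure_on_pos =
  fixes m :: "real measure"
  assumes sets_m: "sets m = sets (restrict_space borel {0<..})"
begin

lemma space_m: "space m = {0<..}"
  using sets_eq_imp_space_eq[OF sets_m] by (simp add: space_restrict_space)

lemma measurable_m: "f \<in> borel_measurable borel \<Longrightarrow> f \<in> borel_measurable m"
  using measurable_restrict_space1[of f borel borel "{0<..}"] measurable_cong_sets[OF sets_m refl, of borel] by blast

lemma measurable_dual_heat: "(\<lambda>t. ennreal (dual_heat w t)) \<in> borel_measurable m"
  by (rule measurable_m) measurable

lemma sets_mI: "B \<in> sets borel \<Longrightarrow> B \<subseteq> {0<..} \<Longrightarrow> B \<in> sets m"
  by (simp add: sets_m sets_restrict_space_iff)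

lemma dual_mass_finite:
  assumes fin: "finite_measure m" and w: "w \<noteq> 0"
  shows "dual_mass m B w < \<infinity>"
proof -
  define C where "C = pi powr (real CARD('a) / 2) * (real CARD('a) / 2 / (pi\<^sup>2 * (norm w)\<^sup>2)) powr (real CARD('a) / 2)"
  have C: "t > 0 \<Longrightarrow> dual_heat w t \<le> C" for t
    unfolding C_def by (rule dual_heat_le[OF w])
  have "dual_mass m B w \<le> (\<integral>\<^sup>+t. ennreal C \<partial>m)"
    unfolding dual_mass_def
    by (intro nn_integral_mono) (auto simp: space_m indicator_def intro!: ennreal_leI C)
  also have "\<dots> < \<infinity>"
    using finite_measure.emeasure_finite[OF fin, of "space m"] by (simp add: ennreal_mult_less_top less_top)
  finally show ?thesis .
qed

lemma set_nn_integral_SUP: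
  assumes f: "f \<in> borel_measurable borel"
  shows "(SUP n. \<integral>\<^sup>+t\<in>{1..real n}. f t \<partial>m) = (\<integral>\<^sup>+t\<in>{1..}. f t \<partial>m)"
proof -
  have "(SUP n. f t * indicator {1..real n} t) = f t * indicator {1..} t" for t
  proof (rule antisym)
    obtain n where "t \<le> real n" using real_arch_simple by blast
    then show "f t * indicator {1..} t \<le> (SUP n. f t * indicator {1..real n} t)"
      by (intro SUP_upper2[of n]) (auto simp: indicator_def)
  qed (auto intro!: SUP_least simp: indicator_def)
  then have "(\<integral>\<^sup>+t\<in>{1..}. f t \<partial>m) = (\<integral>\<^sup>+t. (SUP n. f t * indicator {1..real n} t) \<partial>m)" by simp
  also have "\<dots> = (SUP n. \<integral>\<^sup>+t\<in>{1..real n}. f t \<partial>m)"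
  proof (rule nn_integral_monotone_convergence_SUP)
    show "incseq (\<lambda>n t. f t * indicator {1..real n} t)"
      by (auto simp: incseq_def le_fun_def indicator_def)
    show "(\<lambda>t. f t * indicator {1..real n} t) \<in> borel_measurable m" for n
      using f by (intro measurable_m) auto
  qed
  finally show ?thesis by simp
qed

end

context unimodular_lattice
begin

definition lattice_mass :: "real measure \<Rightarrow> real set \<Rightarrow> real^'d \<Rightarrow> ennreal" where
  "lattice_mass m B x = (\<integral>\<^sup>+v. (\<integral>\<^sup>+t\<in>B. ennreal (exp (- (norm (x + v))\<^sup>2 * t)) \<partial>m) \<partial>count_space \<Lambda>)"

text \<open>For \<open>t \<ge> 1\<close> the Gaussian is at most its value at \<open>t = 1\<close>,
  so the sum is at most \<open>theta 1 x\<close> times the mass of \<open>B\<close>.\<close>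

lemma lattice_mass_finite:
  assumes "measure_on_pos m" and B: "B \<in> sets borel" "B \<subseteq> {1..}" and fin: "emeasure m B < \<infinity>"
  shows "lattice_mass m B x < \<infinity>"
proof -
  interpret measure_on_pos m by fact
  have Bm: "B \<in> sets m" using B by (intro sets_mI) auto
  have "lattice_mass m B x \<le> (\<integral>\<^sup>+v. ennreal (exp (- 1 * (norm (x + v))\<^sup>2)) * emeasure m B \<partial>count_space \<Lambda>)"
    unfolding lattice_mass_def
  proof (rule nn_integral_mono)
    fix v
    have "(\<integral>\<^sup>+t\<in>B. ennreal (exp (- (norm (x + v))\<^sup>2 * t)) \<partial>m) \<le> (\<integral>\<^sup>+t\<in>B. ennreal (exp (- 1 * (norm (x + v))\<^sup>2)) \<partial>m)"
    proof (rule nn_integral_mono)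
      fix t
      have "(norm (x + v))\<^sup>2 * 1 \<le> (norm (x + v))\<^sup>2 * t" if "t \<in> B" using B that by (intro mult_left_mono) auto
      then show "ennreal (exp (- (norm (x + v))\<^sup>2 * t)) * indicator B t \<le> ennreal (exp (- 1 * (norm (x + v))\<^sup>2)) * indicator B t"
        by (auto simp: indicator_def intro!: ennreal_leI)
    qed
    also have "\<dots> = ennreal (exp (- 1 * (norm (x + v))\<^sup>2)) * emeasure m B"
      by (rule nn_integral_cmult_indicator[OF Bm])
    finally show "(\<integral>\<^sup>+t\<in>B. ennreal (exp (- (norm (x + v))\<^sup>2 * t)) \<partial>m) \<le> ennreal (exp (- 1 * (norm (x + v))\<^sup>2)) * emeasure m B" .
  qed
  also have "\<dots> = ennreal (theta 1 x) * emeasure m B"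
    by (subst nn_integral_multc) (auto simp: nn_integral_theta[of 1, simplified])
  also have "\<dots> < \<infinity>" using fin by (simp add: ennreal_mult_less_top)
  finally show ?thesis .
qed

text \<open>Adding the value at the origin makes all terms of the cosine series nonnegative, so that
  Tonelli applies.\<close>

lemma lattice_mass_add:
  assumes "measure_on_pos m" and B: "B \<in> sets borel" "B \<subseteq> {0<..}"
  shows "lattice_mass m B 0 + lattice_mass m B x =
    (\<integral>\<^sup>+w. ennreal (1 + cos (2 * pi * (w \<bullet> x))) * dual_mass m B w \<partial>count_space dual)"
proof -
  interpret measure_on_pos m by fact
  have [measurable]: "(\<lambda>t. indicator B t :: ennreal) \<in> borel_measurable m"
    using B by (intro measurable_m) auto
  define e where "e v t = ennreal (exp (- (norm v)\<^sup>2 * t))" for v :: "real^'d" and t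
  have [measurable]: "e v \<in> borel_measurable m" for v
    unfolding e_def by (intro measurable_m) measurable
  note [measurable] = measurable_dual_heat
  have nn: "0 \<le> 1 + cos a" for a :: real using cos_ge_minus_one[of a] by linarith
  have "lattice_mass m B 0 + lattice_mass m B x =
    (\<integral>\<^sup>+v. (\<integral>\<^sup>+t. (e (0 + v) t + e (x + v) t) * indicator B t \<partial>m) \<partial>count_space \<Lambda>)"
  proof -
    have "(\<integral>\<^sup>+t. (e (0 + v) t + e (x + v) t) * indicator B t \<partial>m) =
        (\<integral>\<^sup>+t. e (0 + v) t * indicator B t \<partial>m) + (\<integral>\<^sup>+t. e (x + v) t * indicator B t \<partial>m)" for v
      unfolding distrib_right by (rule nn_integral_add) measurable
    then show ?thesis
      unfolding lattice_mass_def e_def[symmetric] by (simp only: nn_integral_add borel_measurable_count_space)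
  qed
  also have "\<dots> = (\<integral>\<^sup>+t. (\<integral>\<^sup>+v. (e (0 + v) t + e (x + v) t) * indicator B t \<partial>count_space \<Lambda>) \<partial>m)"
    by (rule nn_integral_count_space_nn_integral[symmetric]) (use countable_lattice in auto)
  also have "\<dots> = (\<integral>\<^sup>+t. (\<integral>\<^sup>+w. ennreal (1 + cos (2 * pi * (w \<bullet> x))) * (ennreal (dual_heat w t) * indicator B t) \<partial>count_space dual) \<partial>m)"
  proof (rule nn_integral_cong)
    fix t
    show "(\<integral>\<^sup>+v. (e (0 + v) t + e (x + v) t) * indicator B t \<partial>count_space \<Lambda>) =
      (\<integral>\<^sup>+w. ennreal (1 + cos (2 * pi * (w \<bullet> x))) * (ennreal (dual_heat w t) * indicator B t) \<partial>count_space dual)"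
    proof (cases "t \<in> B")
      case True
      then have t: "t > 0" using B by auto
      have h: "dual_heat w t \<ge> 0" for w :: "real^'d" using dual_heat_pos[OF t, of w] by simp
      have int: "integrable (count_space dual) (\<lambda>w. dual_heat w t * cos (2 * pi * (w \<bullet> y)))" for y
        using h by (intro integrable_count_space_bound[OF integrable_dual_heat[OF t]]) (simp add: abs_mult mult_left_le)
      have "(\<integral>\<^sup>+v. (e (0 + v) t + e (x + v) t) * indicator B t \<partial>count_space \<Lambda>)
         = ennreal (theta t 0) + ennreal (theta t x)"
        using True nn_integral_theta[OF t, of 0] nn_integral_theta[OF t, of x] by (simp add: e_def nn_integral_add mult.commute)
      also have "\<dots> = ennreal (theta t 0 + theta t x)" by (simp add: theta_nonneg)
      also have "theta t 0 + theta t x = (\<integral>w. dual_heat w t * (1 + cos (2 * pi * (w \<bullet> x))) \<partial>count_space dual)"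
        unfolding poisson_summation[OF t] using int[of 0] int[of x] by (simp add: distrib_left)
      also have "ennreal \<dots> = (\<integral>\<^sup>+w. ennreal (dual_heat w t * (1 + cos (2 * pi * (w \<bullet> x)))) \<partial>count_space dual)"
      proof (rule nn_integral_eq_integral[symmetric])
        show "integrable (count_space dual) (\<lambda>w. dual_heat w t * (1 + cos (2 * pi * (w \<bullet> x))))"
          using int[of 0] int[of x] by (simp add: distrib_left)
        show "AE w in count_space dual. 0 \<le> dual_heat w t * (1 + cos (2 * pi * (w \<bullet> x)))"
          using h nn by (intro AE_I2 mult_nonneg_nonneg)
      qed
      also have "\<dots> = (\<integral>\<^sup>+w. ennreal (1 + cos (2 * pi * (w \<bullet> x))) * (ennreal (dual_heat w t) * indicator B t) \<partial>count_space dual)"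
        using h nn True by (intro nn_integral_cong) (simp add: ennreal_mult mult.commute)
      finally show ?thesis .
    qed simp
  qed
  also have "\<dots> = (\<integral>\<^sup>+w. (\<integral>\<^sup>+t. ennreal (1 + cos (2 * pi * (w \<bullet> x))) * (ennreal (dual_heat w t) * indicator B t) \<partial>m) \<partial>count_space dual)"
    by (rule nn_integral_count_space_nn_integral) (use countable_dual in auto)
  also have "\<dots> = (\<integral>\<^sup>+w. ennreal (1 + cos (2 * pi * (w \<bullet> x))) * dual_mass m B w \<partial>count_space dual)"
    unfolding dual_mass_def by (intro nn_integral_cong nn_integral_cmult) measurable
  finally show ?thesis .
qed

text \<open>Finite mass on \<open>B\<close> makes both sides of \<open>lattice_mass_add\<close>
  finite, so that the value at the origin can be subtracted again.\<close>

lemma lattice_mass_fourier: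
  assumes m: "measure_on_pos m" and B: "B \<in> sets borel" "B \<subseteq> {1..}" and fin: "emeasure m B < \<infinity>"
  shows "w \<in> dual \<Longrightarrow> dual_mass m B w < \<infinity>"
    and "integrable (count_space dual) (\<lambda>w. enn2real (dual_mass m B w))"
    and "enn2real (lattice_mass m B x) = (\<integral>w. enn2real (dual_mass m B w) * cos (2 * pi * (w \<bullet> x)) \<partial>count_space dual)"
proof -
  have B0: "B \<subseteq> {0<..}" using B by auto
  note fin' = lattice_mass_finite[OF m B fin]
  note add = lattice_mass_add[OF m B(1) B0]
  \<comment> \<open>At \<open>x = 0\<close> the cosine factor in \<open>add\<close> is 2, so
    finiteness of the left side gives summability of the coefficients.\<close>
  have two: "(\<integral>\<^sup>+w. 2 * dual_mass m B w \<partial>count_space dual) < \<infinity>"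
  proof -
    have "lattice_mass m B 0 + lattice_mass m B 0 < \<infinity>" using fin'[of 0] by (simp add: ennreal_add_less_top)
    then show ?thesis by (simp add: add[of 0])
  qed
  then have "AE w in count_space dual. 2 * dual_mass m B w \<noteq> \<infinity>"
    by (intro nn_integral_PInf_AE) auto
  then have f: "dual_mass m B w < \<infinity>" if "w \<in> dual" for w
    using that by (auto simp: AE_count_space ennreal_mult_eq_top_iff less_top)
  then show "w \<in> dual \<Longrightarrow> dual_mass m B w < \<infinity>" .
  have er: "ennreal (enn2real (dual_mass m B w)) = dual_mass m B w" if "w \<in> dual" for w
    using f[OF that] by (simp add: less_top)
  have "(\<integral>\<^sup>+w. dual_mass m B w \<partial>count_space dual) < \<infinity>"
    using two by (subst (asm) nn_integral_cmult) (auto simp: ennreal_mult_less_top)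
  moreover have "(\<integral>\<^sup>+w. ennreal (norm (enn2real (dual_mass m B w))) \<partial>count_space dual) = (\<integral>\<^sup>+w. dual_mass m B w \<partial>count_space dual)"
    using er by (intro nn_integral_cong) simp
  ultimately have "(\<integral>\<^sup>+w. ennreal (norm (enn2real (dual_mass m B w))) \<partial>count_space dual) < \<infinity>"
    by simp
  then show int: "integrable (count_space dual) (\<lambda>w. enn2real (dual_mass m B w))"
    by (intro integrableI_bounded) auto
  have intc: "integrable (count_space dual) (\<lambda>w. enn2real (dual_mass m B w) * cos (2 * pi * (w \<bullet> x)))" for x
    by (intro integrable_count_space_bound[OF int]) (simp add: abs_mult mult_left_le)
  have nn: "0 \<le> 1 + cos a" for a :: real using cos_ge_minus_one[of a] by linarith
  have eq: "lattice_mass m B 0 + lattice_mass m B x =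
      ennreal (\<integral>w. enn2real (dual_mass m B w) * (1 + cos (2 * pi * (w \<bullet> x))) \<partial>count_space dual)" for x
  proof -
    have "lattice_mass m B 0 + lattice_mass m B x =
        (\<integral>\<^sup>+w. ennreal (enn2real (dual_mass m B w) * (1 + cos (2 * pi * (w \<bullet> x)))) \<partial>count_space dual)"
      unfolding add using er nn by (intro nn_integral_cong) (simp add: ennreal_mult mult.commute)
    also have "\<dots> = ennreal (\<integral>w. enn2real (dual_mass m B w) * (1 + cos (2 * pi * (w \<bullet> x))) \<partial>count_space dual)"
    proof (rule nn_integral_eq_integral)
      show "integrable (count_space dual) (\<lambda>w. enn2real (dual_mass m B w) * (1 + cos (2 * pi * (w \<bullet> x))))"
        using int intc[of x] by (simp add: distrib_left)
      show "AE w in count_space dual. 0 \<le> enn2real (dual_mass m B w) * (1 + cos (2 * pi * (w \<bullet> x)))"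
        using nn by (intro AE_I2 mult_nonneg_nonneg) auto
    qed
    finally show ?thesis .
  qed
  have eq': "enn2real (lattice_mass m B 0) + enn2real (lattice_mass m B x) =
      (\<integral>w. enn2real (dual_mass m B w) \<partial>count_space dual) + (\<integral>w. enn2real (dual_mass m B w) * cos (2 * pi * (w \<bullet> x)) \<partial>count_space dual)" for x
  proof -
    have "enn2real (lattice_mass m B 0 + lattice_mass m B x) =
        (\<integral>w. enn2real (dual_mass m B w) * (1 + cos (2 * pi * (w \<bullet> x))) \<partial>count_space dual)"
      unfolding eq using nn by (intro enn2real_ennreal integral_nonneg_AE) auto
    then show ?thesis
      using fin'[of 0] fin'[of x] int intc[of x] by (simp add: enn2real_plus less_top distrib_left)
  qed
  \<comment> \<open>The instance at 0 identifies the value at the origin with the sum of the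
    coefficients, which then cancels from the instance at \<open>x\<close>.\<close>
  show "enn2real (lattice_mass m B x) = (\<integral>w. enn2real (dual_mass m B w) * cos (2 * pi * (w \<bullet> x)) \<partial>count_space dual)"
    using eq'[of 0] eq'[of x] by simp
qed

text \<open>For \<open>t < 1\<close> the quotient of the heat factors of \<open>w\<close> and
  \<open>w0\<close> is at most its value at \<open>t = 1\<close>, because \<open>w\<close> is not
  shorter than \<open>w0\<close>. This value is \<open>E w\<close>; it decays like a Gaussian in
  \<open>w\<close>, so control at the shortest vector gives summability over the dual
  lattice.\<close>

lemma dual_mass_unit_interval:
  assumes "measure_on_pos m" and w0: "w0 \<in> dual - {0}" "\<forall>w \<in> dual - {0}. norm w0 \<le> norm w"
    and fin: "dual_mass m {0<..<1} w0 < \<infinity>"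
  shows "w \<in> dual - {0} \<Longrightarrow> dual_mass m {0<..<1} w < \<infinity>"
    and "integrable (count_space dual) (\<lambda>w. if w = 0 then 0 else enn2real (dual_mass m {0<..<1} w))"
proof -
  interpret measure_on_pos m by fact
  define E where "E w = exp (pi\<^sup>2 * (norm w0)\<^sup>2) * exp (- pi\<^sup>2 * (norm w)\<^sup>2)" for w :: "real^'d"
  have le: "dual_mass m {0<..<1} w \<le> ennreal (E w) * dual_mass m {0<..<1} w0" if w: "w \<in> dual - {0}" for w
  proof -
    have "dual_heat w t \<le> E w * dual_heat w0 t" if t: "0 < t" "t < 1" for t
    proof -
      have "(norm w0)\<^sup>2 \<le> (norm w)\<^sup>2" using w0(2) w by (intro power_mono) auto
      then have "0 \<le> (norm w)\<^sup>2 - (norm w0)\<^sup>2" by linarith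
      moreover have "1 \<le> 1 / t" using t by simp
      ultimately have "((norm w)\<^sup>2 - (norm w0)\<^sup>2) * 1 \<le> ((norm w)\<^sup>2 - (norm w0)\<^sup>2) * (1 / t)"
        by (rule mult_left_mono[rotated])
      then have "pi\<^sup>2 * (((norm w)\<^sup>2 - (norm w0)\<^sup>2) * 1) \<le> pi\<^sup>2 * (((norm w)\<^sup>2 - (norm w0)\<^sup>2) * (1 / t))"
        by (rule mult_left_mono) simp
      then have "- pi\<^sup>2 * (norm w)\<^sup>2 / t \<le> (pi\<^sup>2 * (norm w0)\<^sup>2 + - pi\<^sup>2 * (norm w)\<^sup>2) + - pi\<^sup>2 * (norm w0)\<^sup>2 / t"
        by (simp add: algebra_simps diff_divide_distrib)
      then have "exp (- pi\<^sup>2 * (norm w)\<^sup>2 / t) \<le> E w * exp (- pi\<^sup>2 * (norm w0)\<^sup>2 / t)"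
        unfolding E_def exp_add[symmetric] by (simp only: exp_le_cancel_iff)
      then have "(pi powr (real CARD('d) / 2) / t powr (real CARD('d) / 2)) * exp (- pi\<^sup>2 * (norm w)\<^sup>2 / t) \<le>
          (pi powr (real CARD('d) / 2) / t powr (real CARD('d) / 2)) * (E w * exp (- pi\<^sup>2 * (norm w0)\<^sup>2 / t))"
        by (intro mult_left_mono) auto
      then show ?thesis unfolding dual_heat_def by (simp only: ac_simps)
    qed
    then have "dual_mass m {0<..<1} w \<le> (\<integral>\<^sup>+t. ennreal (E w) * (ennreal (dual_heat w0 t) * indicator {0<..<1} t) \<partial>m)"
      unfolding dual_mass_def
      by (intro nn_integral_mono) (auto simp: indicator_def E_def ennreal_mult'[symmetric] intro!: ennreal_leI)
    also have "\<dots> = ennreal (E w) * dual_mass m {0<..<1} w0"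
      unfolding dual_mass_def by (intro nn_integral_cmult measurable_m) measurable
    finally show ?thesis .
  qed
  have lt: "ennreal (E w) * dual_mass m {0<..<1} w0 < \<infinity>" for w
    using fin by (simp add: ennreal_mult_less_top)
  show "w \<in> dual - {0} \<Longrightarrow> dual_mass m {0<..<1} w < \<infinity>"
    using le[of w] lt[of w] by (rule le_less_trans)
  show "integrable (count_space dual) (\<lambda>w. if w = 0 then 0 else enn2real (dual_mass m {0<..<1} w))"
  proof (rule integrable_count_space_bound)
    have "integrable (count_space dual) (\<lambda>w. exp (- pi\<^sup>2 * (norm w)\<^sup>2))"
      by (rule integrable_dual_gaussian) simp
    then show "integrable (count_space dual) (\<lambda>w. E w * enn2real (dual_mass m {0<..<1} w0))"
      by (simp add: E_def)
    have E0: "0 \<le> E w" for w by (simp add: E_def)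
    fix w assume w: "w \<in> dual"
    show "\<bar>if w = 0 then 0 else enn2real (dual_mass m {0<..<1} w)\<bar> \<le> E w * enn2real (dual_mass m {0<..<1} w0)"
    proof (cases "w = 0")
      case False
      have "enn2real (dual_mass m {0<..<1} w) \<le> enn2real (ennreal (E w) * dual_mass m {0<..<1} w0)"
        using le[of w] lt[of w] w False by (intro enn2real_mono) auto
      then show ?thesis using False E0[of w] by (simp add: enn2real_mult)
    qed (simp add: E0)
  qed
qed

lemma enn2ereal_diff_less_topD:
  assumes "enn2ereal A - enn2ereal B < \<infinity>" "B < \<infinity>" shows "A < \<infinity>"
  using assms by (cases A; cases B) (auto simp: enn2ereal_ennreal)

text \<open>Condition (W1) is evaluated at \<open>\<alpha> = 1\<close> and at a nonzero
  \<open>q\<close>, for which a shortest dual vector serves. The negative part is finite, so a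
  finite difference bounds the positive part itself. The weight decays in \<open>t\<close>, hence
  finite mass only on bounded intervals.\<close>

lemma weak_G_type_masses:
  assumes f: "weak_G_type V f \<mu>"
  shows "measure_on_pos (fst \<mu>)" and "measure_on_pos (snd \<mu>)" and "finite_measure (snd \<mu>)"
    and "emeasure (fst \<mu>) {1..real n} < \<infinity>"
    and "\<exists>w0 \<in> dual - {0}. (\<forall>w \<in> dual - {0}. norm w0 \<le> norm w) \<and> dual_mass (fst \<mu>) {0<..<1} w0 < \<infinity>"
proof -
  have sm: "signed_measure_finite_neg \<mu>" using f by (simp add: weak_G_type_def)
  show p: "measure_on_pos (fst \<mu>)" and q: "measure_on_pos (snd \<mu>)" and finq: "finite_measure (snd \<mu>)"
    using sm by (simp_all add: signed_measure_finite_neg_def measure_on_pos_def)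
  interpret p: measure_on_pos "fst \<mu>" by (rule p)
  interpret q: measure_on_pos "snd \<mu>" by (rule q)
  obtain w0 where w0: "w0 \<in> dual - {0}" "\<forall>w \<in> dual - {0}. norm w0 \<le> norm w"
    using minimal_dual_vector by blast
  then have nz: "w0 \<noteq> 0" by auto
  let ?e = "\<lambda>t. exp (- (norm w0)\<^sup>2 * t)"
  have "signed_integral \<mu> {1..} ?e < \<infinity>"
    using f nz unfolding weak_G_type_def by (metis zero_less_one)
  moreover have "(\<integral>\<^sup>+t\<in>{1..}. ennreal (?e t) \<partial>snd \<mu>) < \<infinity>"
  proof -
    have "(\<integral>\<^sup>+t\<in>{1..}. ennreal (?e t) \<partial>snd \<mu>) \<le> (\<integral>\<^sup>+t. 1 \<partial>snd \<mu>)"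
      by (intro nn_integral_mono) (auto simp: indicator_def)
    also have "\<dots> < \<infinity>" using finite_measure.emeasure_finite[OF finq] by (simp add: less_top)
    finally show ?thesis .
  qed
  ultimately have A: "(\<integral>\<^sup>+t\<in>{1..}. ennreal (?e t) \<partial>fst \<mu>) < \<infinity>"
    unfolding signed_integral_def by (rule enn2ereal_diff_less_topD)
  \<comment> \<open>On the interval up to \<open>n\<close> the weight is at least its value at
    \<open>n\<close>.\<close>
  have "ennreal (?e (real n)) * emeasure (fst \<mu>) {1..real n} =
      (\<integral>\<^sup>+t\<in>{1..real n}. ennreal (?e (real n)) \<partial>fst \<mu>)"
    by (rule nn_integral_cmult_indicator[symmetric]) (rule p.sets_mI; auto)
  also have "\<dots> \<le> (\<integral>\<^sup>+t\<in>{1..}. ennreal (?e t) \<partial>fst \<mu>)"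
    by (intro nn_integral_mono) (auto simp: indicator_def intro!: ennreal_leI mult_left_mono)
  also note A
  finally show "emeasure (fst \<mu>) {1..real n} < \<infinity>"
    by (auto simp: ennreal_mult_less_top ennreal_eq_0_iff)
  let ?g = "\<lambda>t. t powr (- real CARD('d) / 2) * exp (- pi\<^sup>2 * (norm w0)\<^sup>2 / t)"
  have dm: "dual_mass m {0<..<1} w0 = ennreal (pi powr (real CARD('d) / 2)) * (\<integral>\<^sup>+t\<in>{0<..<1}. ennreal (?g t) \<partial>m)"
    if "measure_on_pos m" for m
  proof -
    interpret measure_on_pos m by fact
    have "dual_heat w0 t = pi powr (real CARD('d) / 2) * ?g t" for t
      unfolding dual_heat_def minus_divide_left[symmetric] powr_minus_divide by simp
    then have "dual_mass m {0<..<1} w0 = (\<integral>\<^sup>+t. ennreal (pi powr (real CARD('d) / 2)) * (ennreal (?g t) * indicator {0<..<1} t) \<partial>m)"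
      unfolding dual_mass_def by (simp add: ennreal_mult' mult.assoc)
    also have "\<dots> = ennreal (pi powr (real CARD('d) / 2)) * (\<integral>\<^sup>+t\<in>{0<..<1}. ennreal (?g t) \<partial>m)"
      by (intro nn_integral_cmult measurable_m) measurable
    finally show ?thesis .
  qed
  have "(\<integral>\<^sup>+t\<in>{0<..<1}. ennreal (?g t) \<partial>snd \<mu>) < \<infinity>"
    using q.dual_mass_finite[OF finq nz, of "{0<..<1}"] unfolding dm[OF q]
    by (auto simp: ennreal_mult_less_top ennreal_eq_0_iff)
  moreover have "signed_integral \<mu> {0<..<1} ?g < \<infinity>"
    using f w0 by (simp add: weak_G_type_def)
  ultimately have "(\<integral>\<^sup>+t\<in>{0<..<1}. ennreal (?g t) \<partial>fst \<mu>) < \<infinity>"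
    unfolding signed_integral_def by (rule enn2ereal_diff_less_topD[rotated])
  then have "dual_mass (fst \<mu>) {0<..<1} w0 < \<infinity>"
    unfolding dm[OF p] by (simp add: ennreal_mult_less_top)
  then show "\<exists>w0 \<in> dual - {0}. (\<forall>w \<in> dual - {0}. norm w0 \<le> norm w) \<and> dual_mass (fst \<mu>) {0<..<1} w0 < \<infinity>"
    using w0 by blast
qed

lemma lattice_mass_mono: "B \<subseteq> C \<Longrightarrow> lattice_mass m B x \<le> lattice_mass m C x"
  unfolding lattice_mass_def by (intro nn_integral_mono) (auto simp: indicator_def)

lemma dual_mass_mono: "B \<subseteq> C \<Longrightarrow> dual_mass m B w \<le> dual_mass m C w"
  unfolding dual_mass_def by (intro nn_integral_mono) (auto simp: indicator_def)

lemma lattice_mass_LIMSEQ: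
  assumes "measure_on_pos m"
  shows "(\<lambda>n. lattice_mass m {1..real n} x) \<longlonglongrightarrow> lattice_mass m {1..} x"
proof -
  interpret measure_on_pos m by fact
  have "lattice_mass m {1..} x = (\<integral>\<^sup>+v. (SUP n. \<integral>\<^sup>+t\<in>{1..real n}. ennreal (exp (- (norm (x + v))\<^sup>2 * t)) \<partial>m) \<partial>count_space \<Lambda>)"
    unfolding lattice_mass_def by (intro nn_integral_cong set_nn_integral_SUP[symmetric]) measurable
  also have "\<dots> = (SUP n. lattice_mass m {1..real n} x)"
    unfolding lattice_mass_def
    by (rule nn_integral_monotone_convergence_SUP)
      (auto simp: incseq_def le_fun_def indicator_def intro!: nn_integral_mono)
  finally have "lattice_mass m {1..} x = (SUP n. lattice_mass m {1..real n} x)" .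
  moreover have "incseq (\<lambda>n. lattice_mass m {1..real n} x)"
    by (auto simp: incseq_def intro!: lattice_mass_mono)
  ultimately show ?thesis using LIMSEQ_SUP by metis
qed

text \<open>Setting the coefficient at 0 to zero turns the sum over nonzero dual vectors into an
  integral over the whole dual lattice. The lattice sum splits into two sums because the one of the
  finite negative part converges.\<close>

lemma periodic_kernel_eq:
  assumes f: "weak_G_type V f \<mu>"
  defines "c w \<equiv> (if w = 0 then 0 else enn2real (dual_mass (fst \<mu>) {0<..<1} w)) -
    (if w = 0 then 0 else enn2real (dual_mass (snd \<mu>) {0<..<1} w))"
  shows "periodic_kernel V \<mu> x y = enn2ereal (lattice_mass (fst \<mu>) {1..} (x - y)) -
    enn2ereal (lattice_mass (snd \<mu>) {1..} (x - y)) +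
    ereal (\<integral>w. c w * cos (2 * pi * (w \<bullet> (x - y))) \<partial>count_space dual)"
    and "integrable (count_space dual) c"
proof -
  note masses = weak_G_type_masses[OF f]
  interpret p: measure_on_pos "fst \<mu>" by (rule masses(1))
  interpret q: measure_on_pos "snd \<mu>" by (rule masses(2))
  obtain w0 where w0: "w0 \<in> dual - {0}" "\<forall>w \<in> dual - {0}. norm w0 \<le> norm w"
    and pf: "dual_mass (fst \<mu>) {0<..<1} w0 < \<infinity>"
    using masses(5) by blast
  have qf: "dual_mass (snd \<mu>) {0<..<1} w < \<infinity>" if "w \<in> dual - {0}" for w
    using that by (intro q.dual_mass_finite masses(3)) auto
  note fin_p = dual_mass_unit_interval(1)[OF masses(1) w0 pf]
  show c: "integrable (count_space dual) c"
    unfolding c_def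
    using dual_mass_unit_interval(2)[OF masses(1) w0 pf] dual_mass_unit_interval(2)[OF masses(2) w0 qf[OF w0(1)]]
    by (rule Bochner_Integration.integrable_diff)
  let ?e = "\<lambda>w. exp (2 * complex_of_real pi * \<i> * complex_of_real (w \<bullet> (x - y)))"
  let ?g = "\<lambda>w. ?e w * complex_of_real (c w)"
  have e: "?e w = cis (2 * pi * (w \<bullet> (x - y)))" for w
    by (simp add: cis_conv_exp mult_ac)
  have g: "integrable (count_space dual) ?g"
    using c unfolding e by (rule Bochner_Integration.integrable_bound) (simp_all add: norm_mult)
  have "real_of_ereal (signed_integral \<mu> {0<..<1} (dual_heat w)) = c w" if "w \<in> dual - {0}" for w
    using fin_p[OF that] qf[OF that] that
    unfolding signed_integral_def dual_mass_def[symmetric] c_def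
    by (cases "dual_mass (fst \<mu>) {0<..<1} w"; cases "dual_mass (snd \<mu>) {0<..<1} w") (auto simp: enn2ereal_ennreal)
  then have "(\<Sum>\<^sub>\<infinity>w\<in>dual - {0}. ?e w * complex_of_real (real_of_ereal (signed_integral \<mu> {0<..<1} (dual_heat w)))) =
      (\<Sum>\<^sub>\<infinity>w\<in>dual - {0}. ?g w)"
    by (intro infsum_cong) simp
  also have "\<dots> = (\<Sum>\<^sub>\<infinity>w\<in>dual. ?g w)"
    by (rule infsum_cong_neutral) (auto simp: c_def)
  also have "\<dots> = (\<integral>w. ?g w \<partial>count_space dual)"
    using infsetsum_infsum[of ?g dual] g by (simp add: abs_summable_on_def infsetsum_def)
  finally have "Re (\<Sum>\<^sub>\<infinity>w\<in>dual - {0}. ?e w * complex_of_real (real_of_ereal (signed_integral \<mu> {0<..<1} (dual_heat w)))) =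
      (\<integral>w. Re (?g w) \<partial>count_space dual)"
    by (simp only: integral_Re[OF g])
  also have "\<dots> = (\<integral>w. c w * cos (2 * pi * (w \<bullet> (x - y))) \<partial>count_space dual)"
    unfolding e by (simp add: mult.commute)
  finally have fourier: "Re (\<Sum>\<^sub>\<infinity>w\<in>dual - {0}. ?e w * complex_of_real (real_of_ereal (signed_integral \<mu> {0<..<1} (dual_heat w)))) =
      (\<integral>w. c w * cos (2 * pi * (w \<bullet> (x - y))) \<partial>count_space dual)" .
  have "lattice_mass (snd \<mu>) {1..} (x - y) < \<infinity>"
    using finite_measure.emeasure_finite[OF masses(3)] by (intro lattice_mass_finite masses(2)) (auto simp: less_top)
  then have "(\<Sum>\<^sub>\<infinity>v\<in>\<Lambda>. signed_integral \<mu> {1..} (\<lambda>t. exp (- (norm (x - y + v))\<^sup>2 * t))) =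
      enn2ereal (lattice_mass (fst \<mu>) {1..} (x - y)) - enn2ereal (lattice_mass (snd \<mu>) {1..} (x - y))"
    unfolding signed_integral_def lattice_mass_def by (rule infsum_ereal_diff[OF countable_lattice])
  then show "periodic_kernel V \<mu> x y = enn2ereal (lattice_mass (fst \<mu>) {1..} (x - y)) -
    enn2ereal (lattice_mass (snd \<mu>) {1..} (x - y)) +
    ereal (\<integral>w. c w * cos (2 * pi * (w \<bullet> (x - y))) \<partial>count_space dual)"
    unfolding periodic_kernel_def fourier by simp
qed

text \<open>The part of the kernel with \<open>t < 1\<close> is already a cosine series; Poisson
  summation turns the rest into one after the positive part is cut at \<open>n\<close>. Nothing is
  claimed about the sign at \<open>w = 0\<close>.\<close>

theorem kernel_approximation:
  assumes f: "weak_G_type V f \<mu>"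
    and pos: "\<forall>w \<in> dual - {0}. signed_integral \<mu> {0<..} (dual_heat w) > 0"
  obtains a :: "nat \<Rightarrow> real^'d \<Rightarrow> real" where
    "\<And>n. integrable (count_space dual) (a n)"
    "\<And>w. w \<in> dual \<Longrightarrow> incseq (\<lambda>n. a n w)"
    "\<And>w. w \<in> dual \<Longrightarrow> w \<noteq> 0 \<Longrightarrow> \<exists>n. a n w > 0"
    "\<And>z. incseq (\<lambda>n. \<integral>w. a n w * cos (2 * pi * (w \<bullet> z)) \<partial>count_space dual)"
    "\<And>x y. (\<lambda>n. ereal (\<integral>w. a n w * cos (2 * pi * (w \<bullet> (x - y))) \<partial>count_space dual)) \<longlonglongrightarrow> periodic_kernel V \<mu> x y"
proof -
  note masses = weak_G_type_masses[OF f]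
  interpret p: measure_on_pos "fst \<mu>" by (rule masses(1))
  interpret q: measure_on_pos "snd \<mu>" by (rule masses(2))
  define c where "c w = (if w = 0 then 0 else enn2real (dual_mass (fst \<mu>) {0<..<1} w)) -
    (if w = 0 then 0 else enn2real (dual_mass (snd \<mu>) {0<..<1} w))" for w :: "real^'d"
  note kernel = periodic_kernel_eq[OF f, folded c_def]
  have int_c: "integrable (count_space dual) c" unfolding c_def[abs_def] by (rule periodic_kernel_eq(2)[OF f])
  have B: "{1..real n} \<in> sets borel" "{1..real n} \<subseteq> {1..}" for n by auto
  have B': "{1..} \<in> sets (borel :: real measure)" "{1..} \<subseteq> {1 :: real..}" by auto
  have finq: "emeasure (snd \<mu>) {1..} < \<infinity>"
    using finite_measure.emeasure_finite[OF masses(3)] by (simp add: less_top)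
  note P = lattice_mass_fourier[OF masses(1) B masses(4)]
  note Q = lattice_mass_fourier[OF masses(2) B' finq]
  have finP: "lattice_mass (fst \<mu>) {1..real n} z < \<infinity>" for n z
    by (rule lattice_mass_finite[OF masses(1) B masses(4)])
  have finQ: "lattice_mass (snd \<mu>) {1..} z < \<infinity>" for z
    by (rule lattice_mass_finite[OF masses(2) B' finq])
  \<comment> \<open>Only the positive part depends on \<open>n\<close>; the negative part on
    \<open>{1..}\<close> is subtracted in full, which makes \<open>a n w\<close> increase with
    \<open>n\<close>.\<close>
  define a where "a n w = enn2real (dual_mass (fst \<mu>) {1..real n} w) - enn2real (dual_mass (snd \<mu>) {1..} w) + c w" for n :: nat and w :: "real^'d"
  define C where "C z = (\<integral>w. c w * cos (2 * pi * (w \<bullet> z)) \<partial>count_space dual)" for z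
  have times_cos: "integrable (count_space dual) (\<lambda>w. g w * cos (2 * pi * (w \<bullet> z)))"
    if "integrable (count_space dual) g" for g :: "real^'d \<Rightarrow> real" and z
    using integrable_norm[OF that] by (rule integrable_count_space_bound) (simp add: abs_mult mult_left_le)
  have sum_a: "(\<integral>w. a n w * cos (2 * pi * (w \<bullet> z)) \<partial>count_space dual) =
      enn2real (lattice_mass (fst \<mu>) {1..real n} z) - enn2real (lattice_mass (snd \<mu>) {1..} z) + C z" for n z
    unfolding a_def P(3) Q(3) C_def
    using times_cos[OF P(2), of n z] times_cos[OF Q(2), of z] times_cos[OF int_c, of z]
    by (simp add: distrib_right left_diff_distrib)
  show thesis
  proof (rule that[of a])
    show "integrable (count_space dual) (a n)" for n
      unfolding a_def[abs_def] using P(2)[of n] Q(2) int_c by simp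
    show "incseq (\<lambda>n. a n w)" if "w \<in> dual" for w
      unfolding a_def using P(1)[OF that]
      by (auto simp: incseq_def intro!: enn2real_mono dual_mass_mono)
    show "incseq (\<lambda>n. \<integral>w. a n w * cos (2 * pi * (w \<bullet> z)) \<partial>count_space dual)" for z
      unfolding sum_a using finP by (auto simp: incseq_def intro!: enn2real_mono lattice_mass_mono)
    show "\<exists>n. a n w > 0" if w: "w \<in> dual" "w \<noteq> 0" for w
    proof -
      have split: "dual_mass m {0<..} w = dual_mass m {0<..<1} w + dual_mass m {1..} w" if "measure_on_pos m" for m
      proof -
        interpret measure_on_pos m by fact
        have "dual_mass m {0<..} w = (\<integral>\<^sup>+t. ennreal (dual_heat w t) * indicator {0<..<1} t + ennreal (dual_heat w t) * indicator {1..} t \<partial>m)"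
          unfolding dual_mass_def by (intro nn_integral_cong) (auto simp: indicator_def)
        also have "\<dots> = dual_mass m {0<..<1} w + dual_mass m {1..} w"
          unfolding dual_mass_def by (intro nn_integral_add measurable_m) measurable
        finally show ?thesis .
      qed
      obtain w0 where w0: "w0 \<in> dual - {0}" "\<forall>w \<in> dual - {0}. norm w0 \<le> norm w"
        and pf: "dual_mass (fst \<mu>) {0<..<1} w0 < \<infinity>"
        using masses(5) by blast
      have p0: "dual_mass (fst \<mu>) {0<..<1} w < \<infinity>"
        using dual_mass_unit_interval(1)[OF masses(1) w0 pf] w by simp
      have q0: "dual_mass (snd \<mu>) B w < \<infinity>" for B
        by (rule q.dual_mass_finite[OF masses(3) w(2)])
      have "0 < enn2ereal (dual_mass (fst \<mu>) {0<..} w) - enn2ereal (dual_mass (snd \<mu>) {0<..} w)"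
        using pos w unfolding signed_integral_def dual_mass_def by simp
      then have "dual_mass (snd \<mu>) {0<..} w < dual_mass (fst \<mu>) {0<..} w"
        using q0[of "{0<..}"] by (cases "dual_mass (snd \<mu>) {0<..} w"; cases "dual_mass (fst \<mu>) {0<..} w")
          (auto simp: enn2ereal_ennreal ennreal_less_iff)
      \<comment> \<open>The positive mass is a supremum over the cut-off, so the strict inequality
        already holds at some finite \<open>n\<close>. This also covers an infinite positive
        mass.\<close>
      also have "dual_mass (fst \<mu>) {0<..} w = dual_mass (fst \<mu>) {0<..<1} w + (SUP n. dual_mass (fst \<mu>) {1..real n} w)"
        unfolding split[OF masses(1)] by (subst p.set_nn_integral_SUP[symmetric, folded dual_mass_def, of "\<lambda>t. ennreal (dual_heat w t)", folded dual_mass_def]) (simp_all add: dual_mass_def)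
      also have "\<dots> = (SUP n. dual_mass (fst \<mu>) {0<..<1} w + dual_mass (fst \<mu>) {1..real n} w)"
        by (simp add: ennreal_SUP_add_right)
      finally obtain n where n: "dual_mass (snd \<mu>) {0<..} w < dual_mass (fst \<mu>) {0<..<1} w + dual_mass (fst \<mu>) {1..real n} w"
        by (auto simp: less_SUP_iff)
      have "enn2real (dual_mass (snd \<mu>) {0<..<1} w) + enn2real (dual_mass (snd \<mu>) {1..} w) <
          enn2real (dual_mass (fst \<mu>) {0<..<1} w) + enn2real (dual_mass (fst \<mu>) {1..real n} w)"
        using n p0 P(1)[OF w(1), of n] q0[of "{0<..<1}"] q0[of "{1..}"] unfolding split[OF masses(2)]
        by (cases "dual_mass (fst \<mu>) {0<..<1} w"; cases "dual_mass (fst \<mu>) {1..real n} w";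
            cases "dual_mass (snd \<mu>) {0<..<1} w"; cases "dual_mass (snd \<mu>) {1..} w")
          (auto simp: ennreal_less_iff simp flip: ennreal_plus)
      then have "a n w > 0" using w by (simp add: a_def c_def)
      then show ?thesis ..
    qed
    show "(\<lambda>n. ereal (\<integral>w. a n w * cos (2 * pi * (w \<bullet> (x - y))) \<partial>count_space dual)) \<longlonglongrightarrow> periodic_kernel V \<mu> x y" for x y
    proof -
      define z where "z = x - y"
      have real: "ereal (enn2real b) = enn2ereal b" if "b < \<infinity>" for b
        using that by (cases b) (auto simp: enn2ereal_ennreal)
      \<comment> \<open>The positive mass may tend to \<open>\<infinity>\<close>; all other terms
        are collected in one real summand, so that the sum of the limits is well defined.\<close>
      have "(\<lambda>n. enn2ereal (lattice_mass (fst \<mu>) {1..real n} z) + ereal (C z - enn2real (lattice_mass (snd \<mu>) {1..} z)))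
          \<longlonglongrightarrow> enn2ereal (lattice_mass (fst \<mu>) {1..} z) + ereal (C z - enn2real (lattice_mass (snd \<mu>) {1..} z))"
        by (intro tendsto_add_ereal_nonneg tendsto_enn2erealI lattice_mass_LIMSEQ masses(1) tendsto_const) auto
      moreover have "enn2ereal (lattice_mass (fst \<mu>) {1..real n} z) + ereal (C z - enn2real (lattice_mass (snd \<mu>) {1..} z)) =
          ereal (\<integral>w. a n w * cos (2 * pi * (w \<bullet> z)) \<partial>count_space dual)" for n
        unfolding sum_a real[OF finP[of n z], symmetric] by simp
      moreover have "enn2ereal (lattice_mass (fst \<mu>) {1..} z) + ereal (C z - enn2real (lattice_mass (snd \<mu>) {1..} z)) =
          periodic_kernel V \<mu> x y"
        unfolding periodic_kernel_eq(1)[OF f] C_def c_def z_def[symmetric] real[OF finQ[of z], symmetric]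
        by (cases "enn2ereal (lattice_mass (fst \<mu>) {1..} z)") auto
      ultimately show ?thesis by (simp add: z_def)
    qed
  qed
qed

end

subsection \<open>A space-filling curve\<close>

text \<open>Schoenberg's construction: the coordinates of the curve read off the ternary digits of the
  parameter, which carry the interleaved binary digits of the target point.\<close>

definition schoenberg_fun :: "real \<Rightarrow> real" where
  "schoenberg_fun t = max 0 (min 1 (1 / 2 - cos (pi * t)))"

lemma continuous_on_schoenberg_fun [continuous_intros]:
  fixes f :: "'a::metric_space \<Rightarrow> real"
  shows "continuous_on S f \<Longrightarrow> continuous_on S (\<lambda>x. schoenberg_fun (f x))"
  unfolding schoenberg_fun_def by (intro continuous_intros)

lemma schoenberg_fun_range: "0 \<le> schoenberg_fun t" "schoenberg_fun t \<le> 1"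
  by (auto simp: schoenberg_fun_def)

text \<open>As \<open>cos (pi / 3) = 1 / 2\<close>, the clipped cosine has period 2, is 0 on
  \<open>[0,1/3]\<close> and 1 on \<open>[2/3,1]\<close>. It thus reads the leading digit of a
  ternary expansion with digits 0 and 2.\<close>

lemma schoenberg_fun_digit:
  fixes b :: nat and M :: int
  assumes "b \<le> 1" "0 \<le> r" "r \<le> 1"
  shows "schoenberg_fun (2 * of_int M + (2 * real b + r) / 3) = real b"
proof -
  define y where "y = (2 * real b + r) / 3"
  have "cos (pi * (2 * of_int M + y)) = cos (2 * pi * of_int M + pi * y)" by (simp add: algebra_simps)
  also have "\<dots> = cos (pi * y)" by (simp add: cos_add cos_integer_2pi sin_integer_2pi)
  finally have *: "cos (pi * (2 * of_int M + y)) = cos (pi * y)" .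
  consider "b = 0" | "b = 1" using assms by linarith
  then show ?thesis
  proof cases
    case 1
    then have "0 \<le> pi * y" "pi * y \<le> pi / 3" using assms by (auto simp: y_def)
    then have "cos (pi / 3) \<le> cos (pi * y)" by (intro cos_monotone_0_pi_le) auto
    then have "cos (pi * y) \<ge> 1 / 2" by (simp add: cos_60)
    then show ?thesis unfolding y_def[symmetric] schoenberg_fun_def * using 1 by simp
  next
    case 2
    then have y: "2 / 3 \<le> y" "y \<le> 1" using assms by (auto simp: y_def)
    then have "pi - pi * y \<le> pi - pi * (2 / 3)" by (intro diff_left_mono mult_left_mono) auto
    moreover have "0 \<le> pi - pi * y" using y by (simp add: mult_left_le)
    ultimately have "cos (pi / 3) \<le> cos (pi - pi * y)" by (intro cos_monotone_0_pi_le) auto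
    then have "cos (pi * y) \<le> - 1 / 2" by (simp add: cos_60 cos_pi_minus)
    then show ?thesis unfolding y_def[symmetric] schoenberg_fun_def * using 2 by simp
  qed
qed

text \<open>The parameter is the point of the Cantor set with ternary digits \<open>2 * b n\<close>.
  Multiplication by \<open>3 ^ k\<close> splits off an even integer, which is a period of
  \<open>schoenberg_fun\<close>, and leaves the tail \<open>T k\<close>.\<close>

lemma ternary_digits:
  fixes b :: "nat \<Rightarrow> nat"
  assumes b: "\<And>n. b n \<le> 1"
  shows "\<exists>t\<in>{0..1}. \<forall>k. schoenberg_fun (3 ^ k * t) = real (b k)"
proof -
  define T where "T k = (\<Sum>n. 2 * real (b (n + k)) * (1 / 3) ^ Suc n)" for k
  have geo: "(\<lambda>n. 2 * (1 / 3 :: real) ^ Suc n) sums 1"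
    using sums_mult[OF geometric_sums[of "1 / 3 :: real"], of "2 / 3"] by simp
  have le: "2 * real (b (n + k)) * (1 / 3) ^ Suc n \<le> 2 * (1 / 3) ^ Suc n" for n k
    using b[of "n + k"] by (intro mult_right_mono) auto
  have summ: "summable (\<lambda>n. 2 * real (b (n + k)) * (1 / 3) ^ Suc n)" for k
    by (rule summable_comparison_test'[OF sums_summable[OF geo], of 0]) (use le in auto)
  have T: "0 \<le> T k" "T k \<le> 1" for k
  proof -
    show "0 \<le> T k" unfolding T_def by (intro suminf_nonneg summ) auto
    have "T k \<le> (\<Sum>n. 2 * (1 / 3 :: real) ^ Suc n)"
      unfolding T_def by (intro suminf_le summ sums_summable[OF geo] le)
    then show "T k \<le> 1" using sums_unique[OF geo] by simp
  qed
  have rec: "T k = (2 * real (b k) + T (Suc k)) / 3" for k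
  proof -
    have "T k = 2 * real (b k) / 3 + (\<Sum>n. 2 * real (b (Suc n + k)) * (1 / 3) ^ Suc (Suc n))"
      using suminf_split_head[OF summ[of k]] by (simp add: T_def)
    also have "(\<Sum>n. 2 * real (b (Suc n + k)) * (1 / 3) ^ Suc (Suc n)) =
        (\<Sum>n. (1 / 3) * (2 * real (b (n + Suc k)) * (1 / 3) ^ Suc n))"
      by (intro suminf_cong) simp
    also have "\<dots> = (1 / 3) * T (Suc k)" unfolding T_def by (rule suminf_mult[OF summ])
    finally show ?thesis by simp
  qed
  have M: "\<exists>M::int. 3 ^ k * T 0 = 2 * of_int M + T k" for k
  proof (induction k)
    case 0
    show ?case by (intro exI[of _ 0]) simp
  next
    case (Suc k)
    then obtain M :: int where M: "3 ^ k * T 0 = 2 * of_int M + T k" ..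
    have "3 ^ Suc k * T 0 = 3 * (2 * of_int M + T k)" using M by simp
    also have "\<dots> = 2 * of_int (3 * M + int (b k)) + T (Suc k)" by (simp add: rec[of k])
    finally show ?case ..
  qed
  have "schoenberg_fun (3 ^ k * T 0) = real (b k)" for k
  proof -
    obtain M :: int where "3 ^ k * T 0 = 2 * of_int M + T k"
      using M by blast
    then have "3 ^ k * T 0 = 2 * of_int M + (2 * real (b k) + T (Suc k)) / 3" using rec[of k] by simp
    then show ?thesis by (simp only: schoenberg_fun_digit[OF b T])
  qed
  then show ?thesis using T[of 0] by (intro bexI[of _ "T 0"] allI) auto
qed

lemma binary_digits:
  fixes x :: real
  assumes "0 \<le> x" "x < 1"
  shows "\<exists>b :: nat \<Rightarrow> nat. (\<forall>n. b n \<le> 1) \<and> (\<lambda>n. real (b n) * (1 / 2) ^ Suc n) sums x"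
proof -
  \<comment> \<open>The \<open>n\<close>-th binary digit as a difference of floors; the weighted
    digits telescope to \<open>\<lfloor>2 ^ N * x\<rfloor> / 2 ^ N\<close>.\<close>
  define c where "c n = \<lfloor>2 ^ Suc n * x\<rfloor> - 2 * \<lfloor>2 ^ n * x\<rfloor>" for n
  have c: "0 \<le> c n \<and> c n \<le> 1" for n
  proof -
    have "2 ^ Suc n * x = 2 * (2 ^ n * x)" by simp
    then show ?thesis unfolding c_def by linarith
  qed
  have part: "(\<Sum>n<N. real_of_int (c n) * (1 / 2) ^ Suc n) = of_int \<lfloor>2 ^ N * x\<rfloor> * (1 / 2) ^ N" for N
  proof (induction N)
    case 0
    then show ?case using assms by (simp add: floor_eq_iff)
  next
    case (Suc N)
    then show ?case by (simp add: c_def algebra_simps)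
  qed
  have "(\<lambda>N. of_int \<lfloor>2 ^ N * x\<rfloor> * (1 / 2) ^ N) \<longlonglongrightarrow> x"
  proof (rule real_tendsto_sandwich)
    have *: "(\<lambda>N. (1 / 2 :: real) ^ N) \<longlonglongrightarrow> 0" by (rule LIMSEQ_realpow_zero) auto
    show "(\<lambda>N. x - (1 / 2 :: real) ^ N) \<longlonglongrightarrow> x" using tendsto_diff[OF tendsto_const[of x] *] by simp
    have hx: "2 ^ N * x * (1 / 2) ^ N = x" for N by (simp add: power_divide)
    have 1: "(2 ^ N * x - 1) * (1 / 2) ^ N \<le> of_int \<lfloor>2 ^ N * x\<rfloor> * (1 / 2) ^ N" for N
      by (rule mult_right_mono) (linarith, simp)
    have 2: "of_int \<lfloor>2 ^ N * x\<rfloor> * (1 / 2) ^ N \<le> 2 ^ N * x * (1 / 2) ^ N" for N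
      by (rule mult_right_mono) simp_all
    show "\<forall>\<^sub>F N in sequentially. x - (1 / 2) ^ N \<le> of_int \<lfloor>2 ^ N * x\<rfloor> * (1 / 2) ^ N"
      "\<forall>\<^sub>F N in sequentially. of_int \<lfloor>2 ^ N * x\<rfloor> * (1 / 2) ^ N \<le> x"
      using 1 2 unfolding left_diff_distrib hx by simp_all
  qed (rule tendsto_const)
  then have "(\<lambda>n. real_of_int (c n) * (1 / 2) ^ Suc n) sums x"
    unfolding sums_def part .
  moreover have "real_of_int (c n) = real (nat (c n))" for n using c[of n] by simp
  moreover have "nat (c n) \<le> 1" for n using c[of n] by linarith
  ultimately show ?thesis by (intro exI[of _ "\<lambda>n. nat (c n)"]) simp
qed

text \<open>Used to lift measures on the cell to measures on \<open>[0,1]\<close>: what matters is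
  continuity and that every point of the half-open cube is reached.\<close>

lemma space_filling_curve:
  "\<exists>\<phi> :: real \<Rightarrow> real^'d. continuous_on UNIV \<phi> \<and>
    (\<forall>a. (\<forall>j. 0 \<le> a $ j \<and> a $ j < 1) \<longrightarrow> (\<exists>t\<in>{0..1}. \<phi> t = a))"
proof -
  \<comment> \<open>Interleaving: binary digit \<open>k\<close> of coordinate \<open>j\<close> is
    stored at ternary place \<open>e j k\<close>.\<close>
  define e where "e j k = (to_nat (j, k) :: nat)" for j :: 'd and k :: nat
  define \<phi> :: "real \<Rightarrow> real^'d" where
    "\<phi> t = (\<chi> j. \<integral>k. schoenberg_fun (3 ^ e j k * t) * (1 / 2) ^ Suc k \<partial>count_space UNIV)" for t
  have geo: "integrable (count_space UNIV) (\<lambda>k. (1 / 2 :: real) ^ Suc k)"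
    unfolding integrable_count_space_nat_iff by (simp add: summable_geometric)
  have le: "\<bar>schoenberg_fun s * (1 / 2) ^ Suc k\<bar> \<le> (1 / 2) ^ Suc k" for s and k :: nat
    using schoenberg_fun_range[of s] by (simp add: abs_mult)
  have "continuous_on UNIV \<phi>"
    unfolding \<phi>_def[abs_def]
    by (intro continuous_on_vec_lambda continuous_on_integral_count_space[OF _ geo] le continuous_intros)
  moreover have "\<exists>t\<in>{0..1}. \<phi> t = a" if a: "\<forall>j. 0 \<le> a $ j \<and> a $ j < 1" for a
  proof -
    have "\<forall>j. \<exists>b :: nat \<Rightarrow> nat. (\<forall>n. b n \<le> 1) \<and> (\<lambda>n. real (b n) * (1 / 2) ^ Suc n) sums (a $ j)"
      using a binary_digits by blast
    then obtain b where b: "\<And>j n. b j n \<le> (1 :: nat)" "\<And>j. (\<lambda>n. real (b j n) * (1 / 2) ^ Suc n) sums (a $ j)"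
      unfolding choice_iff by blast
    have "(case from_nat k of (j, n) \<Rightarrow> b j n) \<le> 1" for k
      using b(1) by (simp split: prod.split)
    from ternary_digits[of "\<lambda>k. case from_nat k of (j, n) \<Rightarrow> b j n", OF this]
    obtain t where t: "t \<in> {0..1}" "\<And>k. schoenberg_fun (3 ^ k * t) = real (case from_nat k of (j, n) \<Rightarrow> b j n)"
      by blast
    have "schoenberg_fun (3 ^ e j k * t) = real (b j k)" for j k
      unfolding t(2) by (simp add: e_def)
    moreover have "(\<integral>k. schoenberg_fun (3 ^ e j k * t) * (1 / 2) ^ Suc k \<partial>count_space UNIV) =
        (\<Sum>k. schoenberg_fun (3 ^ e j k * t) * (1 / 2) ^ Suc k)" for j
      by (intro integral_count_space_nat integrable_count_space_bound[OF geo] le)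
    ultimately have "\<phi> t = a"
      using sums_unique[OF b(2)] by (simp add: \<phi>_def vec_eq_iff)
    then show ?thesis using t(1) by blast
  qed
  ultimately show ?thesis by blast
qed

subsection \<open>Measures on the torus\<close>

context unimodular_lattice
begin

lemma saturation_eq: "U \<subseteq> cell \<Longrightarrow> {x. \<exists>u\<in>U. x - u \<in> \<Lambda>} = cell_rep -` U"
proof (intro equalityI subsetI)
  fix x assume U: "U \<subseteq> cell" and "x \<in> {x. \<exists>u\<in>U. x - u \<in> \<Lambda>}"
  then obtain u where u: "u \<in> U" "x - u \<in> \<Lambda>" by blast
  then have "u = cell_rep x" using U by (intro cell_rep_unique) auto
  then show "x \<in> cell_rep -` U" using u by simp
qed (auto intro: diff_cell_rep_in_lattice)

lemma openin_torus_iff: "openin (torus_topology V) U \<longleftrightarrow> U \<subseteq> cell \<and> open (cell_rep -` U)"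
  using openin_torus_topology[of V U] saturation_eq[of U] det_V by auto

lemma topspace_torus: "topspace (torus_topology V) = cell"
  unfolding topspace_def
proof (intro equalityI subsetI)
  fix x assume "x \<in> cell"
  moreover have "cell_rep -` cell = UNIV" by auto
  then have "openin (torus_topology V) cell" by (simp add: openin_torus_iff)
  ultimately show "x \<in> \<Union> (Collect (openin (torus_topology V)))" by blast
qed (auto simp: openin_torus_iff)

lemma cell_rep_vimage_Int: "periodic g \<Longrightarrow> cell_rep -` {u \<in> cell. g u \<in> B} = g -` B"
  by (auto simp: periodic_cell_rep)

lemma openin_torus_vimage:
  assumes g: "continuous_on UNIV g" "periodic g" and B: "open B"
  shows "openin (torus_topology V) {u \<in> cell. g u \<in> B}"
  unfolding openin_torus_iff cell_rep_vimage_Int[OF g(2)]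
  using g(1) B by (auto simp: continuous_on_open_vimage)

lemma continuous_map_torus:
  fixes g :: "real^'d \<Rightarrow> real"
  assumes "continuous_on UNIV g" "periodic g"
  shows "continuous_map (torus_topology V) euclideanreal g"
  unfolding continuous_map_def topspace_torus using openin_torus_vimage[OF assms] by auto

lemma periodic_comp_cell_rep: "periodic (\<lambda>x. g (cell_rep x))"
  unfolding periodic_def
proof (intro allI impI)
  fix x v assume v: "v \<in> \<Lambda>"
  have "x - cell_rep (x + v) \<in> \<Lambda>"
    using lattice_diff[OF diff_cell_rep_in_lattice[of "x + v"] v] by (simp add: algebra_simps)
  then have "cell_rep (x + v) = cell_rep x" by (intro cell_rep_unique) auto
  then show "g (cell_rep (x + v)) = g (cell_rep x)" by simp
qed

text \<open>Together with \<open>continuous_map_torus\<close>, this identifies the test functions of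
  weak convergence with the continuous periodic functions.\<close>

lemma continuous_on_comp_cell_rep:
  fixes g :: "real^'d \<Rightarrow> real"
  assumes "continuous_map (torus_topology V) euclideanreal g"
  shows "continuous_on UNIV (\<lambda>x. g (cell_rep x))"
  unfolding continuous_on_open_vimage[OF open_UNIV]
proof (intro allI impI)
  fix B :: "real set" assume "open B"
  then have "openin (torus_topology V) {x \<in> cell. g x \<in> B}"
    using assms by (simp add: continuous_map_def topspace_torus)
  moreover have "cell_rep -` {x \<in> cell. g x \<in> B} = (\<lambda>x. g (cell_rep x)) -` B" by auto
  ultimately show "open ((\<lambda>x. g (cell_rep x)) -` B \<inter> UNIV)" by (simp add: openin_torus_iff)
qed

lemma space_torus_borel [simp]: "space (torus_borel V) = cell"
  unfolding torus_borel_def by (rule space_measure_of) (auto simp: openin_torus_iff)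

lemma sets_torus_borel: "sets (torus_borel V) = sigma_sets cell {U. openin (torus_topology V) U}"
  unfolding torus_borel_def by (rule sets_measure_of) (auto simp: openin_torus_iff)

lemma openin_sets_torus_borel: "openin (torus_topology V) U \<Longrightarrow> U \<in> sets (torus_borel V)"
  by (simp add: sets_torus_borel)

text \<open>A coordinate is not continuous on the torus, since it jumps at the face where it
  vanishes. The sets where it lies strictly between 0 and some \<open>c \<le> 1\<close> are
  nevertheless open.\<close>

lemma coord_measurable_torus_borel: "(\<lambda>x. coord x $ j) \<in> borel_measurable (torus_borel V)"
proof (rule borel_measurableI_less)
  fix y :: real
  define I where "I c = {x \<in> cell. 0 < coord x $ j \<and> coord x $ j < c}" for c
  have I: "I c \<in> sets (torus_borel V)" if "c \<le> 1" for c
  proof (rule openin_sets_torus_borel)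
    have "cell_rep -` I c = (\<Union>n::int. {x. of_int n < coord x $ j} \<inter> {x. coord x $ j < of_int n + c})"
    proof (intro equalityI subsetI)
      fix x assume "x \<in> cell_rep -` I c"
      then have "0 < frac (coord x $ j)" "frac (coord x $ j) < c" by (auto simp: I_def coord_cell_rep)
      then show "x \<in> (\<Union>n::int. {x. of_int n < coord x $ j} \<inter> {x. coord x $ j < of_int n + c})"
        by (intro UN_I[of "\<lfloor>coord x $ j\<rfloor>"]) (auto simp: frac_def)
    next
      fix x assume "x \<in> (\<Union>n::int. {x. of_int n < coord x $ j} \<inter> {x. coord x $ j < of_int n + c})"
      then obtain n :: int where n: "of_int n < coord x $ j" "coord x $ j < of_int n + c" by auto
      then have "\<lfloor>coord x $ j\<rfloor> = n" using that by (intro floor_unique) auto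
      then show "x \<in> cell_rep -` I c" using n by (auto simp: I_def coord_cell_rep frac_def)
    qed
    moreover have "open {x. of_int n < coord x $ j}" "open {x. coord x $ j < of_int n + c}" for n :: int
      by (intro open_Collect_less continuous_intros)+
    ultimately show "openin (torus_topology V) (I c)"
      unfolding openin_torus_iff by (auto simp: I_def simp del: vimage_Collect_eq intro!: open_UN open_Int)
  qed
  consider "y \<le> 0" | "0 < y" "y \<le> 1" | "1 < y" by linarith
  then show "{x \<in> space (torus_borel V). coord x $ j < y} \<in> sets (torus_borel V)"
  proof cases
    case 1
    then have "\<not> coord x $ j < y" if "x \<in> cell" for x
      using that unfolding in_cell_iff by (metis not_le order_trans)
    then have "{x \<in> space (torus_borel V). coord x $ j < y} = {}" by simp
    then show ?thesis by (simp only: sets.empty_sets)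
  next
    case 2
    \<comment> \<open>The complement of \<open>I 1\<close> is the face on which the coordinate is
      0.\<close>
    then have "{x \<in> space (torus_borel V). coord x $ j < y} = (space (torus_borel V) - I 1) \<union> I y"
      by (auto simp: I_def in_cell_iff order.order_iff_strict)
    then show ?thesis by (simp only:) (intro sets.Un sets.compl_sets I; use 2 in simp)
  next
    case 3
    then have "coord x $ j < y" if "x \<in> cell" for x
      using that unfolding in_cell_iff by (metis less_trans)
    then have "{x \<in> space (torus_borel V). coord x $ j < y} = space (torus_borel V)" by auto
    then show ?thesis by (simp only: sets.top)
  qed
qed

text \<open>Every Borel function on the Euclidean space can therefore be integrated against a
  measure on the torus.\<close>

lemma id_measurable_torus_borel: "(\<lambda>x. x) \<in> torus_borel V \<rightarrow>\<^sub>M borel"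
proof -
  have "(\<lambda>x. \<Sum>j\<in>UNIV. coord x $ j *\<^sub>R column j V) \<in> torus_borel V \<rightarrow>\<^sub>M borel"
    using coord_measurable_torus_borel by (intro borel_measurable_sum borel_measurable_scaleR) auto
  moreover have "(\<Sum>j\<in>UNIV. coord x $ j *\<^sub>R column j V) = x" for x
    using V_coord[of x] by (simp add: matrix_mult_sum scalar_mult_eq_scaleR)
  ultimately show ?thesis by simp
qed

section \<open>Probability measures on the torus and periodic test functions\<close>

definition torus_prob :: "(real^'d) measure \<Rightarrow> bool" where
  "torus_prob \<nu> \<longleftrightarrow> prob_space \<nu> \<and> sets \<nu> = sets (torus_borel V)"

lemma torus_probD:
  assumes "torus_prob \<nu>"
  shows "prob_space \<nu>" "sets \<nu> = sets (torus_borel V)" "space \<nu> = cell"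
  using assms sets_eq_imp_space_eq[of \<nu> "torus_borel V"] by (auto simp: torus_prob_def)

lemma torus_prob_measurable:
  assumes "torus_prob \<nu>" "g \<in> borel_measurable borel"
  shows "g \<in> borel_measurable \<nu>"
  using measurable_compose[OF id_measurable_torus_borel assms(2)]
    measurable_cong_sets[OF torus_probD(2)[OF assms(1)] refl, of borel] by blast

lemma torus_prob_integrable:
  fixes g :: "real^'d \<Rightarrow> real"
  assumes \<nu>: "torus_prob \<nu>" and g: "g \<in> borel_measurable borel" "\<And>x. \<bar>g x\<bar> \<le> B"
  shows "integrable \<nu> g"
proof -
  interpret prob_space \<nu> by (rule torus_probD[OF \<nu>])
  show ?thesis using torus_prob_measurable[OF \<nu> g(1)] g(2) by (intro integrable_const_bound[where B=B]) auto
qed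

text \<open>Supplies continuous periodic test functions: distances to saturated sets.\<close>

lemma infdist_translate:
  assumes F: "\<And>x v. v \<in> \<Lambda> \<Longrightarrow> x \<in> F \<Longrightarrow> x + v \<in> F"
  shows "periodic (\<lambda>x. infdist x F)"
  unfolding periodic_def
proof (intro allI impI)
  fix x v assume v: "v \<in> \<Lambda>"
  have "(+) v ` F = F"
  proof (intro equalityI subsetI)
    fix y assume "y \<in> F"
    then have "y + - v \<in> F" using v by (intro F) (simp_all add: lattice_uminus_iff)
    then show "y \<in> (+) v ` F" by (intro image_eqI[of _ _ "y + - v"]) auto
  qed (use F[OF v] in \<open>auto simp: add.commute\<close>)
  then have "infdist (x + v) F = infdist (x + v) ((+) v ` F)" by simp
  also have "\<dots> = infdist x F"
    by (simp add: infdist_def image_image add.commute[of x])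
  finally show "infdist (x + v) F = infdist x F" .
qed

lemma periodic_vimage_shift: "v \<in> \<Lambda> \<Longrightarrow> x \<in> cell_rep -` U \<Longrightarrow> x + v \<in> cell_rep -` U"
  using periodicD[OF periodic_comp_cell_rep[of "\<lambda>y. y"], of v x] by simp

text \<open>The indicator of an open set is the limit of truncated multiples of the distance to its
  complement, and these are periodic because the complement is saturated. The open sets are an
  intersection-stable generator.\<close>

lemma torus_prob_eqI:
  assumes \<nu>: "torus_prob \<nu>" and \<rho>: "torus_prob \<rho>"
    and eq: "\<And>g :: real^'d \<Rightarrow> real. continuous_on UNIV g \<Longrightarrow> periodic g \<Longrightarrow> (\<integral>x. g x \<partial>\<nu>) = (\<integral>x. g x \<partial>\<rho>)"
  shows "\<nu> = \<rho>"
proof -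
  interpret \<nu>: prob_space \<nu> by (rule torus_probD[OF \<nu>])
  interpret \<rho>: prob_space \<rho> by (rule torus_probD[OF \<rho>])
  have main: "measure \<nu> U = measure \<rho> U" if U: "openin (torus_topology V) U" for U
  proof (cases "U = cell")
    \<comment> \<open>The complement is empty here, and \<open>infdist\<close> to the empty set is
      0, so the approximation below would fail.\<close>
    case True
    then show ?thesis using \<nu>.prob_space \<rho>.prob_space torus_probD(3)[OF \<nu>] torus_probD(3)[OF \<rho>] by simp
  next
    case False
    define F where "F = - (cell_rep -` U)"
    have Uc: "U \<subseteq> cell" "closed F" using U by (auto simp: openin_torus_iff F_def)
    from False Uc obtain z where "z \<in> cell" "z \<notin> U" by blast
    then have "z \<in> F" by (simp add: F_def)
    then have F0: "F \<noteq> {}" by blast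
    define g where "g n x = min 1 (real n * infdist x F)" for n :: nat and x
    have g_cont: "continuous_on UNIV (g n)" for n
      unfolding g_def[abs_def] by (intro continuous_intros)
    have g_per: "periodic (g n)" for n
    proof -
      have F_eq: "F = cell_rep -` (- U)" by (auto simp: F_def)
      have "periodic (\<lambda>x. infdist x F)" unfolding F_eq by (rule infdist_translate) (rule periodic_vimage_shift)
      then show ?thesis by (simp add: periodic_def g_def)
    qed
    have g_bd: "\<bar>g n x\<bar> \<le> 1" for n x by (auto simp: g_def infdist_nonneg)
    have g_lim: "(\<lambda>n. g n x) \<longlonglongrightarrow> indicator U x" if x: "x \<in> cell" for x
    proof (cases "x \<in> U")
      case True
      then have "x \<notin> F" using Uc by (auto simp: F_def)
      then have pos: "infdist x F > 0"
        using in_closed_iff_infdist_zero[OF Uc(2) F0] infdist_nonneg[of x F] by (simp add: order.order_iff_strict)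
      obtain N where N: "1 / infdist x F \<le> real N" using real_arch_simple by blast
      have "g n x = 1" if "n \<ge> N" for n
      proof -
        have "1 / infdist x F \<le> real n" using N that by (meson of_nat_mono order_trans)
        then show ?thesis using pos by (simp add: g_def field_simps)
      qed
      then have "(\<lambda>n. g n x) \<longlonglongrightarrow> 1"
        by (intro tendsto_eventually eventually_sequentiallyI[of N])
      then show ?thesis using True by simp
    next
      case False
      then have "x \<in> F" using x by (auto simp: F_def)
      then show ?thesis using False by (simp add: g_def)
    qed
    have lim: "(\<lambda>n. \<integral>x. g n x \<partial>\<kappa>) \<longlonglongrightarrow> measure \<kappa> U" if \<kappa>: "torus_prob \<kappa>" for \<kappa>
    proof -
      interpret \<kappa>: prob_space \<kappa> by (rule torus_probD[OF \<kappa>])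
      have Us: "U \<in> sets \<kappa>" using openin_sets_torus_borel[OF U] torus_probD(2)[OF \<kappa>] by simp
      have "(\<lambda>n. \<integral>x. g n x \<partial>\<kappa>) \<longlonglongrightarrow> (\<integral>x. indicator U x \<partial>\<kappa>)"
      proof (rule integral_dominated_convergence[where w = "\<lambda>_. 1"])
        show "g n \<in> borel_measurable \<kappa>" for n
          by (intro torus_prob_measurable[OF \<kappa>] borel_measurable_continuous_onI g_cont)
        show "AE x in \<kappa>. (\<lambda>n. g n x) \<longlonglongrightarrow> indicator U x"
          using g_lim torus_probD(3)[OF \<kappa>] by (intro AE_I2) auto
      qed (use g_bd Us in auto)
      then show ?thesis using Us by simp
    qed
    have "(\<lambda>n. \<integral>x. g n x \<partial>\<nu>) = (\<lambda>n. \<integral>x. g n x \<partial>\<rho>)"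
      using eq[OF g_cont g_per] by simp
    with lim[OF \<nu>] lim[OF \<rho>] show ?thesis using LIMSEQ_unique by metis
  qed
  show ?thesis
  proof (rule measure_eqI_generator_eq[where E = "{U. openin (torus_topology V) U}" and \<Omega> = cell and A = "\<lambda>_. cell"])
    show "Int_stable {U. openin (torus_topology V) U}" by (auto intro!: Int_stableI openin_Int)
    show "{U. openin (torus_topology V) U} \<subseteq> Pow cell" by (auto simp: openin_torus_iff)
    show "emeasure \<nu> X = emeasure \<rho> X" if "X \<in> {U. openin (torus_topology V) U}" for X
      using main[of X] that by (simp add: \<nu>.emeasure_eq_measure \<rho>.emeasure_eq_measure)
    show "sets \<nu> = sigma_sets cell {U. openin (torus_topology V) U}"
      "sets \<rho> = sigma_sets cell {U. openin (torus_topology V) U}"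
      using torus_probD(2)[OF \<nu>] torus_probD(2)[OF \<rho>] sets_torus_borel by auto
    show "range (\<lambda>_. cell) \<subseteq> {U. openin (torus_topology V) U}"
      using openin_topspace[of "torus_topology V"] by (auto simp: topspace_torus)
  qed auto
qed

lemma periodic_torus_map: "periodic torus_map"
  by (auto simp: periodic_def torus_map_eq_iff)

text \<open>Disjoint neighbourhoods are pulled back along \<open>torus_map\<close>, which is
  continuous and injective on the cell.\<close>

lemma Hausdorff_torus: "Hausdorff_space (torus_topology V)"
  unfolding Hausdorff_space_def topspace_torus
proof (intro allI impI)
  fix x y assume xy: "x \<in> cell \<and> y \<in> cell \<and> x \<noteq> y"
  have ne: "torus_map x \<noteq> torus_map y"
  proof
    assume "torus_map x = torus_map y"
    then have "x - y \<in> \<Lambda>" by (simp add: torus_map_eq_iff)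
    then show False using cell_rep_unique[of y x] xy by simp
  qed
  obtain O1 O2 where O: "open O1" "open O2" "torus_map x \<in> O1" "torus_map y \<in> O2" "O1 \<inter> O2 = {}"
    using hausdorff[OF ne] by (elim exE conjE)
  show "\<exists>U W. openin (torus_topology V) U \<and> openin (torus_topology V) W \<and> x \<in> U \<and> y \<in> W \<and> disjnt U W"
    using O xy openin_torus_vimage[OF continuous_on_torus_map periodic_torus_map O(1)]
      openin_torus_vimage[OF continuous_on_torus_map periodic_torus_map O(2)]
    by (intro exI[of _ "{u \<in> cell. torus_map u \<in> O1}"] exI[of _ "{u \<in> cell. torus_map u \<in> O2}"]) (auto simp: disjnt_def)
qed

lemma closed_saturation:
  assumes "compactin (torus_topology V) A"
  shows "closed (cell_rep -` A)" and "openin (torus_topology V) (cell - A)"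
proof -
  show *: "openin (torus_topology V) (cell - A)"
    using compactin_imp_closedin[OF Hausdorff_torus assms] by (simp add: closedin_def topspace_torus)
  have "cell_rep -` A = - (cell_rep -` (cell - A))" by auto
  then show "closed (cell_rep -` A)" using * by (simp add: openin_torus_iff closed_def)
qed

text \<open>The complement of the support is a union of open null sets. Pulled back to the Euclidean
  space, it has a countable subcover by the Lindelof property.\<close>

lemma AE_torus_support:
  assumes \<nu>: "torus_prob \<nu>" and supp: "torus_support V \<nu> \<subseteq> A"
  shows "AE x in \<nu>. x \<in> A"
proof -
  define \<U> where "\<U> = {cell_rep -` U | U. openin (torus_topology V) U \<and> emeasure \<nu> U = 0}"
  have "open S" if "S \<in> \<U>" for S using that by (auto simp: \<U>_def openin_torus_iff)
  then obtain \<U>' where \<U>': "\<U>' \<subseteq> \<U>" "countable \<U>'" "\<Union>\<U>' = \<Union>\<U>"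
    using Lindelof[of \<U>] by metis
  have null: "S \<inter> cell \<in> null_sets \<nu>" if "S \<in> \<U>'" for S
  proof -
    from that \<U>' obtain U where U: "S = cell_rep -` U" "openin (torus_topology V) U" "emeasure \<nu> U = 0"
      by (auto simp: \<U>_def)
    then have "S \<inter> cell = U" by (auto simp: openin_torus_iff)
    then show ?thesis using U openin_sets_torus_borel[OF U(2)] torus_probD(2)[OF \<nu>] by (simp add: null_sets_def)
  qed
  have "(\<Union>S\<in>\<U>'. S \<inter> cell) \<in> null_sets \<nu>"
    using \<U>'(2) null by (rule null_sets_UN')
  then show ?thesis
  proof (rule AE_I')
    show "{x \<in> space \<nu>. x \<notin> A} \<subseteq> (\<Union>S\<in>\<U>'. S \<inter> cell)"
    proof
      fix x assume x: "x \<in> {x \<in> space \<nu>. x \<notin> A}"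
      then have xc: "x \<in> cell" using torus_probD(3)[OF \<nu>] by simp
      have "x \<notin> torus_support V \<nu>" using x supp by auto
      then obtain U where U: "openin (torus_topology V) U" "x \<in> U" "emeasure \<nu> U = 0"
        using xc by (auto simp: torus_support_def)
      then have "x \<in> \<Union>\<U>" using xc by (auto simp: \<U>_def)
      then show "x \<in> (\<Union>S\<in>\<U>'. S \<inter> cell)" using xc \<U>'(3) by blast
    qed
  qed
qed

text \<open>The integral of \<open>g\<close> against the normalized counting measure, as a plain
  finite sum; for \<open>N = 0\<close> its value is 0.\<close>

definition point_average :: "nat \<Rightarrow> (nat \<Rightarrow> real^'d) \<Rightarrow> (real^'d \<Rightarrow> real) \<Rightarrow> real" where
  "point_average N x g = (\<Sum>i<N. g (x i)) / real N"

text \<open>The points are lifted to parameters of the space-filling curve. The lifted measures live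
  on \<open>[0,1]\<close>, hence are tight, and a weak limit on the line is pushed forward to the
  torus along the curve.\<close>

theorem torus_measures_compact:
  fixes N :: "nat \<Rightarrow> nat"
  assumes x: "\<And>n i. i < N n \<Longrightarrow> x n i \<in> cell" and N: "\<And>n. 1 \<le> N n"
  shows "\<exists>s \<nu>. strict_mono s \<and> torus_prob \<nu> \<and>
    (\<forall>g. continuous_on UNIV g \<longrightarrow> periodic g \<longrightarrow>
      (\<lambda>n. point_average (N (s n)) (x (s n)) g) \<longlonglongrightarrow> (\<integral>z. g z \<partial>\<nu>))"
proof -
  obtain \<phi> :: "real \<Rightarrow> real^'d" where \<phi>: "continuous_on UNIV \<phi>"
    "\<And>a. \<forall>j. 0 \<le> a $ j \<and> a $ j < 1 \<Longrightarrow> \<exists>t\<in>{0..1}. \<phi> t = a"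
    using space_filling_curve by blast
  have V\<phi>: "continuous_on UNIV (\<lambda>t. V *v \<phi> t)"
    by (rule bounded_linear.continuous_on[OF matrix_vector_mul_bounded_linear \<phi>(1)])
  \<comment> \<open>An arbitrary choice of parameters. Its regularity does not matter, since it is
    composed with maps on a finite index set, where every function is measurable.\<close>
  define \<tau> where "\<tau> z = (SOME t. t \<in> {0..1} \<and> V *v \<phi> t = z)" for z
  have \<tau>: "\<tau> z \<in> {0..1}" "V *v \<phi> (\<tau> z) = z" if z: "z \<in> cell" for z
  proof -
    obtain t where "t \<in> {0..1}" "\<phi> t = coord z" using \<phi>(2)[of "coord z"] z by (auto simp: in_cell_iff)
    then have "t \<in> {0..1} \<and> V *v \<phi> t = z" by simp
    from someI[of "\<lambda>t. t \<in> {0..1} \<and> V *v \<phi> t = z", OF this]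
    show "\<tau> z \<in> {0..1}" "V *v \<phi> (\<tau> z) = z" by (auto simp: \<tau>_def)
  qed
  define \<mu> where "\<mu> n = distr (uniform_count_measure {..<N n}) borel (\<lambda>i. \<tau> (x n i))" for n
  have meas: "h \<in> uniform_count_measure {..<N n} \<rightarrow>\<^sub>M borel" for h :: "nat \<Rightarrow> real" and n
    by (simp add: measurable_cong_sets[OF sets_uniform_count_measure_count_space refl])
  have pm: "prob_space (uniform_count_measure {..<N n})" for n
    using N[of n] by (intro prob_space_uniform_count_measure) (auto simp: lessThan_empty_iff bot_nat_def)
  have rd: "real_distribution (\<mu> n)" for n
  proof -
    interpret prob_space "\<mu> n" unfolding \<mu>_def by (rule prob_space.prob_space_distr[OF pm meas])
    show ?thesis by standard (simp add: \<mu>_def)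
  qed
  \<comment> \<open>Tightness is phrased with half-open intervals; the left end \<open>-1\<close>
    keeps the parameter 0 inside.\<close>
  have "measure (\<mu> n) {-1<..1} = 1" for n
  proof -
    have "(\<lambda>i. \<tau> (x n i)) -` {-1<..1} \<inter> {..<N n} = {..<N n}" using \<tau>(1)[OF x] by force
    then show ?thesis
      unfolding \<mu>_def using N[of n] by (subst measure_distr[OF meas]) (auto simp: space_uniform_count_measure measure_uniform_count_measure)
  qed
  then have "tight \<mu>"
    unfolding tight_def using rd by (intro conjI allI impI exI[of _ "-1"] exI[of _ 1]) auto
  from tight_imp_convergent_subsubsequence[OF this strict_mono_id]
  obtain s M where s: "strict_mono s" and M: "real_distribution M" "weak_conv_m (\<lambda>n. \<mu> (s n)) M"
    by (auto simp: comp_def)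
  interpret M: real_distribution M by fact
  \<comment> \<open>The curve may leave the half-open cell; \<open>cell_rep\<close> brings it back
    without changing periodic functions.\<close>
  define \<nu> where "\<nu> = distr M (torus_borel V) (\<lambda>t. cell_rep (V *v \<phi> t))"
  have mm: "(\<lambda>t. cell_rep (V *v \<phi> t)) \<in> M \<rightarrow>\<^sub>M torus_borel V"
    unfolding torus_borel_def
  proof (rule measurable_measure_of)
    fix U assume "U \<in> {U. openin (torus_topology V) U}"
    then have "open (cell_rep -` U)" by (simp add: openin_torus_iff)
    then have "open ((\<lambda>t. V *v \<phi> t) -` (cell_rep -` U))" using V\<phi> by (simp add: continuous_on_open_vimage)
    moreover have "(\<lambda>t. V *v \<phi> t) -` (cell_rep -` U) = (\<lambda>t. cell_rep (V *v \<phi> t)) -` U \<inter> space M" by auto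
    ultimately show "(\<lambda>t. cell_rep (V *v \<phi> t)) -` U \<inter> space M \<in> sets M" by (metis M.events_eq_borel borel_open)
  qed (auto simp: openin_torus_iff)
  have \<nu>: "torus_prob \<nu>"
    unfolding torus_prob_def \<nu>_def using M.prob_space_distr[OF mm] by simp
  have "(\<lambda>n. point_average (N (s n)) (x (s n)) g) \<longlonglongrightarrow> (\<integral>z. g z \<partial>\<nu>)"
    if g: "continuous_on UNIV g" "periodic g" for g
  proof -
    obtain B where B: "\<And>z. \<bar>g z\<bar> \<le> B" using periodic_bounded[OF g] by blast
    have gb: "g \<in> borel_measurable borel" by (rule borel_measurable_continuous_onI) fact
    have g\<phi>: "continuous_on UNIV (\<lambda>t. g (V *v \<phi> t))" using g(1) V\<phi> by (rule continuous_on_compose2) auto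
    have "(\<lambda>n. \<integral>t. g (V *v \<phi> t) \<partial>(\<mu> (s n))) \<longlonglongrightarrow> (\<integral>t. g (V *v \<phi> t) \<partial>M)"
      by (rule weak_conv_imp_integral_bdd_continuous_conv[where B=B])
        (use rd M g\<phi> B in \<open>auto simp: continuous_on_eq_continuous_at\<close>)
    moreover have "(\<integral>t. g (V *v \<phi> t) \<partial>(\<mu> (s n))) = point_average (N (s n)) (x (s n)) g" for n
    proof -
      have "(\<integral>t. g (V *v \<phi> t) \<partial>(\<mu> (s n))) = (\<integral>i. g (V *v \<phi> (\<tau> (x (s n) i))) \<partial>uniform_count_measure {..<N (s n)})"
        unfolding \<mu>_def
        by (intro integral_distr meas borel_measurable_continuous_onI g\<phi>)
      also have "\<dots> = point_average (N (s n)) (x (s n)) g"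
        using \<tau>(2)[OF x] by (simp add: integral_uniform_count_measure point_average_def)
      finally show ?thesis .
    qed
    moreover have "(\<integral>z. g z \<partial>\<nu>) = (\<integral>t. g (V *v \<phi> t) \<partial>M)"
      unfolding \<nu>_def
      by (subst integral_distr[OF mm measurable_compose[OF id_measurable_torus_borel gb]]) (simp add: periodic_cell_rep[OF g(2)])
    ultimately show ?thesis by simp
  qed
  then show ?thesis using s \<nu> by blast
qed

text \<open>The distance to the saturation of \<open>A\<close> is a continuous periodic test
  function with zero average at every stage. It therefore vanishes almost everywhere for the limit,
  and its zero set is closed.\<close>

lemma torus_support_limit:
  fixes N :: "nat \<Rightarrow> nat"
  assumes A: "compactin (torus_topology V) A" and x: "\<And>n i. i < N n \<Longrightarrow> x n i \<in> A" and N: "\<And>n. 1 \<le> N n"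
    and \<nu>: "torus_prob \<nu>"
    and lim: "\<And>g. continuous_on UNIV g \<Longrightarrow> periodic g \<Longrightarrow> (\<lambda>n. point_average (N n) (x n) g) \<longlonglongrightarrow> (\<integral>z. g z \<partial>\<nu>)"
  shows "torus_support V \<nu> \<subseteq> A"
proof
  fix z assume z: "z \<in> torus_support V \<nu>"
  define F where "F = cell_rep -` A"
  have Ac: "A \<subseteq> cell" using compactin_subset_topspace[OF A] by (simp add: topspace_torus)
  have F: "closed F" unfolding F_def by (rule closed_saturation[OF A])
  have xF: "x n i \<in> F" if "i < N n" for n i using x[OF that] Ac by (auto simp: F_def)
  have F0: "F \<noteq> {}" using xF[of 0 0] N[of 0] by auto
  define g where "g y = infdist y F" for y
  have g: "continuous_on UNIV g" "periodic g"
    unfolding g_def[abs_def] F_def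
    by (intro continuous_intros) (intro infdist_translate periodic_vimage_shift)
  have "point_average (N n) (x n) g = 0" for n using xF by (simp add: point_average_def g_def)
  then have "(\<integral>y. g y \<partial>\<nu>) = 0" using lim[OF g] by (simp add: LIMSEQ_const_iff)
  moreover obtain B where B: "\<And>y. \<bar>g y\<bar> \<le> B" using periodic_bounded[OF g] by blast
  have "integrable \<nu> g"
    by (rule torus_prob_integrable[OF \<nu> borel_measurable_continuous_onI[OF g(1)] B])
  ultimately have AE: "AE y in \<nu>. g y = 0"
    by (subst (asm) integral_nonneg_eq_0_iff_AE) (auto simp: g_def infdist_nonneg)
  show "z \<in> A"
  proof (rule ccontr)
    assume "z \<notin> A"
    moreover have "z \<in> cell" using z by (simp add: torus_support_def)
    ultimately have "emeasure \<nu> (cell - A) > 0"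
      using z closed_saturation(2)[OF A] by (auto simp: torus_support_def)
    moreover have "emeasure \<nu> (cell - A) = 0"
    proof (rule AE_iff_measurable[THEN iffD1, OF _ _ AE])
      show "cell - A \<in> sets \<nu>"
        using openin_sets_torus_borel[OF closed_saturation(2)[OF A]] torus_probD(2)[OF \<nu>] by simp
      show "{y \<in> space \<nu>. \<not> g y = 0} = cell - A"
      proof -
        have "g y = 0 \<longleftrightarrow> y \<in> A" if "y \<in> cell" for y
          using in_closed_iff_infdist_zero[OF F F0, of y] that by (simp add: g_def F_def)
        then show ?thesis using torus_probD(3)[OF \<nu>] by blast
      qed
    qed
    ultimately show False by simp
  qed
qed

end

subsection \<open>Energies and Fourier coefficients\<close>

text \<open>Monotone convergence handles the positive parts and dominated convergence the negative
  ones, with the negative part of \<open>g 0\<close> as majorant. The limit thus has a finite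
  negative part, which excludes \<open>\<infinity> - \<infinity>\<close>.\<close>

lemma ereal_integral_incseq_LIMSEQ:
  fixes g :: "nat \<Rightarrow> 'a \<Rightarrow> real"
  assumes g: "\<And>n. integrable M (g n)" and mono: "\<And>x. incseq (\<lambda>n. g n x)"
    and lim: "\<And>x. (\<lambda>n. ereal (g n x)) \<longlonglongrightarrow> G x"
  shows "(\<lambda>n. ereal (\<integral>x. g n x \<partial>M)) \<longlonglongrightarrow> ereal_integral M G"
proof -
  have gm [measurable]: "g n \<in> borel_measurable M" for n using g by auto
  have [measurable]: "G \<in> borel_measurable M"
    by (rule borel_measurable_LIMSEQ_order[where u = "\<lambda>n x. ereal (g n x)"]) (use lim in auto)
  have fin: "(\<integral>\<^sup>+x. ennreal (g n x) \<partial>M) < \<infinity>" "(\<integral>\<^sup>+x. ennreal (- g n x) \<partial>M) < \<infinity>" for n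
    using g[of n] unfolding real_integrable_def by (auto simp: less_top)
  have P: "(\<lambda>n. \<integral>\<^sup>+x. ennreal (g n x) \<partial>M) \<longlonglongrightarrow> (\<integral>\<^sup>+x. e2ennreal (G x) \<partial>M)"
  proof (rule nn_integral_LIMSEQ)
    show "incseq (\<lambda>n x. ennreal (g n x))"
      using mono by (auto simp: incseq_def le_fun_def intro!: ennreal_leI)
    show "(\<lambda>n. ennreal (g n x)) \<longlonglongrightarrow> e2ennreal (G x)" for x
      using tendsto_e2ennrealI[OF lim[of x]] by simp
  qed simp
  have Q: "(\<lambda>n. \<integral>\<^sup>+x. ennreal (- g n x) \<partial>M) \<longlonglongrightarrow> (\<integral>\<^sup>+x. e2ennreal (- G x) \<partial>M)"
  proof (rule nn_integral_dominated_convergence[where w = "\<lambda>x. ennreal (- g 0 x)"])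
    show "AE x in M. ennreal (- g n x) \<le> ennreal (- g 0 x)" for n
      using mono by (auto simp: incseq_def intro!: ennreal_leI)
    show "AE x in M. (\<lambda>n. ennreal (- g n x)) \<longlonglongrightarrow> e2ennreal (- G x)"
    proof (rule AE_I2)
      fix x
      have "(\<lambda>n. - ereal (g n x)) \<longlonglongrightarrow> - G x" using lim[of x] by (rule tendsto_uminus_ereal)
      from tendsto_e2ennrealI[OF this] show "(\<lambda>n. ennreal (- g n x)) \<longlonglongrightarrow> e2ennreal (- G x)" by simp
    qed
  qed (use fin in auto)
  have "(\<integral>\<^sup>+x. e2ennreal (- G x) \<partial>M) \<le> (\<integral>\<^sup>+x. ennreal (- g 0 x) \<partial>M)"
  proof (rule LIMSEQ_le_const2[OF Q], intro exI allI impI nn_integral_mono ennreal_leI)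
    show "- g n x \<le> - g 0 x" for n x using mono[of x] by (simp add: incseq_def)
  qed
  then have "(\<integral>\<^sup>+x. e2ennreal (- G x) \<partial>M) < \<infinity>" using fin(2)[of 0] by (rule le_less_trans)
  then have "\<bar>- enn2ereal (\<integral>\<^sup>+x. e2ennreal (- G x) \<partial>M)\<bar> \<noteq> \<infinity>"
    by (cases "\<integral>\<^sup>+x. e2ennreal (- G x) \<partial>M") (auto simp: enn2ereal_ennreal)
  then have "(\<lambda>n. enn2ereal (\<integral>\<^sup>+x. ennreal (g n x) \<partial>M) + - enn2ereal (\<integral>\<^sup>+x. ennreal (- g n x) \<partial>M)) \<longlonglongrightarrow>
      enn2ereal (\<integral>\<^sup>+x. e2ennreal (G x) \<partial>M) + - enn2ereal (\<integral>\<^sup>+x. e2ennreal (- G x) \<partial>M)"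
    using P Q by (intro tendsto_add_ereal_general1 tendsto_uminus_ereal tendsto_enn2erealI)
  moreover have "enn2ereal (\<integral>\<^sup>+x. ennreal (g n x) \<partial>M) + - enn2ereal (\<integral>\<^sup>+x. ennreal (- g n x) \<partial>M) = ereal (\<integral>x. g n x \<partial>M)" for n
    unfolding real_lebesgue_integral_def[OF g[of n]] using fin[of n]
    by (cases "\<integral>\<^sup>+x. ennreal (g n x) \<partial>M"; cases "\<integral>\<^sup>+x. ennreal (- g n x) \<partial>M")
      (auto simp: enn2ereal_ennreal)
  ultimately show ?thesis by (simp add: ereal_integral_def minus_ereal_def)
qed

lemma abs_sum_squares_le:
  fixes x y :: real
  assumes "\<bar>x\<bar> \<le> 1" "\<bar>y\<bar> \<le> 1" shows "\<bar>x\<^sup>2 + y\<^sup>2\<bar> \<le> 2"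
  using power_mono[of "\<bar>x\<bar>" 1 2] power_mono[of "\<bar>y\<bar>" 1 2] assms by simp

context unimodular_lattice
begin

definition cos_coeff :: "(real^'d) measure \<Rightarrow> real^'d \<Rightarrow> real" where
  "cos_coeff \<rho> w = (\<integral>x. cos (2 * pi * (w \<bullet> x)) \<partial>\<rho>)"

definition sin_coeff :: "(real^'d) measure \<Rightarrow> real^'d \<Rightarrow> real" where
  "sin_coeff \<rho> w = (\<integral>x. sin (2 * pi * (w \<bullet> x)) \<partial>\<rho>)"

lemma abs_coeff_le:
  assumes "torus_prob \<rho>" shows "\<bar>cos_coeff \<rho> w\<bar> \<le> 1" "\<bar>sin_coeff \<rho> w\<bar> \<le> 1"
proof -
  interpret prob_space \<rho> by (rule torus_probD[OF assms])
  have "\<bar>\<integral>x. g x \<partial>\<rho>\<bar> \<le> 1" if g: "g \<in> borel_measurable borel" "\<And>x. \<bar>g x\<bar> \<le> 1" for g :: "real^'d \<Rightarrow> real"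
  proof -
    have i: "integrable \<rho> g" by (rule torus_prob_integrable[OF assms g])
    have "\<bar>\<integral>x. g x \<partial>\<rho>\<bar> \<le> (\<integral>x. \<bar>g x\<bar> \<partial>\<rho>)" by (rule integral_abs_bound)
    also have "\<dots> \<le> (\<integral>x. 1 \<partial>\<rho>)" using i g(2) by (intro integral_mono) auto
    finally show ?thesis by (simp add: prob_space)
  qed
  then show "\<bar>cos_coeff \<rho> w\<bar> \<le> 1" "\<bar>sin_coeff \<rho> w\<bar> \<le> 1" by (simp_all add: cos_coeff_def sin_coeff_def)
qed

lemma measurable_on_pair:
  assumes \<rho>: "torus_prob \<rho>" and g: "g \<in> borel_measurable borel"
  shows "(\<lambda>p. g (fst p - snd p)) \<in> borel_measurable (\<rho> \<Otimes>\<^sub>M \<rho>)"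
proof -
  have [measurable]: "(\<lambda>x. x) \<in> \<rho> \<rightarrow>\<^sub>M borel"
    using id_measurable_torus_borel measurable_cong_sets[OF torus_probD(2)[OF \<rho>] refl, of borel] by blast
  note g [measurable]
  have [measurable]: "fst \<in> \<rho> \<Otimes>\<^sub>M \<rho> \<rightarrow>\<^sub>M borel" "snd \<in> \<rho> \<Otimes>\<^sub>M \<rho> \<rightarrow>\<^sub>M borel"
    using measurable_compose[OF measurable_fst, of "\<lambda>x. x" \<rho> borel \<rho>]
      measurable_compose[OF measurable_snd, of "\<lambda>x. x" \<rho> borel \<rho>] by auto
  show ?thesis by measurable
qed

lemma borel_measurable_cos_inner [measurable]: "(\<lambda>x. cos (2 * pi * (w \<bullet> x))) \<in> borel_measurable borel"
  and borel_measurable_sin_inner [measurable]: "(\<lambda>x. sin (2 * pi * (w \<bullet> x))) \<in> borel_measurable borel"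
  by (intro borel_measurable_continuous_onI continuous_intros)+

text \<open>The addition formula separates the two variables; this is what makes the energy diagonal
  in the Fourier coefficients.\<close>

lemma integral_cos_diff:
  assumes \<rho>: "torus_prob \<rho>"
  shows "(\<integral>p. cos (2 * pi * (w \<bullet> (fst p - snd p))) \<partial>(\<rho> \<Otimes>\<^sub>M \<rho>)) = (cos_coeff \<rho> w)\<^sup>2 + (sin_coeff \<rho> w)\<^sup>2"
proof -
  interpret prob_space \<rho> by (rule torus_probD[OF \<rho>])
  interpret pair_prob_space \<rho> \<rho> ..
  let ?h = "\<lambda>p. cos (2 * pi * (w \<bullet> (fst p - snd p)))"
  have int: "integrable (\<rho> \<Otimes>\<^sub>M \<rho>) (\<lambda>(x, y). ?h (x, y))"
    using measurable_on_pair[OF \<rho> borel_measurable_cos_inner] by (intro P.integrable_const_bound[where B=1]) (auto simp: case_prod_beta)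
  have ic: "integrable \<rho> (\<lambda>x. cos (2 * pi * (w \<bullet> x)))" "integrable \<rho> (\<lambda>x. sin (2 * pi * (w \<bullet> x)))"
    by (rule torus_prob_integrable[OF \<rho>, where B=1]; simp)+
  have "(\<integral>p. ?h p \<partial>(\<rho> \<Otimes>\<^sub>M \<rho>)) = (\<integral>x. (\<integral>y. ?h (x, y) \<partial>\<rho>) \<partial>\<rho>)"
    using integral_fst'[OF int] by (simp add: split_beta')
  also have "\<dots> = (\<integral>x. cos (2 * pi * (w \<bullet> x)) * cos_coeff \<rho> w + sin (2 * pi * (w \<bullet> x)) * sin_coeff \<rho> w \<partial>\<rho>)"
    using ic by (simp add: inner_diff_right right_diff_distrib cos_diff cos_coeff_def sin_coeff_def)
  also have "\<dots> = (cos_coeff \<rho> w)\<^sup>2 + (sin_coeff \<rho> w)\<^sup>2"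
    using ic by (simp add: power2_eq_square cos_coeff_def[symmetric] sin_coeff_def[symmetric])
  finally show ?thesis .
qed

text \<open>The coefficients determine the integrals of trigonometric polynomials, which are
  uniformly dense among the continuous periodic functions.\<close>

lemma torus_prob_eqI_coeff:
  assumes \<nu>: "torus_prob \<nu>" and \<rho>: "torus_prob \<rho>"
    and eq: "\<And>w. w \<in> dual \<Longrightarrow> cos_coeff \<nu> w = cos_coeff \<rho> w"
      "\<And>w. w \<in> dual \<Longrightarrow> sin_coeff \<nu> w = sin_coeff \<rho> w"
  shows "\<nu> = \<rho>"
proof (rule torus_prob_eqI[OF \<nu> \<rho>])
  fix g :: "real^'d \<Rightarrow> real" assume g: "continuous_on UNIV g" "periodic g"
  have int: "integrable \<sigma> h" if "torus_prob \<sigma>" "continuous_on UNIV h" "periodic h" for \<sigma> and h :: "real^'d \<Rightarrow> real"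
    using periodic_bounded[OF that(2,3)] torus_prob_integrable[OF that(1) borel_measurable_continuous_onI[OF that(2)]] by blast
  have int_p: "integrable \<sigma> p" if "torus_prob \<sigma>" "p \<in> trig_poly" for \<sigma> p
    by (rule int[OF that(1) trig_poly_continuous[OF that(2)] trig_poly_periodic[OF that(2)]])
  have poly: "(\<integral>x. p x \<partial>\<nu>) = (\<integral>x. p x \<partial>\<rho>)" if "p \<in> trig_poly" for p
    using that
  proof induction
    case (cosI w c) then show ?case using eq(1)[of w] by (simp add: cos_coeff_def)
  next
    case (sinI w c) then show ?case using eq(2)[of w] by (simp add: sin_coeff_def)
  next
    case (addI p q) then show ?case using int_p[OF \<nu>] int_p[OF \<rho>] by simp
  qed
  have near: "\<bar>(\<integral>x. g x \<partial>\<sigma>) - (\<integral>x. p x \<partial>\<sigma>)\<bar> \<le> e"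
    if \<sigma>: "torus_prob \<sigma>" and p: "p \<in> trig_poly" "\<And>x. \<bar>g x - p x\<bar> < e" for \<sigma> p e
  proof -
    interpret prob_space \<sigma> by (rule torus_probD[OF \<sigma>])
    have i: "integrable \<sigma> (\<lambda>x. g x - p x)" using int[OF \<sigma> g] int_p[OF \<sigma> p(1)] by simp
    have "\<bar>(\<integral>x. g x \<partial>\<sigma>) - (\<integral>x. p x \<partial>\<sigma>)\<bar> = \<bar>\<integral>x. g x - p x \<partial>\<sigma>\<bar>"
      using int[OF \<sigma> g] int_p[OF \<sigma> p(1)] by simp
    also have "\<dots> \<le> (\<integral>x. \<bar>g x - p x\<bar> \<partial>\<sigma>)" by (rule integral_abs_bound)
    also have "\<dots> \<le> (\<integral>x. e \<partial>\<sigma>)" using i p(2) by (intro integral_mono) (auto simp: less_imp_le)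
    finally show ?thesis by (simp add: prob_space)
  qed
  have "\<bar>(\<integral>x. g x \<partial>\<nu>) - (\<integral>x. g x \<partial>\<rho>)\<bar> \<le> 0 + e" if e: "e > 0" for e
  proof -
    obtain p where p: "p \<in> trig_poly" "\<And>x. \<bar>g x - p x\<bar> < e / 2"
      using trig_poly_dense[OF g, of "e / 2"] e by auto
    show ?thesis using near[OF \<nu> p] near[OF \<rho> p] poly[OF p(1)] by linarith
  qed
  then show "(\<integral>x. g x \<partial>\<nu>) = (\<integral>x. g x \<partial>\<rho>)"
    using field_le_epsilon[of "\<bar>(\<integral>x. g x \<partial>\<nu>) - (\<integral>x. g x \<partial>\<rho>)\<bar>" 0] by simp
qed

text \<open>The half-sum of the two measures, realized as the law of a point that a fair coin takes
  from \<open>\<nu>\<close> or from \<open>\<rho>\<close>; total mass 1 is then inherited from the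
  product space.\<close>

definition mixture :: "(real^'d) measure \<Rightarrow> (real^'d) measure \<Rightarrow> (real^'d) measure" where
  "mixture \<nu> \<rho> = distr (measure_pmf (bernoulli_pmf (1 / 2)) \<Otimes>\<^sub>M (\<nu> \<Otimes>\<^sub>M \<rho>)) (torus_borel V)
     (\<lambda>p. if fst p then fst (snd p) else snd (snd p))"

lemma mixture:
  assumes \<nu>: "torus_prob \<nu>" and \<rho>: "torus_prob \<rho>"
  shows "torus_prob (mixture \<nu> \<rho>)"
    and "\<And>g :: real^'d \<Rightarrow> real. g \<in> borel_measurable (torus_borel V) \<Longrightarrow> (\<And>x. \<bar>g x\<bar> \<le> B) \<Longrightarrow>
      (\<integral>x. g x \<partial>mixture \<nu> \<rho>) = ((\<integral>x. g x \<partial>\<nu>) + (\<integral>x. g x \<partial>\<rho>)) / 2"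
proof -
  interpret \<nu>: prob_space \<nu> by (rule torus_probD[OF \<nu>])
  interpret \<rho>: prob_space \<rho> by (rule torus_probD[OF \<rho>])
  interpret \<nu>\<rho>: pair_prob_space \<nu> \<rho> ..
  interpret b: prob_space "measure_pmf (bernoulli_pmf (1 / 2))" by (rule prob_space_measure_pmf)
  interpret b\<nu>\<rho>: pair_prob_space "measure_pmf (bernoulli_pmf (1 / 2))" "\<nu> \<Otimes>\<^sub>M \<rho>" ..
  let ?T = "\<lambda>p. if fst p then fst (snd p) else snd (snd p)"
  have id: "(\<lambda>x. x) \<in> \<nu> \<rightarrow>\<^sub>M torus_borel V" "(\<lambda>x. x) \<in> \<rho> \<rightarrow>\<^sub>M torus_borel V"
    using torus_probD(2)[OF \<nu>] torus_probD(2)[OF \<rho>] by (simp_all add: measurable_ident_sets)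
  have proj [measurable]: "fst \<in> \<nu> \<Otimes>\<^sub>M \<rho> \<rightarrow>\<^sub>M torus_borel V" "snd \<in> \<nu> \<Otimes>\<^sub>M \<rho> \<rightarrow>\<^sub>M torus_borel V"
    using measurable_compose[OF measurable_fst id(1)] measurable_compose[OF measurable_snd id(2)] by auto
  have T: "?T \<in> measure_pmf (bernoulli_pmf (1 / 2)) \<Otimes>\<^sub>M (\<nu> \<Otimes>\<^sub>M \<rho>) \<rightarrow>\<^sub>M torus_borel V"
    by measurable
  show "torus_prob (mixture \<nu> \<rho>)"
    unfolding torus_prob_def mixture_def using b\<nu>\<rho>.P.prob_space_distr[OF T] by simp
  fix g :: "real^'d \<Rightarrow> real" assume g [measurable]: "g \<in> borel_measurable (torus_borel V)" and B: "\<And>x. \<bar>g x\<bar> \<le> B"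
  have i2: "integrable (\<nu> \<Otimes>\<^sub>M \<rho>) (\<lambda>q. g (fst q))" "integrable (\<nu> \<Otimes>\<^sub>M \<rho>) (\<lambda>q. g (snd q))"
    using measurable_compose[OF proj(1) g] measurable_compose[OF proj(2) g] B
    by (auto intro!: \<nu>\<rho>.P.integrable_const_bound[where B=B])
  have i3: "integrable (measure_pmf (bernoulli_pmf (1 / 2)) \<Otimes>\<^sub>M (\<nu> \<Otimes>\<^sub>M \<rho>)) (\<lambda>p. g (?T p))"
    using measurable_compose[OF T g] B by (intro b\<nu>\<rho>.P.integrable_const_bound[where B=B]) auto
  have e2: "(\<integral>q. g (fst q) \<partial>(\<nu> \<Otimes>\<^sub>M \<rho>)) = (\<integral>x. g x \<partial>\<nu>)" "(\<integral>q. g (snd q) \<partial>(\<nu> \<Otimes>\<^sub>M \<rho>)) = (\<integral>x. g x \<partial>\<rho>)"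
    using \<nu>\<rho>.integral_fst'[of "\<lambda>q. g (fst q)"] \<nu>\<rho>.integral_fst'[of "\<lambda>q. g (snd q)"] i2
    by (simp_all add: \<nu>.prob_space \<rho>.prob_space)
  have "(\<integral>x. g x \<partial>mixture \<nu> \<rho>) = (\<integral>p. g (?T p) \<partial>(measure_pmf (bernoulli_pmf (1 / 2)) \<Otimes>\<^sub>M (\<nu> \<Otimes>\<^sub>M \<rho>)))"
    unfolding mixture_def by (rule integral_distr[OF T g])
  also have "\<dots> = (\<integral>c. (\<integral>q. g (?T (c, q)) \<partial>(\<nu> \<Otimes>\<^sub>M \<rho>)) \<partial>measure_pmf (bernoulli_pmf (1 / 2)))"
    using b\<nu>\<rho>.integral_fst'[OF i3] by simp
  also have "\<dots> = ((\<integral>x. g x \<partial>\<nu>) + (\<integral>x. g x \<partial>\<rho>)) / 2"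
    by (simp add: e2)
  finally show "(\<integral>x. g x \<partial>mixture \<nu> \<rho>) = ((\<integral>x. g x \<partial>\<nu>) + (\<integral>x. g x \<partial>\<rho>)) / 2" .
qed

lemma mixture_coeff:
  assumes \<nu>: "torus_prob \<nu>" and \<rho>: "torus_prob \<rho>"
  shows "cos_coeff (mixture \<nu> \<rho>) w = (cos_coeff \<nu> w + cos_coeff \<rho> w) / 2"
    and "sin_coeff (mixture \<nu> \<rho>) w = (sin_coeff \<nu> w + sin_coeff \<rho> w) / 2"
proof -
  have "(\<lambda>x. cos (2 * pi * (w \<bullet> x))) \<in> borel_measurable (torus_borel V)"
    "(\<lambda>x. sin (2 * pi * (w \<bullet> x))) \<in> borel_measurable (torus_borel V)"
    by (rule measurable_compose[OF id_measurable_torus_borel], simp)+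
  from mixture(2)[OF \<nu> \<rho> this(1), of 1] mixture(2)[OF \<nu> \<rho> this(2), of 1]
  show "cos_coeff (mixture \<nu> \<rho>) w = (cos_coeff \<nu> w + cos_coeff \<rho> w) / 2"
    "sin_coeff (mixture \<nu> \<rho>) w = (sin_coeff \<nu> w + sin_coeff \<rho> w) / 2"
    by (simp_all add: cos_coeff_def sin_coeff_def)
qed

text \<open>Rewrites the support condition as a condition that is linear in the measure, hence
  preserved by mixtures.\<close>

lemma torus_support_subset_iff:
  assumes A: "compactin (torus_topology V) A" and \<nu>: "torus_prob \<nu>"
  shows "torus_support V \<nu> \<subseteq> A \<longleftrightarrow> measure \<nu> (cell - A) = 0"
proof
  interpret prob_space \<nu> by (rule torus_probD[OF \<nu>])
  note op = closed_saturation(2)[OF A]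
  have s: "cell - A \<in> sets \<nu>" using openin_sets_torus_borel[OF op] torus_probD(2)[OF \<nu>] by simp
  { assume "torus_support V \<nu> \<subseteq> A"
    then have AE: "AE x in \<nu>. x \<in> A" by (rule AE_torus_support[OF \<nu>])
    have "{x \<in> space \<nu>. \<not> x \<in> A} = cell - A" using torus_probD(3)[OF \<nu>] by auto
    from AE_iff_measurable[OF s this] AE have "emeasure \<nu> (cell - A) = 0" by simp
    then show "measure \<nu> (cell - A) = 0" by (simp add: emeasure_eq_measure) }
  assume "measure \<nu> (cell - A) = 0"
  then have "emeasure \<nu> (cell - A) = 0" by (simp add: emeasure_eq_measure)
  then have "x \<notin> torus_support V \<nu>" if "x \<in> cell - A" for x
    using op that unfolding torus_support_def by (metis (no_types, lifting) less_irrefl mem_Collect_eq)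
  moreover have "torus_support V \<nu> \<subseteq> cell" by (auto simp: torus_support_def)
  ultimately show "torus_support V \<nu> \<subseteq> A" by blast
qed

lemma torus_support_mixture:
  assumes A: "compactin (torus_topology V) A" and \<nu>: "torus_prob \<nu>" and \<rho>: "torus_prob \<rho>"
    and supp: "torus_support V \<nu> \<subseteq> A" "torus_support V \<rho> \<subseteq> A"
  shows "torus_support V (mixture \<nu> \<rho>) \<subseteq> A"
proof -
  have s: "cell - A \<in> sets (torus_borel V)" by (rule openin_sets_torus_borel[OF closed_saturation(2)[OF A]])
  have "measure \<sigma> (cell - A) = (\<integral>x. indicator (cell - A) x \<partial>\<sigma>)" if "torus_prob \<sigma>" for \<sigma>
    using s torus_probD(2)[OF that] by simp
  moreover have "(\<integral>x. indicator (cell - A) x \<partial>mixture \<nu> \<rho>) =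
      ((\<integral>x. indicator (cell - A) x \<partial>\<nu>) + (\<integral>x. indicator (cell - A) x \<partial>\<rho>)) / (2 :: real)"
    by (rule mixture(2)[OF \<nu> \<rho>, where B=1]) (use s in \<open>auto simp: abs_indicator indicator_le_1 split: split_indicator intro: borel_measurable_indicator\<close>)
  ultimately show ?thesis
    using supp torus_support_subset_iff[OF A] \<nu> \<rho> mixture(1)[OF \<nu> \<rho>] by simp
qed

end

text \<open>A finite difference with finite negative part has a finite positive part as well, so
  \<open>G\<close> is real almost everywhere and real-valued integration applies.\<close>

lemma ereal_integral_eq_real:
  assumes [measurable]: "G \<in> borel_measurable M" and neg: "(\<integral>\<^sup>+x. e2ennreal (- G x) \<partial>M) < \<infinity>"
    and e: "ereal_integral M G = ereal e"
  shows "integrable M (\<lambda>x. real_of_ereal (G x))" and "(\<integral>x. real_of_ereal (G x) \<partial>M) = e"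
    and "AE x in M. G x = ereal (real_of_ereal (G x))"
proof -
  have pos: "(\<integral>\<^sup>+x. e2ennreal (G x) \<partial>M) < \<infinity>"
    using neg e unfolding ereal_integral_def
    by (cases "\<integral>\<^sup>+x. e2ennreal (G x) \<partial>M"; cases "\<integral>\<^sup>+x. e2ennreal (- G x) \<partial>M") (auto simp: enn2ereal_ennreal)
  have "AE x in M. e2ennreal (G x) \<noteq> \<infinity>" "AE x in M. e2ennreal (- G x) \<noteq> \<infinity>"
    using pos neg by (intro nn_integral_PInf_AE; simp)+
  then show AE: "AE x in M. G x = ereal (real_of_ereal (G x))"
    by eventually_elim (auto simp: ereal_real)
  have eq: "(\<integral>\<^sup>+x. ennreal (real_of_ereal (G x)) \<partial>M) = (\<integral>\<^sup>+x. e2ennreal (G x) \<partial>M)"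
    "(\<integral>\<^sup>+x. ennreal (- real_of_ereal (G x)) \<partial>M) = (\<integral>\<^sup>+x. e2ennreal (- G x) \<partial>M)"
    using AE by (auto intro!: nn_integral_cong_AE elim!: eventually_mono) (metis e2ennreal_ereal uminus_ereal.simps(1))+
  show int: "integrable M (\<lambda>x. real_of_ereal (G x))"
    unfolding real_integrable_def eq using pos neg by auto
  show "(\<integral>x. real_of_ereal (G x) \<partial>M) = e"
    unfolding real_lebesgue_integral_def[OF int] eq using e pos neg unfolding ereal_integral_def
    by (cases "\<integral>\<^sup>+x. e2ennreal (G x) \<partial>M"; cases "\<integral>\<^sup>+x. e2ennreal (- G x) \<partial>M") (auto simp: enn2ereal_ennreal)
qed

text \<open>Distinct coordinates are independent. This computes the expected interaction of two
  random points of a configuration.\<close>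

lemma distr_PiM_pair:
  assumes M: "prob_space M" and I: "j \<in> I" "k \<in> I" "j \<noteq> k"
  shows "distr (PiM I (\<lambda>_. M)) (M \<Otimes>\<^sub>M M) (\<lambda>x. (x j, x k)) = M \<Otimes>\<^sub>M M"
proof (rule pair_measure_eqI[symmetric])
  interpret M: prob_space M by fact
  show "sigma_finite_measure M" "sigma_finite_measure M" by unfold_locales
  fix A B assume AB: "A \<in> sets M" "B \<in> sets M"
  let ?X = "\<lambda>i. if i = j then A else B"
  have m: "(\<lambda>x. (x j, x k)) \<in> PiM I (\<lambda>_. M) \<rightarrow>\<^sub>M M \<Otimes>\<^sub>M M" using I by simp
  have "(\<lambda>x. (x j, x k)) -` (A \<times> B) \<inter> space (PiM I (\<lambda>_. M)) = prod_emb I (\<lambda>_. M) {j, k} (Pi\<^sub>E {j, k} ?X)"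
    using I by (auto simp: prod_emb_def space_PiM PiE_def Pi_def split: if_splits)
  moreover have "emeasure (PiM I (\<lambda>_. M)) (prod_emb I (\<lambda>_. M) {j, k} (Pi\<^sub>E {j, k} ?X)) = (\<Prod>i\<in>{j, k}. emeasure M (?X i))"
    using I AB M by (intro emeasure_PiM_emb) auto
  ultimately show "emeasure M A * emeasure M B = emeasure (distr (PiM I (\<lambda>_. M)) (M \<Otimes>\<^sub>M M) (\<lambda>x. (x j, x k))) (A \<times> B)"
    using AB I by (subst emeasure_distr[OF m]) auto
qed simp

text \<open>The conclusions of \<open>kernel_approximation\<close> as an interface: the arguments
  below know nothing else about the potential.\<close>

locale fourier_kernel = unimodular_lattice V for V :: "real^'d^'d" +
  fixes a :: "nat \<Rightarrow> real^'d \<Rightarrow> real" and K :: "real^'d \<Rightarrow> real^'d \<Rightarrow> ereal"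
  assumes integrable_a: "integrable (count_space dual) (a n)"
    and incseq_a: "w \<in> dual \<Longrightarrow> incseq (\<lambda>n. a n w)"
    and a_pos: "w \<in> dual \<Longrightarrow> w \<noteq> 0 \<Longrightarrow> \<exists>n. a n w > 0"
    and incseq_kernel: "incseq (\<lambda>n. \<integral>w. a n w * cos (2 * pi * (w \<bullet> z)) \<partial>count_space dual)"
    and kernel_LIMSEQ: "(\<lambda>n. ereal (\<integral>w. a n w * cos (2 * pi * (w \<bullet> (x - y))) \<partial>count_space dual)) \<longlonglongrightarrow> K x y"
begin

section \<open>Quadratic forms of the truncated kernels and uniqueness of minimizers\<close>

definition trunc :: "nat \<Rightarrow> real^'d \<Rightarrow> real" where
  "trunc n z = (\<integral>w. a n w * cos (2 * pi * (w \<bullet> z)) \<partial>count_space dual)"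

definition energy :: "(real^'d) measure \<Rightarrow> ereal" where
  "energy \<rho> = ereal_integral (\<rho> \<Otimes>\<^sub>M \<rho>) (\<lambda>(x, y). K x y)"

text \<open>\<open>C\<close> and \<open>S\<close> play the role of the cosine and sine coefficients of a measure.\<close>

definition quad :: "nat \<Rightarrow> (real^'d \<Rightarrow> real) \<Rightarrow> (real^'d \<Rightarrow> real) \<Rightarrow> real" where
  "quad n C S = (\<integral>w. a n w * ((C w)\<^sup>2 + (S w)\<^sup>2) \<partial>count_space dual)"

lemma integrable_a_mult:
  assumes "\<And>w. w \<in> dual \<Longrightarrow> \<bar>g w\<bar> \<le> c"
  shows "integrable (count_space dual) (\<lambda>w. a n w * g w)"
proof (rule integrable_count_space_bound)
  show "integrable (count_space dual) (\<lambda>w. \<bar>a n w\<bar> * c)"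
    using integrable_a[of n] by simp
qed (use assms in \<open>auto simp: abs_mult mult_left_mono\<close>)

lemma integral_trunc_pair:
  assumes \<rho>: "torus_prob \<rho>"
  shows "integrable (\<rho> \<Otimes>\<^sub>M \<rho>) (\<lambda>p. trunc n (fst p - snd p))"
    and "(\<integral>p. trunc n (fst p - snd p) \<partial>(\<rho> \<Otimes>\<^sub>M \<rho>)) = quad n (cos_coeff \<rho>) (sin_coeff \<rho>)"
proof -
  interpret prob_space \<rho> by (rule torus_probD[OF \<rho>])
  interpret pair_prob_space \<rho> \<rho> ..
  have meas: "(\<lambda>p. a n w * cos (2 * pi * (w \<bullet> (fst p - snd p)))) \<in> borel_measurable (\<rho> \<Otimes>\<^sub>M \<rho>)" for w
    using measurable_on_pair[OF \<rho> borel_measurable_cos_inner] by simp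
  have b: "integrable (count_space dual) (\<lambda>w. \<bar>a n w\<bar>)" using integrable_a by simp
  note swap = integral_count_space_swap[OF countable_dual P.finite_measure_axioms meas b]
  show "integrable (\<rho> \<Otimes>\<^sub>M \<rho>) (\<lambda>p. trunc n (fst p - snd p))"
    unfolding trunc_def by (rule swap(1)) (simp_all add: abs_mult mult_left_le)
  show "(\<integral>p. trunc n (fst p - snd p) \<partial>(\<rho> \<Otimes>\<^sub>M \<rho>)) = quad n (cos_coeff \<rho>) (sin_coeff \<rho>)"
    unfolding trunc_def by (subst swap(2)) (simp_all add: abs_mult mult_left_le integral_cos_diff[OF \<rho>] quad_def)
qed

lemma energy_LIMSEQ:
  assumes "torus_prob \<rho>"
  shows "(\<lambda>n. ereal (quad n (cos_coeff \<rho>) (sin_coeff \<rho>))) \<longlonglongrightarrow> energy \<rho>"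
  unfolding energy_def integral_trunc_pair(2)[OF assms, symmetric]
  by (rule ereal_integral_incseq_LIMSEQ)
    (use integral_trunc_pair(1)[OF assms] incseq_kernel kernel_LIMSEQ in \<open>auto simp: trunc_def\<close>)

lemma quad_mono:
  assumes \<rho>: "torus_prob \<rho>"
  shows "incseq (\<lambda>n. quad n (cos_coeff \<rho>) (sin_coeff \<rho>))"
  unfolding integral_trunc_pair(2)[OF \<rho>, symmetric]
proof (rule incseq_SucI, rule integral_mono)
  fix n p
  show "trunc n (fst p - snd p) \<le> trunc (Suc n) (fst p - snd p)"
    unfolding trunc_def using incseq_SucD[OF incseq_kernel] .
qed (rule integral_trunc_pair(1)[OF \<rho>])+

lemma quad_le_energy: "torus_prob \<rho> \<Longrightarrow> ereal (quad n (cos_coeff \<rho>) (sin_coeff \<rho>)) \<le> energy \<rho>"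
  using incseq_le[OF _ energy_LIMSEQ, of \<rho> n] quad_mono[of \<rho>] by (simp add: incseq_def)

lemma quad_parallelogram:
  assumes "\<And>w. \<bar>C w\<bar> \<le> 1" "\<And>w. \<bar>S w\<bar> \<le> 1" "\<And>w. \<bar>C' w\<bar> \<le> 1" "\<And>w. \<bar>S' w\<bar> \<le> 1"
  shows "quad n (\<lambda>w. (C w + C' w) / 2) (\<lambda>w. (S w + S' w) / 2) =
    (quad n C S + quad n C' S') / 2 - quad n (\<lambda>w. C w - C' w) (\<lambda>w. S w - S' w) / 4"
proof -
  \<comment> \<open>Differences of coefficients are at most 2 in absolute value, and
    \<open>8 = 2\<^sup>2 + 2\<^sup>2\<close>.\<close>
  have diff: "\<bar>(C w - C' w)\<^sup>2 + (S w - S' w)\<^sup>2\<bar> \<le> 8" for w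
    using power_mono[of "\<bar>C w - C' w\<bar>" 2 2] power_mono[of "\<bar>S w - S' w\<bar>" 2 2] assms[of w]
    by (simp add: abs_le_iff)
  have i: "integrable (count_space dual) (\<lambda>w. a n w * ((C w)\<^sup>2 + (S w)\<^sup>2))"
    "integrable (count_space dual) (\<lambda>w. a n w * ((C' w)\<^sup>2 + (S' w)\<^sup>2))"
    "integrable (count_space dual) (\<lambda>w. a n w * ((C w - C' w)\<^sup>2 + (S w - S' w)\<^sup>2))"
    using assms diff by (auto intro!: integrable_a_mult abs_sum_squares_le)
  have "quad n (\<lambda>w. (C w + C' w) / 2) (\<lambda>w. (S w + S' w) / 2) =
      (\<integral>w. (a n w * ((C w)\<^sup>2 + (S w)\<^sup>2) + a n w * ((C' w)\<^sup>2 + (S' w)\<^sup>2)) / 2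
        - a n w * ((C w - C' w)\<^sup>2 + (S w - S' w)\<^sup>2) / 4 \<partial>count_space dual)"
    unfolding quad_def
  proof (rule Bochner_Integration.integral_cong[OF refl])
    fix w
    show "a n w * (((C w + C' w) / 2)\<^sup>2 + ((S w + S' w) / 2)\<^sup>2) =
        (a n w * ((C w)\<^sup>2 + (S w)\<^sup>2) + a n w * ((C' w)\<^sup>2 + (S' w)\<^sup>2)) / 2
        - a n w * ((C w - C' w)\<^sup>2 + (S w - S' w)\<^sup>2) / 4"
      by (simp add: power2_eq_square field_simps)
  qed
  also have "\<dots> = (quad n C S + quad n C' S') / 2 - quad n (\<lambda>w. C w - C' w) (\<lambda>w. S w - S' w) / 4"
    using i by (simp add: quad_def)
  finally show ?thesis .
qed

text \<open>Positive definiteness in the limit. One mode \<open>w\<close> contributes at least a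
  fixed amount once its coefficient is positive, while the total of all negative contributions tends
  to 0. The unsigned coefficient at 0 is excluded by \<open>C 0 = 0\<close> and
  \<open>S 0 = 0\<close>.\<close>

lemma quad_eventually_ge:
  assumes bound: "\<And>w. \<bar>C w\<bar> \<le> 2" "\<And>w. \<bar>S w\<bar> \<le> 2" and zero: "C 0 = 0" "S 0 = 0"
    and w: "w \<in> dual" "(C w)\<^sup>2 + (S w)\<^sup>2 > 0"
  shows "\<exists>c>0. eventually (\<lambda>n. quad n C S \<ge> c) sequentially"
proof -
  define d where "d u = (C u)\<^sup>2 + (S u)\<^sup>2" for u
  have d: "0 \<le> d u" "d u \<le> 8" for u
    using power_mono[of "\<bar>C u\<bar>" 2 2] power_mono[of "\<bar>S u\<bar>" 2 2] bound[of u] by (auto simp: d_def)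
  have d0: "d 0 = 0" using zero by (simp add: d_def)
  have "w \<noteq> 0" using w(2) d0 by (auto simp: d_def)
  then obtain n0 where n0: "a n0 w > 0" using a_pos[OF w(1)] by blast
  define c where "c = a n0 w * d w"
  have c: "c > 0" using n0 w(2) by (simp add: c_def d_def)
  \<comment> \<open>As \<open>a n u \<ge> a 0 u\<close>, the negative part of \<open>a n u\<close>
    is at most that of \<open>a 0 u\<close>; this gives a majorant independent of
    \<open>n\<close>.\<close>
  have min_bound: "\<bar>min 0 (a n u) * d u\<bar> \<le> \<bar>a 0 u\<bar> * 8" if u: "u \<in> dual" for n u
  proof -
    have "a 0 u \<le> a n u" using incseq_a[OF u] by (simp add: incseq_def)
    then have "\<bar>min 0 (a n u)\<bar> \<le> \<bar>a 0 u\<bar>" by (auto simp: min_def)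
    then show ?thesis unfolding abs_mult using d[of u] by (intro mult_mono) auto
  qed
  have b: "integrable (count_space dual) (\<lambda>u. \<bar>a 0 u\<bar> * 8)" using integrable_a[of 0] by simp
  have "(\<lambda>n. \<integral>u. min 0 (a n u) * d u \<partial>count_space dual) \<longlonglongrightarrow> (\<integral>u. 0 \<partial>count_space dual)"
  proof (rule integral_dominated_convergence[OF _ _ b])
    show "AE u in count_space dual. (\<lambda>n. min 0 (a n u) * d u) \<longlonglongrightarrow> 0"
      unfolding AE_count_space
    proof
      fix u assume u: "u \<in> dual"
      show "(\<lambda>n. min 0 (a n u) * d u) \<longlonglongrightarrow> 0"
      proof (cases "u = 0")
        case True then show ?thesis using d0 by simp
      next
        case False
        then obtain m where m: "a m u > 0" using a_pos[OF u] by blast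
        have "min 0 (a n u) * d u = 0" if "n \<ge> m" for n
          using incseqD[OF incseq_a[OF u] that] m by simp
        then show ?thesis by (intro tendsto_eventually eventually_sequentiallyI[of m])
      qed
    qed
    show "AE u in count_space dual. norm (min 0 (a n u) * d u) \<le> \<bar>a 0 u\<bar> * 8" for n
      using min_bound by (simp add: AE_count_space)
  qed auto
  then have ev: "eventually (\<lambda>n. (\<integral>u. min 0 (a n u) * d u \<partial>count_space dual) > - (c / 2)) sequentially"
    using c by (intro order_tendstoD(1)) auto
  have "quad n C S \<ge> c / 2"
    if n: "n \<ge> n0" and r: "(\<integral>u. min 0 (a n u) * d u \<partial>count_space dual) > - (c / 2)" for n
  proof -
    have ind: "integrable (count_space dual) (\<lambda>u. indicator {w} u * c)" "(\<integral>u. indicator {w} u * c \<partial>count_space dual) = c"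
      using w(1) by (auto simp: measure_def emeasure_count_space_finite)
    have mi: "integrable (count_space dual) (\<lambda>u. min 0 (a n u) * d u)"
      by (rule integrable_count_space_bound[OF b min_bound])
    have "(\<integral>u. min 0 (a n u) * d u + indicator {w} u * c \<partial>count_space dual) \<le> (\<integral>u. a n u * d u \<partial>count_space dual)"
    proof (rule integral_mono)
      show "integrable (count_space dual) (\<lambda>u. a n u * d u)"
        by (rule integrable_a_mult[where c=8]) (use d in auto)
      fix u assume "u \<in> space (count_space dual)"
      show "min 0 (a n u) * d u + indicator {w} u * c \<le> a n u * d u"
      proof (cases "u = w")
        case True
        have "a n0 w \<le> a n w" using incseqD[OF incseq_a[OF w(1)] n] .
        then show ?thesis using True n0 d(1)[of w] by (simp add: c_def mult_right_mono)
      next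
        case False then show ?thesis using d(1)[of u] by (simp add: mult_right_mono)
      qed
    qed (use ind mi in simp)
    then have "(\<integral>u. min 0 (a n u) * d u \<partial>count_space dual) + c \<le> quad n C S"
      unfolding Bochner_Integration.integral_add[OF mi ind(1)] ind(2) by (simp add: quad_def d_def)
    then show ?thesis using r by simp
  qed
  then have "eventually (\<lambda>n. quad n C S \<ge> c / 2) sequentially"
    using eventually_conj[OF ev eventually_ge_at_top[of n0]] by (auto elim: eventually_mono)
  then show ?thesis using c by (intro exI[of _ "c / 2"]) simp
qed

theorem energy_minimizer_unique:
  assumes A: "compactin (torus_topology V) A"
    and \<nu>: "torus_prob \<nu>" "torus_support V \<nu> \<subseteq> A" and \<rho>: "torus_prob \<rho>" "torus_support V \<rho> \<subseteq> A"
    and min: "\<And>\<sigma>. torus_prob \<sigma> \<Longrightarrow> torus_support V \<sigma> \<subseteq> A \<Longrightarrow> energy \<nu> \<le> energy \<sigma>"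
    and le: "energy \<rho> \<le> energy \<nu>" and fin: "energy \<nu> < \<infinity>"
  shows "\<rho> = \<nu>"
proof (rule ccontr)
  assume "\<rho> \<noteq> \<nu>"
  then obtain w where w: "w \<in> dual" "cos_coeff \<rho> w \<noteq> cos_coeff \<nu> w \<or> sin_coeff \<rho> w \<noteq> sin_coeff \<nu> w"
    using torus_prob_eqI_coeff[OF \<rho>(1) \<nu>(1)] by blast
  let ?C = "\<lambda>w. cos_coeff \<rho> w - cos_coeff \<nu> w" and ?S = "\<lambda>w. sin_coeff \<rho> w - sin_coeff \<nu> w"
  note bd = abs_coeff_le[OF \<rho>(1)] abs_coeff_le[OF \<nu>(1)]
  \<comment> \<open>Both measures have mass 1, so their coefficients at \<open>w = 0\<close>
    agree.\<close>
  have "?C 0 = 0" "?S 0 = 0"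
    using prob_space.prob_space[OF torus_probD(1)[OF \<rho>(1)]] prob_space.prob_space[OF torus_probD(1)[OF \<nu>(1)]]
    by (simp_all add: cos_coeff_def sin_coeff_def)
  moreover have "\<bar>?C u\<bar> \<le> 2" "\<bar>?S u\<bar> \<le> 2" for u
    using bd[of u] by (auto simp: abs_le_iff)
  moreover have "(?C w)\<^sup>2 + (?S w)\<^sup>2 > 0" using w(2) by (simp add: sum_power2_gt_zero_iff)
  ultimately obtain c where c: "c > 0" "eventually (\<lambda>n. quad n ?C ?S \<ge> c) sequentially"
    using quad_eventually_ge[of ?C ?S w] w(1) by auto
  define \<sigma> where "\<sigma> = mixture \<rho> \<nu>"
  have \<sigma>: "torus_prob \<sigma>" "torus_support V \<sigma> \<subseteq> A"
    using mixture(1)[OF \<rho>(1) \<nu>(1)] torus_support_mixture[OF A \<rho>(1) \<nu>(1) \<rho>(2) \<nu>(2)] by (auto simp: \<sigma>_def)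
  have q: "quad n (cos_coeff \<sigma>) (sin_coeff \<sigma>) =
      (quad n (cos_coeff \<rho>) (sin_coeff \<rho>) + quad n (cos_coeff \<nu>) (sin_coeff \<nu>)) / 2 - quad n ?C ?S / 4" for n
  proof -
    have "cos_coeff \<sigma> = (\<lambda>w. (cos_coeff \<rho> w + cos_coeff \<nu> w) / 2)" "sin_coeff \<sigma> = (\<lambda>w. (sin_coeff \<rho> w + sin_coeff \<nu> w) / 2)"
      using mixture_coeff[OF \<rho>(1) \<nu>(1)] by (auto simp: \<sigma>_def)
    then show ?thesis using quad_parallelogram[of "cos_coeff \<rho>" "sin_coeff \<rho>" "cos_coeff \<nu>" "sin_coeff \<nu>" n] bd by simp
  qed
  obtain e where e: "energy \<nu> = ereal e"
    using fin quad_le_energy[OF \<nu>(1), of 0] by (cases "energy \<nu>") auto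
  \<comment> \<open>The parallelogram identity puts the midpoint at least \<open>c / 4\<close> below
    the minimum, uniformly for large \<open>n\<close>, so the gap survives the limit and contradicts
    minimality.\<close>
  have "eventually (\<lambda>n. ereal (quad n (cos_coeff \<sigma>) (sin_coeff \<sigma>)) \<le> ereal (e - c / 4)) sequentially"
    using c(2)
  proof eventually_elim
    case (elim n)
    have "ereal (quad n (cos_coeff \<rho>) (sin_coeff \<rho>)) \<le> ereal e" "ereal (quad n (cos_coeff \<nu>) (sin_coeff \<nu>)) \<le> ereal e"
      using order_trans[OF quad_le_energy[OF \<rho>(1)] le] quad_le_energy[OF \<nu>(1)] e by auto
    moreover have "(x + y) / 2 - z / 4 \<le> e - c / 4" if "x \<le> e" "y \<le> e" "c \<le> z" for x y z using that by (simp add: field_simps)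
    ultimately show ?case using elim unfolding q ereal_less_eq by blast
  qed
  then have "energy \<sigma> \<le> ereal (e - c / 4)"
    by (intro tendsto_upperbound[OF energy_LIMSEQ[OF \<sigma>(1)]]) auto
  then show False using order_trans[OF min[OF \<sigma>]] e c(1) by force
qed

section \<open>Discrete energies and the passage to the limit\<close>

lemma trunc_le_kernel: "ereal (trunc n (x - y)) \<le> K x y"
  using incseq_le[OF _ kernel_LIMSEQ, of x y n] incseq_kernel[of "x - y"] by (simp add: incseq_def trunc_def)

text \<open>The double sum includes the diagonal, where the truncated kernel is finite although
  \<open>K\<close> may be infinite.\<close>

lemma quad_point_average:
  assumes "1 \<le> N"
  shows "quad n (\<lambda>w. point_average N x (\<lambda>z. cos (2 * pi * (w \<bullet> z)))) (\<lambda>w. point_average N x (\<lambda>z. sin (2 * pi * (w \<bullet> z)))) =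
    (\<Sum>i<N. \<Sum>j<N. trunc n (x i - x j)) / (real N)\<^sup>2"
proof -
  have int: "integrable (count_space dual) (\<lambda>w. a n w * cos (2 * pi * (w \<bullet> z)))" for z
    by (rule integrable_a_mult[where c=1]) simp
  have sq: "(point_average N x (\<lambda>z. cos (2 * pi * (w \<bullet> z))))\<^sup>2 + (point_average N x (\<lambda>z. sin (2 * pi * (w \<bullet> z))))\<^sup>2 =
      (\<Sum>i<N. \<Sum>j<N. cos (2 * pi * (w \<bullet> (x i - x j)))) / (real N)\<^sup>2" for w
    by (simp add: point_average_def power2_eq_square sum_product inner_diff_right right_diff_distrib cos_diff sum.distrib add_divide_distrib)
  have "(\<Sum>i<N. \<Sum>j<N. trunc n (x i - x j)) / (real N)\<^sup>2 =
      (\<integral>w. (\<Sum>i<N. \<Sum>j<N. a n w * cos (2 * pi * (w \<bullet> (x i - x j)))) / (real N)\<^sup>2 \<partial>count_space dual)"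
    using int by (simp add: trunc_def)
  then show ?thesis unfolding quad_def sq using assms by (simp add: sum_distrib_left)
qed

lemma measurable_kernel:
  assumes "torus_prob \<rho>" shows "(\<lambda>(x, y). K x y) \<in> borel_measurable (\<rho> \<Otimes>\<^sub>M \<rho>)"
proof (rule borel_measurable_LIMSEQ_order[where u = "\<lambda>n p. ereal (trunc n (fst p - snd p))"])
  show "(\<lambda>p. ereal (trunc n (fst p - snd p))) \<in> borel_measurable (\<rho> \<Otimes>\<^sub>M \<rho>)" for n
    using integral_trunc_pair(1)[OF assms] by auto
qed (use kernel_LIMSEQ in \<open>auto simp: trunc_def\<close>)

text \<open>Averaging the discrete energy over independent points distributed according to \<open>\<rho>\<close>.\<close>

lemma discrete_energy_upper_bound:
  assumes \<rho>: "torus_prob \<rho>" "AE x in \<rho>. x \<in> A" and e: "energy \<rho> = ereal e"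
    and c: "\<And>y. y \<in> {..<N} \<rightarrow>\<^sub>E A \<Longrightarrow> ereal c \<le> (\<Sum>j<N. \<Sum>k\<in>{..<N} - {j}. K (y j) (y k))"
  shows "c \<le> real N * real (N - 1) * e"
proof -
  interpret \<rho>: prob_space \<rho> by (rule torus_probD[OF \<rho>(1)])
  interpret \<rho>\<rho>: pair_prob_space \<rho> \<rho> ..
  define P where "P = PiM {..<N} (\<lambda>_. \<rho>)"
  interpret P: prob_space P unfolding P_def by (rule prob_space_PiM) (rule \<rho>.prob_space_axioms)
  define kr where "kr p = real_of_ereal (K (fst p) (snd p))" for p
  note meas = measurable_kernel[OF \<rho>(1)]
  \<comment> \<open>The integrable function \<open>trunc 0\<close> bounds \<open>K\<close> from
    below, so the negative part of \<open>K\<close> is integrable.\<close>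
  have "(\<integral>\<^sup>+p. e2ennreal (- (\<lambda>(x, y). K x y) p) \<partial>(\<rho> \<Otimes>\<^sub>M \<rho>)) \<le> (\<integral>\<^sup>+p. ennreal (- trunc 0 (fst p - snd p)) \<partial>(\<rho> \<Otimes>\<^sub>M \<rho>))"
  proof (rule nn_integral_mono)
    fix p
    have "- (\<lambda>(x, y). K x y) p \<le> ereal (- trunc 0 (fst p - snd p))"
      using trunc_le_kernel[of 0 "fst p" "snd p"] by (cases "K (fst p) (snd p)") (auto simp: split_beta)
    from e2ennreal_mono[OF this]
    show "e2ennreal (- (\<lambda>(x, y). K x y) p) \<le> ennreal (- trunc 0 (fst p - snd p))" by simp
  qed
  also have "\<dots> < \<infinity>"
    using integral_trunc_pair(1)[OF \<rho>(1), of 0] unfolding real_integrable_def by (auto simp: less_top)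
  finally have neg: "(\<integral>\<^sup>+p. e2ennreal (- (\<lambda>(x, y). K x y) p) \<partial>(\<rho> \<Otimes>\<^sub>M \<rho>)) < \<infinity>" .
  note real = ereal_integral_eq_real[OF meas neg e[unfolded energy_def]]
  have kr: "integrable (\<rho> \<Otimes>\<^sub>M \<rho>) kr" "(\<integral>p. kr p \<partial>(\<rho> \<Otimes>\<^sub>M \<rho>)) = e" "AE p in \<rho> \<Otimes>\<^sub>M \<rho>. K (fst p) (snd p) = ereal (kr p)"
    using real by (simp_all add: kr_def[abs_def] split_beta')
  have pair: "integrable P (\<lambda>x. kr (x j, x k))" "(\<integral>x. kr (x j, x k) \<partial>P) = e" "AE x in P. K (x j) (x k) = ereal (kr (x j, x k))"
    if jk: "j < N" "k \<in> {..<N} - {j}" for j k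
  proof -
    have m: "(\<lambda>x. (x j, x k)) \<in> P \<rightarrow>\<^sub>M \<rho> \<Otimes>\<^sub>M \<rho>" using jk by (simp add: P_def)
    have d: "distr P (\<rho> \<Otimes>\<^sub>M \<rho>) (\<lambda>x. (x j, x k)) = \<rho> \<Otimes>\<^sub>M \<rho>"
      unfolding P_def using jk by (intro distr_PiM_pair \<rho>.prob_space_axioms) auto
    have krm: "kr \<in> borel_measurable (\<rho> \<Otimes>\<^sub>M \<rho>)" using kr(1) by auto
    show "integrable P (\<lambda>x. kr (x j, x k))" using integrable_distr_eq[OF m krm] kr(1) unfolding d by simp
    show "(\<integral>x. kr (x j, x k) \<partial>P) = e" using integral_distr[OF m krm] kr(2) unfolding d by simp
    have "AE p in distr P (\<rho> \<Otimes>\<^sub>M \<rho>) (\<lambda>x. (x j, x k)). K (fst p) (snd p) = ereal (kr p)" unfolding d by (rule kr(3))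
    from AE_distrD[OF m this] show "AE x in P. K (x j) (x k) = ereal (kr (x j, x k))" by simp
  qed
  have "AE x in P. x i \<in> A" if "i < N" for i
    unfolding P_def using \<rho> that by (intro AE_PiM_component \<rho>.prob_space_axioms) auto
  then have "AE x in P. \<forall>i\<in>{..<N}. x i \<in> A" by (intro AE_finite_allI) auto
  moreover have "AE x in P. \<forall>j\<in>{..<N}. \<forall>k\<in>{..<N} - {j}. K (x j) (x k) = ereal (kr (x j, x k))"
    using pair(3) by (intro AE_finite_allI) auto
  moreover have "AE x in P. x \<in> space P" by simp
  ultimately have AE: "AE x in P. c \<le> (\<Sum>j<N. \<Sum>k\<in>{..<N} - {j}. kr (x j, x k))"
  proof eventually_elim
    case (elim x)
    \<comment> \<open>Points of the product space are extensional, as configurations in the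
      extensional function space are.\<close>
    then have "x \<in> {..<N} \<rightarrow>\<^sub>E A" by (auto simp: P_def space_PiM PiE_def)
    from c[OF this] have "ereal c \<le> (\<Sum>j<N. \<Sum>k\<in>{..<N} - {j}. ereal (kr (x j, x k)))" using elim(2) by simp
    then show ?case by simp
  qed
  have "c = (\<integral>x. c \<partial>P)" by (simp add: P.prob_space)
  also have "\<dots> \<le> (\<integral>x. (\<Sum>j<N. \<Sum>k\<in>{..<N} - {j}. kr (x j, x k)) \<partial>P)"
    by (intro integral_mono_AE Bochner_Integration.integrable_sum pair(1)) (use AE in auto)
  also have "\<dots> = (\<Sum>j<N. \<integral>x. (\<Sum>k\<in>{..<N} - {j}. kr (x j, x k)) \<partial>P)"
    by (intro Bochner_Integration.integral_sum Bochner_Integration.integrable_sum pair(1)) auto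
  also have "\<dots> = (\<Sum>j<N. \<Sum>k\<in>{..<N} - {j}. \<integral>x. kr (x j, x k) \<partial>P)"
    by (intro sum.cong refl Bochner_Integration.integral_sum pair(1)) auto
  also have "\<dots> = (\<Sum>j<N. \<Sum>k\<in>{..<N} - {j}. e)"
    by (intro sum.cong refl pair(2)) auto
  also have "\<dots> = real N * real (N - 1) * e" by (cases N) (auto simp: card_Diff_singleton)
  finally show ?thesis .
qed

lemma quad_LIMSEQ:
  assumes C: "\<And>w. w \<in> dual \<Longrightarrow> (\<lambda>k. C k w) \<longlonglongrightarrow> C' w" "\<And>k w. \<bar>C k w\<bar> \<le> 1"
    and S: "\<And>w. w \<in> dual \<Longrightarrow> (\<lambda>k. S k w) \<longlonglongrightarrow> S' w" "\<And>k w. \<bar>S k w\<bar> \<le> 1"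
  shows "(\<lambda>k. quad n (C k) (S k)) \<longlonglongrightarrow> quad n C' S'"
  unfolding quad_def
proof (rule integral_dominated_convergence)
  show "integrable (count_space dual) (\<lambda>w. \<bar>a n w\<bar> * 2)" using integrable_a[of n] by simp
  show "AE w in count_space dual. (\<lambda>k. a n w * ((C k w)\<^sup>2 + (S k w)\<^sup>2)) \<longlonglongrightarrow> a n w * ((C' w)\<^sup>2 + (S' w)\<^sup>2)"
    using C(1) S(1) by (auto simp: AE_count_space intro!: tendsto_intros)
  show "AE w in count_space dual. norm (a n w * ((C k w)\<^sup>2 + (S k w)\<^sup>2)) \<le> \<bar>a n w\<bar> * 2" for k
    using abs_sum_squares_le[OF C(2) S(2)] by (auto simp: AE_count_space abs_mult intro!: mult_left_mono)
qed auto

lemma abs_point_average_le: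
  assumes "\<And>z. \<bar>g z\<bar> \<le> 1" shows "\<bar>point_average N x g\<bar> \<le> 1"
proof -
  have "\<bar>\<Sum>i<N. g (x i)\<bar> \<le> (\<Sum>i<N. 1)" by (rule order_trans[OF sum_abs]) (intro sum_mono assms)
  then show ?thesis by (cases "N = 0") (simp_all add: point_average_def)
qed

text \<open>The order of limits matters: for fixed \<open>n\<close> the form \<open>quad n\<close>
  is continuous along the sequence and the diagonal contributes \<open>trunc n 0 / N k\<close>,
  which vanishes as \<open>k\<close> grows. Only then does \<open>n\<close> tend to
  infinity.\<close>

lemma energy_limit_le:
  fixes N :: "nat \<Rightarrow> nat"
  assumes \<rho>: "torus_prob \<rho>" "AE x in \<rho>. x \<in> A" and e: "energy \<rho> = ereal e" and \<nu>: "torus_prob \<nu>"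
    and N: "\<And>k. 1 \<le> N k" "filterlim N at_top sequentially"
    and min: "\<And>k y. y \<in> {..<N k} \<rightarrow>\<^sub>E A \<Longrightarrow>
      (\<Sum>i<N k. \<Sum>j\<in>{..<N k} - {i}. K (x k i) (x k j)) \<le> (\<Sum>i<N k. \<Sum>j\<in>{..<N k} - {i}. K (y i) (y j))"
    and lim: "\<And>g. continuous_on UNIV g \<Longrightarrow> periodic g \<Longrightarrow> (\<lambda>k. point_average (N k) (x k) g) \<longlonglongrightarrow> (\<integral>z. g z \<partial>\<nu>)"
  shows "energy \<nu> \<le> ereal e"
proof (rule LIMSEQ_le_const2[OF energy_LIMSEQ[OF \<nu>]], intro exI allI impI)
  fix n :: nat
  define q where "q k = quad n (\<lambda>w. point_average (N k) (x k) (\<lambda>z. cos (2 * pi * (w \<bullet> z))))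
    (\<lambda>w. point_average (N k) (x k) (\<lambda>z. sin (2 * pi * (w \<bullet> z))))" for k
  have q: "q \<longlonglongrightarrow> quad n (cos_coeff \<nu>) (sin_coeff \<nu>)"
    unfolding q_def[abs_def] cos_coeff_def[abs_def] sin_coeff_def[abs_def]
    by (intro quad_LIMSEQ lim abs_point_average_le continuous_intros periodic_cos periodic_sin) auto
  have q_le: "q k \<le> e + (trunc n 0 - e) / real (N k)" for k
  proof -
    \<comment> \<open>The truncated energy of the minimizer without the diagonal. It is real and a
      lower bound for every discrete energy, so the minimal energy need not be known to be
      finite.\<close>
    define c where "c = (\<Sum>i<N k. \<Sum>j\<in>{..<N k} - {i}. trunc n (x k i - x k j))"
    have "c \<le> real (N k) * real (N k - 1) * e"
    proof (rule discrete_energy_upper_bound[OF \<rho> e])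
      fix y assume y: "y \<in> {..<N k} \<rightarrow>\<^sub>E A"
      have "ereal c = (\<Sum>i<N k. \<Sum>j\<in>{..<N k} - {i}. ereal (trunc n (x k i - x k j)))" by (simp add: c_def)
      also have "\<dots> \<le> (\<Sum>i<N k. \<Sum>j\<in>{..<N k} - {i}. K (x k i) (x k j))" by (intro sum_mono trunc_le_kernel)
      also have "\<dots> \<le> (\<Sum>i<N k. \<Sum>j\<in>{..<N k} - {i}. K (y i) (y j))" by (rule min[OF y])
      finally show "ereal c \<le> (\<Sum>i<N k. \<Sum>j\<in>{..<N k} - {i}. K (y i) (y j))" .
    qed
    moreover have "(\<Sum>i<N k. \<Sum>j<N k. trunc n (x k i - x k j)) = real (N k) * trunc n 0 + c"
    proof -
      have "(\<Sum>j<N k. trunc n (x k i - x k j)) = trunc n 0 + (\<Sum>j\<in>{..<N k} - {i}. trunc n (x k i - x k j))" if "i < N k" for i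
        using that by (subst sum.remove[of _ i]) auto
      then show ?thesis by (simp add: c_def sum.distrib)
    qed
    ultimately have "q k \<le> (real (N k) * trunc n 0 + real (N k) * (real (N k) - 1) * e) / (real (N k))\<^sup>2"
      unfolding q_def quad_point_average[OF N(1)] using N(1)[of k] by (intro divide_right_mono) (auto simp: of_nat_diff)
    \<comment> \<open>The \<open>N k\<close> diagonal terms carry \<open>trunc n 0\<close> instead
      of \<open>e\<close>; after division by the square of \<open>N k\<close> the discrepancy is of
      order \<open>1 / N k\<close>.\<close>
    also have "\<dots> = e + (trunc n 0 - e) / real (N k)"
      using N(1)[of k] by (simp add: power2_eq_square field_simps)
    finally show ?thesis .
  qed
  have "(\<lambda>k. e + (trunc n 0 - e) / real (N k)) \<longlonglongrightarrow> e + 0"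
    by (rule tendsto_add[OF tendsto_const real_tendsto_divide_at_top[OF tendsto_const filterlim_compose[OF filterlim_real_sequentially N(2)]]])
  from LIMSEQ_le[OF q this] q_le have "quad n (cos_coeff \<nu>) (sin_coeff \<nu>) \<le> e + 0" by blast
  then show "ereal (quad n (cos_coeff \<nu>) (sin_coeff \<nu>)) \<le> ereal e" by simp
qed

theorem minimizers_converge:
  assumes A: "compactin (torus_topology V) A"
    and \<rho>: "torus_prob \<rho>" "torus_support V \<rho> \<subseteq> A"
    and min: "\<And>\<sigma>. torus_prob \<sigma> \<Longrightarrow> torus_support V \<sigma> \<subseteq> A \<Longrightarrow> energy \<rho> \<le> energy \<sigma>" and fin: "energy \<rho> < \<infinity>"
    and x: "\<And>N i. i < N \<Longrightarrow> x N i \<in> A"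
    and x_min: "\<And>N y. 1 \<le> N \<Longrightarrow> y \<in> {..<N} \<rightarrow>\<^sub>E A \<Longrightarrow>
      (\<Sum>i<N. \<Sum>j\<in>{..<N} - {i}. K (x N i) (x N j)) \<le> (\<Sum>i<N. \<Sum>j\<in>{..<N} - {i}. K (y i) (y j))"
    and g: "continuous_on UNIV g" "periodic g"
  shows "(\<lambda>N. point_average N (x N) g) \<longlonglongrightarrow> (\<integral>z. g z \<partial>\<rho>)"
proof (rule ccontr)
  assume "\<not> ?thesis"
  then obtain \<epsilon> where \<epsilon>: "\<epsilon> > 0" "\<And>m. \<exists>N\<ge>m. dist (point_average N (x N) g) (\<integral>z. g z \<partial>\<rho>) \<ge> \<epsilon>"
    unfolding lim_sequentially by (auto simp: not_less)
  \<comment> \<open>A subsequence that stays away from the limit. The bound \<open>Suc m\<close>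
    forces at least one point and makes the indices tend to infinity.\<close>
  define F where "F m = (SOME N. N \<ge> Suc m \<and> dist (point_average N (x N) g) (\<integral>z. g z \<partial>\<rho>) \<ge> \<epsilon>)" for m
  have F: "F m \<ge> Suc m" "dist (point_average (F m) (x (F m)) g) (\<integral>z. g z \<partial>\<rho>) \<ge> \<epsilon>" for m
    using someI_ex[OF \<epsilon>(2)[of "Suc m", unfolded Bex_def]] by (auto simp: F_def)
  have F1: "1 \<le> F m" for m using F(1)[of m] by simp
  have Ac: "A \<subseteq> cell" using compactin_subset_topspace[OF A] by (simp add: topspace_torus)
  obtain s \<nu> where s: "strict_mono s" and \<nu>: "torus_prob \<nu>"
    and lim: "\<And>h. continuous_on UNIV h \<Longrightarrow> periodic h \<Longrightarrow> (\<lambda>n. point_average (F (s n)) (x (F (s n))) h) \<longlonglongrightarrow> (\<integral>z. h z \<partial>\<nu>)"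
    using torus_measures_compact[of F "\<lambda>n. x (F n)"] x Ac F1 by blast
  have F_top: "filterlim (\<lambda>n. F (s n)) at_top sequentially"
  proof (rule filterlim_at_top_mono[OF filterlim_ident])
    show "eventually (\<lambda>n. n \<le> F (s n)) sequentially"
      using F(1) seq_suble[OF s] by (intro always_eventually allI) (meson Suc_leD order_trans)
  qed
  have supp: "torus_support V \<nu> \<subseteq> A"
    using torus_support_limit[where N="\<lambda>n. F (s n)" and x="\<lambda>n. x (F (s n))", OF A _ F1 \<nu> lim] x by simp
  obtain e where e: "energy \<rho> = ereal e"
    using fin quad_le_energy[OF \<rho>(1), of 0] by (cases "energy \<rho>") auto
  have "energy \<nu> \<le> energy \<rho>"
    unfolding e using energy_limit_le[where N="\<lambda>n. F (s n)" and x="\<lambda>n. x (F (s n))",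
      OF \<rho>(1) AE_torus_support[OF \<rho>] e \<nu> F1 F_top x_min[OF F1] lim] by simp
  \<comment> \<open>The subsequential limit is supported in \<open>A\<close> and has at most the
    minimal energy, so uniqueness applies and contradicts the distance
    \<open>\<epsilon>\<close>.\<close>
  then have "\<nu> = \<rho>" using energy_minimizer_unique[OF A \<rho> \<nu> supp min _ fin] by simp
  then have "(\<lambda>n. dist (point_average (F (s n)) (x (F (s n))) g) (\<integral>z. g z \<partial>\<rho>)) \<longlonglongrightarrow> 0"
    using lim[OF g] unfolding tendsto_dist_iff[symmetric] by simp
  then have "eventually (\<lambda>n. dist (point_average (F (s n)) (x (F (s n))) g) (\<integral>z. g z \<partial>\<rho>) < \<epsilon>) sequentially"
    using \<epsilon>(1) by (rule order_tendstoD(2))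
  then show False using F(2) by (auto simp: eventually_sequentially not_less[symmetric])
qed

end

section \<open>Translation to measures, weak convergence and the theorem\<close>

context unimodular_lattice
begin

lemma prob_measures_on_iff: "\<rho> \<in> prob_measures_on V A \<longleftrightarrow> torus_prob \<rho> \<and> torus_support V \<rho> \<subseteq> A"
  by (auto simp: prob_measures_on_def torus_prob_def)

lemma integral_normalized_counting_measure:
  assumes N: "1 \<le> N" and x: "\<And>i. i < N \<Longrightarrow> x i \<in> cell" and g: "continuous_on UNIV g" "periodic g"
  shows "(\<integral>z. g z \<partial>normalized_counting_measure V N x) = point_average N x g"
proof -
  have m: "x \<in> uniform_count_measure {..<N} \<rightarrow>\<^sub>M torus_borel V"
    using x by (auto simp: measurable_cong_sets[OF sets_uniform_count_measure_count_space refl])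
  have gm: "g \<in> borel_measurable (torus_borel V)"
    by (rule measurable_compose[OF id_measurable_torus_borel borel_measurable_continuous_onI[OF g(1)]])
  show ?thesis
    unfolding normalized_counting_measure_def
    by (subst integral_distr[OF m gm]) (simp add: integral_uniform_count_measure point_average_def)
qed

text \<open>Continuous functions on the torus and continuous periodic functions give the same test
  integrals, because \<open>cell_rep\<close> is the identity on the cell, where all measures
  live.\<close>

lemma weakly_converges_iff:
  assumes x: "\<And>N i. i < N \<Longrightarrow> x N i \<in> cell" and \<rho>: "torus_prob \<rho>"
  shows "weakly_converges V (\<lambda>N. normalized_counting_measure V N (x N)) \<rho> \<longleftrightarrow>
    (\<forall>g. continuous_on UNIV g \<longrightarrow> periodic g \<longrightarrow> (\<lambda>N. point_average N (x N) g) \<longlonglongrightarrow> (\<integral>z. g z \<partial>\<rho>))"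
proof -
  have eq: "(\<lambda>N. integral\<^sup>L (normalized_counting_measure V N (x N)) g) \<longlonglongrightarrow> L \<longleftrightarrow> (\<lambda>N. point_average N (x N) g) \<longlonglongrightarrow> L"
    if "continuous_on UNIV g" "periodic g" for g L
    using integral_normalized_counting_measure[OF _ x that]
    \<comment> \<open>Starting at 1 discards \<open>N = 0\<close>, where there are no points to
      average over.\<close>
    by (intro tendsto_cong eventually_sequentiallyI[of 1]) simp
  show ?thesis
  proof
    assume w: "weakly_converges V (\<lambda>N. normalized_counting_measure V N (x N)) \<rho>"
    show "\<forall>g. continuous_on UNIV g \<longrightarrow> periodic g \<longrightarrow> (\<lambda>N. point_average N (x N) g) \<longlonglongrightarrow> (\<integral>z. g z \<partial>\<rho>)"
    proof (intro allI impI)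
      fix g :: "real^'d \<Rightarrow> real" assume g: "continuous_on UNIV g" "periodic g"
      have "bounded (g ` cell)" using periodic_bounded[OF g] by (auto simp: bounded_iff)
      with w continuous_map_torus[OF g] show "(\<lambda>N. point_average N (x N) g) \<longlonglongrightarrow> (\<integral>z. g z \<partial>\<rho>)"
        unfolding weakly_converges_def eq[OF g, symmetric] by blast
    qed
  next
    assume lim: "\<forall>g. continuous_on UNIV g \<longrightarrow> periodic g \<longrightarrow> (\<lambda>N. point_average N (x N) g) \<longlonglongrightarrow> (\<integral>z. g z \<partial>\<rho>)"
    show "weakly_converges V (\<lambda>N. normalized_counting_measure V N (x N)) \<rho>"
      unfolding weakly_converges_def
    proof (intro allI impI, elim conjE)
      fix g :: "real^'d \<Rightarrow> real" assume "continuous_map (torus_topology V) euclideanreal g"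
      then have h: "continuous_on UNIV (\<lambda>x. g (cell_rep x))" by (rule continuous_on_comp_cell_rep)
      have "(\<integral>z. g (cell_rep z) \<partial>\<sigma>) = (\<integral>z. g z \<partial>\<sigma>)" if "space \<sigma> = cell" for \<sigma>
        using that by (intro Bochner_Integration.integral_cong) auto
      moreover have "space (normalized_counting_measure V N (x N)) = cell" for N
        by (simp add: normalized_counting_measure_def)
      moreover have "(\<lambda>N. \<integral>z. g (cell_rep z) \<partial>normalized_counting_measure V N (x N)) \<longlonglongrightarrow> (\<integral>z. g (cell_rep z) \<partial>\<rho>)"
        unfolding eq[OF h periodic_comp_cell_rep] using lim h periodic_comp_cell_rep by blast
      ultimately show "(\<lambda>N. integral\<^sup>L (normalized_counting_measure V N (x N)) g) \<longlonglongrightarrow> integral\<^sup>L \<rho> g"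
        using torus_probD(3)[OF \<rho>] by simp
    qed
  qed
qed

end

theorem corollary2p5:
  fixes V :: "real^'d^'d"
    and A :: "(real^'d) set"
    and f :: "real^'d \<Rightarrow> ereal"
    and \<mu> :: signed_measure
    and \<nu>f :: "(real^'d) measure"
    and \<omega> :: "nat \<Rightarrow> nat \<Rightarrow> real^'d"
  assumes "independent (columns V)" and "det V = 1"
    and "A \<subseteq> fundamental_cell V" and "infinite A" and "compactin (torus_topology V) A"
    and "weak_G_type V f \<mu>"
    and "\<forall>w \<in> dual_lattice V - {0}. signed_integral \<mu> {0<..} (dual_heat w) > 0"
    and "\<exists>\<rho> \<in> prob_measures_on V A. continuous_energy V \<mu> \<rho> < \<infinity>"
    and "\<nu>f \<in> prob_measures_on V A"
    and "\<forall>\<rho> \<in> prob_measures_on V A. continuous_energy V \<mu> \<nu>f \<le> continuous_energy V \<mu> \<rho>"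
    and "\<forall>N\<ge>1. \<omega> N \<in> {..<N} \<rightarrow>\<^sub>E A \<and>
           periodic_energy V \<mu> N (\<omega> N) = minimal_periodic_energy V \<mu> A N"
  shows "weakly_converges V (\<lambda>N. normalized_counting_measure V N (\<omega> N)) \<nu>f \<and>
    (\<forall>\<nu> \<in> prob_measures_on V (fundamental_cell V).
       weakly_converges V (\<lambda>N. normalized_counting_measure V N (\<omega> N)) \<nu> \<longrightarrow> \<nu> = \<nu>f)"
proof -
  interpret unimodular_lattice V by unfold_locales fact
  obtain a where a: "\<And>n. integrable (count_space dual) (a n)" "\<And>w. w \<in> dual \<Longrightarrow> incseq (\<lambda>n. a n w)"
    "\<And>w. w \<in> dual \<Longrightarrow> w \<noteq> 0 \<Longrightarrow> \<exists>n. a n w > 0"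
    "\<And>z. incseq (\<lambda>n. \<integral>w. a n w * cos (2 * pi * (w \<bullet> z)) \<partial>count_space dual)"
    "\<And>x y. (\<lambda>n. ereal (\<integral>w. a n w * cos (2 * pi * (w \<bullet> (x - y))) \<partial>count_space dual)) \<longlonglongrightarrow> periodic_kernel V \<mu> x y"
    using kernel_approximation[OF assms(6,7)] by blast
  interpret fourier_kernel V a "periodic_kernel V \<mu>" by unfold_locales (rule a; assumption?)+
  have energy_eq: "energy = continuous_energy V \<mu>" by (auto simp: energy_def continuous_energy_def)
  have \<nu>f: "torus_prob \<nu>f" "torus_support V \<nu>f \<subseteq> A" using assms(9) by (simp_all add: prob_measures_on_iff)
  \<comment> \<open>The condition \<open>i < N\<close> implies \<open>1 \<le> N\<close>, so the
    hypothesis on configurations applies.\<close>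
  have \<omega>: "\<omega> N i \<in> A" if "i < N" for N i
    using assms(11)[rule_format, of N] that by (auto dest: PiE_mem)
  have lim: "(\<lambda>N. point_average N (\<omega> N) g) \<longlonglongrightarrow> (\<integral>z. g z \<partial>\<nu>f)" if g: "continuous_on UNIV g" "periodic g" for g
  proof (rule minimizers_converge[OF assms(5) \<nu>f _ _ \<omega> _ g])
    show "energy \<nu>f \<le> energy \<sigma>" if "torus_prob \<sigma>" "torus_support V \<sigma> \<subseteq> A" for \<sigma>
      using assms(10) that by (simp add: energy_eq prob_measures_on_iff)
    show "energy \<nu>f < \<infinity>"
      using assms(8,10) unfolding energy_eq by (meson le_less_trans)
    fix N :: nat and y :: "nat \<Rightarrow> real^'d" assume "1 \<le> N" and y: "y \<in> {..<N} \<rightarrow>\<^sub>E A"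
    then have "periodic_energy V \<mu> N (\<omega> N) \<le> periodic_energy V \<mu> N y"
      using assms(11) by (auto simp: minimal_periodic_energy_def intro: INF_lower)
    then show "(\<Sum>i<N. \<Sum>j\<in>{..<N} - {i}. periodic_kernel V \<mu> (\<omega> N i) (\<omega> N j)) \<le>
        (\<Sum>i<N. \<Sum>j\<in>{..<N} - {i}. periodic_kernel V \<mu> (y i) (y j))"
      by (simp add: periodic_energy_def)
  qed
  have \<omega>_cell: "\<omega> N i \<in> cell" if "i < N" for N i using \<omega>[OF that] assms(3) by blast
  note weak = weakly_converges_iff[of \<omega>, OF \<omega>_cell]
  show ?thesis
  proof (intro conjI ballI impI)
    show "weakly_converges V (\<lambda>N. normalized_counting_measure V N (\<omega> N)) \<nu>f"
      using weak[OF _ \<nu>f(1)] lim by simp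
    fix \<nu> assume "\<nu> \<in> prob_measures_on V cell" and w: "weakly_converges V (\<lambda>N. normalized_counting_measure V N (\<omega> N)) \<nu>"
    then have \<nu>: "torus_prob \<nu>" by (simp add: prob_measures_on_iff)
    \<comment> \<open>A weak limit is unique among all probability measures on the torus, whatever
      their support, since continuous periodic functions determine such a measure.\<close>
    show "\<nu> = \<nu>f"
    proof (rule torus_prob_eqI[OF \<nu> \<nu>f(1)])
      fix g :: "real^'d \<Rightarrow> real" assume g: "continuous_on UNIV g" "periodic g"
      have "(\<lambda>N. point_average N (\<omega> N) g) \<longlonglongrightarrow> (\<integral>z. g z \<partial>\<nu>)" using weak[OF _ \<nu>] w g by simp
      then show "(\<integral>z. g z \<partial>\<nu>) = (\<integral>z. g z \<partial>\<nu>f)" using lim[OF g] by (rule LIMSEQ_unique)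
    qed
  qed
qed

end
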